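(* The problem of deciding, given a degree sequence $d$, whether $d$ admits a bipartite multigraph realization is NP-hard.
   Context: A degree sequence is a non-increasing sequence of positive integers with even sum (numbers encoded in binary). A bipartite multigraph realization of $d$ is a loopless multigraph (parallel edges allowed, no self-loops) whose underlying simple graph is bipartite and whose degree sequence equals $d$. *)

theory Defs
  imports "HOL-Library.Multiset" "HOL-Computational_Algebra.Polynomial"
begin

section \<open>Deterministic multi-tape Turing machines\<close>

text \<open>
  States and tape symbols are initial segments of the natural numbers.  Symbol 0 is the
  blank, symbols 1 and 2 are the bits.  Tapes are two-way infinite.
\<close>

datatype direction = Go_Left | Stay | Go_Right

record tm =
  tm_tapes :: nat
  tm_states :: nat
  tm_symbols :: nat
  tm_start :: nat
  tm_accept :: nat
  tm_reject :: nat
  tm_delta :: "nat \<Rightarrow> nat list \<Rightarrow> nat \<times> (nat \<times> direction) list"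

definition wf_tm :: "tm \<Rightarrow> bool" where
  "wf_tm M \<longleftrightarrow>
     1 \<le> tm_tapes M \<and> 3 \<le> tm_symbols M \<and>
     tm_start M < tm_states M \<and> tm_accept M < tm_states M \<and> tm_reject M < tm_states M \<and>
     tm_accept M \<noteq> tm_reject M \<and>
     (\<forall>q < tm_states M. \<forall>ss. length ss = tm_tapes M \<and> (\<forall>s \<in> set ss. s < tm_symbols M) \<longrightarrow>
        fst (tm_delta M q ss) < tm_states M \<and>
        length (snd (tm_delta M q ss)) = tm_tapes M \<and>
        (\<forall>(s, m) \<in> set (snd (tm_delta M q ss)). s < tm_symbols M))"

text \<open>A tape is a head position with the cell contents; a configuration is a state with the
  list of tapes.\<close>

type_synonym tape = "int \<times> (int \<Rightarrow> nat)"
type_synonym config = "nat \<times> tape list"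

fun move_head :: "direction \<Rightarrow> int \<Rightarrow> int" where
  "move_head Go_Left i = i - 1"
| "move_head Stay i = i"
| "move_head Go_Right i = i + 1"

fun read_tape :: "tape \<Rightarrow> nat" where
  "read_tape (i, c) = c i"

fun act_tape :: "nat \<times> direction \<Rightarrow> tape \<Rightarrow> tape" where
  "act_tape (s, m) (i, c) = (move_head m i, c(i := s))"

definition halted :: "tm \<Rightarrow> config \<Rightarrow> bool" where
  "halted M c \<longleftrightarrow> fst c = tm_accept M \<or> fst c = tm_reject M"

definition step_tm :: "tm \<Rightarrow> config \<Rightarrow> config" where
  "step_tm M c =
     (if halted M c then c
      else (let (q, acts) = tm_delta M (fst c) (map read_tape (snd c))
            in (q, map2 act_tape acts (snd c))))"

definition word_cells :: "bool list \<Rightarrow> int \<Rightarrow> nat" where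
  "word_cells w i =
     (if 0 \<le> i \<and> i < int (length w) then (if w ! nat i then 2 else 1) else 0)"

text \<open>The \<open>j\<close>-th input word is written on the \<open>j\<close>-th tape; the remaining tapes are blank.\<close>

definition init_config :: "tm \<Rightarrow> bool list list \<Rightarrow> config" where
  "init_config M ws =
     (tm_start M,
      map (\<lambda>j. (0, word_cells (if j < length ws then ws ! j else []))) [0..<tm_tapes M])"

definition run_tm :: "tm \<Rightarrow> bool list list \<Rightarrow> nat \<Rightarrow> config" where
  "run_tm M ws t = (step_tm M ^^ t) (init_config M ws)"

definition halts_within :: "tm \<Rightarrow> bool list list \<Rightarrow> nat \<Rightarrow> bool" where
  "halts_within M ws t \<longleftrightarrow> halted M (run_tm M ws t)"

definition accepts :: "tm \<Rightarrow> bool list list \<Rightarrow> bool" where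
  "accepts M ws \<longleftrightarrow> (\<exists>t. fst (run_tm M ws t) = tm_accept M)"

text \<open>The output is the entire content of the last tape, starting at cell 0.  Halting
  configurations are fixed points of the step function, so it suffices to look at the
  configuration reached after exactly \<open>t\<close> steps.\<close>

definition outputs_within :: "tm \<Rightarrow> bool list list \<Rightarrow> bool list \<Rightarrow> nat \<Rightarrow> bool" where
  "outputs_within M ws w t \<longleftrightarrow>
     halts_within M ws t \<and> snd (last (snd (run_tm M ws t))) = word_cells w"


section \<open>Polynomial time, NP and NP-hardness\<close>

definition polytime_computable :: "(bool list \<Rightarrow> bool list) \<Rightarrow> bool" where
  "polytime_computable f \<longleftrightarrow>
     (\<exists>M (p :: nat poly). wf_tm M \<and>
        (\<forall>x. outputs_within M [x] (f x) (poly p (length x))))"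

definition polytime_verifier :: "tm \<Rightarrow> bool" where
  "polytime_verifier V \<longleftrightarrow> wf_tm V \<and> 2 \<le> tm_tapes V \<and>
     (\<exists>p :: nat poly. \<forall>x u. halts_within V [x, u] (poly p (length x + length u)))"

definition NP :: "bool list set set" where
  "NP = {L. \<exists>V (q :: nat poly). polytime_verifier V \<and>
     (\<forall>x. x \<in> L \<longleftrightarrow> (\<exists>u. length u \<le> poly q (length x) \<and> accepts V [x, u]))}"

text \<open>A decision problem consists of the set \<open>I\<close> of its (encoded) instances and the set
  \<open>Y\<close> of its yes-instances.  A many-one reduction has to produce members of \<open>I\<close> only; for
  \<open>I = UNIV\<close> this is NP-hardness of the language \<open>Y\<close>.\<close>

definition NP_hard :: "bool list set \<Rightarrow> bool list set \<Rightarrow> bool" where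
  "NP_hard I Y \<longleftrightarrow>
     (\<forall>L \<in> NP. \<exists>f. polytime_computable f \<and> (\<forall>x. f x \<in> I \<and> (x \<in> L \<longleftrightarrow> f x \<in> Y)))"


section \<open>Degree sequences and their binary encoding\<close>

definition degree_sequence :: "nat list \<Rightarrow> bool" where
  "degree_sequence d \<longleftrightarrow>
     sorted_wrt (\<ge>) d \<and> (\<forall>x \<in> set d. 0 < x) \<and> even (sum_list d)"

text \<open>Binary digits, least significant digit first.\<close>

fun binary :: "nat \<Rightarrow> bool list" where
  "binary n = (if n = 0 then [] else odd n # binary (n div 2))"

declare binary.simps [simp del]

text \<open>Every digit is preceded by a 1, and every number is terminated by a 0.\<close>

definition encode_nat :: "nat \<Rightarrow> bool list" where
  "encode_nat n = concat (map (\<lambda>b. [True, b]) (binary n)) @ [False]"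

definition encode_seq :: "nat list \<Rightarrow> bool list" where
  "encode_seq d = concat (map encode_nat d)"

lemma binary_eq_Nil_iff: "binary n = [] \<longleftrightarrow> n = 0"
  by (subst binary.simps) simp

lemma binary_inject: "binary m = binary n \<Longrightarrow> m = n"
proof (induction m arbitrary: n rule: less_induct)
  case (less m)
  show ?case
  proof (cases "m = 0 \<or> n = 0")
    case True
    then show ?thesis
      using less.prems by (metis binary_eq_Nil_iff)
  next
    case False
    then have *: "odd m = odd n" "binary (m div 2) = binary (n div 2)"
      using less.prems by (auto simp: binary.simps[of m] binary.simps[of n])
    then have "m div 2 = n div 2"
      using less.IH[of "m div 2"] False by simp
    then show ?thesis
      using *(1) by presburger
  qed
qed

lemma encode_nat_append_inject:
  assumes "encode_nat m @ xs = encode_nat n @ ys"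
  shows "m = n \<and> xs = ys"
proof -
  have "concat (map (\<lambda>b. [True, b]) as) @ False # xs = concat (map (\<lambda>b. [True, b]) bs) @ False # ys
    \<Longrightarrow> as = bs \<and> xs = ys" for as bs
  proof (induction as arbitrary: bs)
    case Nil
    then show ?case by (cases bs) auto
  next
    case (Cons a as)
    then show ?case by (cases bs) auto
  qed
  from this[of "binary m" "binary n"] show ?thesis
    using assms binary_inject[of m n] by (simp add: encode_nat_def)
qed

lemma inj_encode_seq: "inj encode_seq"
proof (rule injI)
  fix d e
  show "encode_seq d = encode_seq e \<Longrightarrow> d = e"
  proof (induction d arbitrary: e)
    case Nil
    then show ?case by (cases e) (auto simp: encode_seq_def encode_nat_def)
  next
    case (Cons x d)
    then obtain y e' where e: "e = y # e'"
      by (cases e) (auto simp: encode_seq_def encode_nat_def)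
    with Cons show ?case
      using encode_nat_append_inject[of x "encode_seq d" y "encode_seq e'"]
      by (auto simp: encode_seq_def)
  qed
qed


section \<open>Bipartite multigraph realizations\<close>

text \<open>Parallel edges are repeated members of the multiset \<open>E\<close>; an edge is a two-element
  set of vertices, so there are no loops.\<close>

definition loopless_multigraph :: "'v set \<Rightarrow> 'v set multiset \<Rightarrow> bool" where
  "loopless_multigraph V E \<longleftrightarrow> finite V \<and> (\<forall>e \<in># E. e \<subseteq> V \<and> card e = 2)"

definition vertex_degree :: "'v set multiset \<Rightarrow> 'v \<Rightarrow> nat" where
  "vertex_degree E v = size {#e \<in># E. v \<in> e#}"

definition degrees_of :: "'v set \<Rightarrow> 'v set multiset \<Rightarrow> nat list" where
  "degrees_of V E = rev (sorted_list_of_multiset (image_mset (vertex_degree E) (mset_set V)))"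

definition bipartite :: "'v set \<Rightarrow> 'v set set \<Rightarrow> bool" where
  "bipartite V F \<longleftrightarrow>
     (\<exists>A B. A \<union> B = V \<and> A \<inter> B = {} \<and> (\<forall>e \<in> F. \<exists>a \<in> A. \<exists>b \<in> B. e = {a, b}))"

text \<open>The underlying simple graph has edge set \<open>set_mset E\<close>.  Every finite multigraph has an
  isomorphic copy on natural numbers.\<close>

definition bipartite_multigraph_realizable :: "nat list \<Rightarrow> bool" where
  "bipartite_multigraph_realizable d \<longleftrightarrow>
     (\<exists>(V :: nat set) E. loopless_multigraph V E \<and> bipartite V (set_mset E) \<and>
        degrees_of V E = d)"

end

theory Submission
  imports Defs "HOL-Library.Nat_Bijection"
begin

text \<open>A degree sequence has a bipartite multigraph realization iff the sum of the degrees in some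
  sub-collection is half of the total, as parallel edges make every pair of equal sums realizable.
  This is a partition problem, and the acceptance condition of a verifier is expressed in it
  directly.  Read in a base so large that no carries occur, balancing signs have to balance
  every digit row.  Tag digits group the numbers into items, each of which is either off
  or contributes a vector \<open>P - C\<close> of produced minus consumed tokens; the contributions have to sum up
  to zero.  Items connecting layer \<open>t\<close> of rows to layer \<open>t + 1\<close> are then transitions of a Petri net
  in which tokens may also be lost.  The net holds one token per tape cell and per head and one for
  the control state, guesses the certificate, and simulates the verifier, where losing a token can only
  block the simulation.  The reduction itself is a uniform printing task: nested loops with
  polynomial bounds, compiled to counter programs and these to a Turing machine.\<close>

section \<open>Realizability and partitions\<close>

text \<open>No number can be left out of a partition, and flipping all signs is a symmetry, so an
  item cannot simply be switched off. It therefore holds its content twice: one copy of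
  \<open>P - C\<close> is locked to a sign \<sigma> shared by all items, the other has a sign
  \<open>e\<close> of its own, and their sum is either 0 or 2 * \<sigma> times \<open>P - C\<close>;
  the common factor drops out of the equations. Another obstacle is that a degree sequence is
  sorted: the tags sit above the contents, so that the order of the numbers is the same whatever the
  contents are. Discarding is what makes the final marking known in advance: the row equations are
  exact, so the tokens left over at the end must be removed somehow. Losses are harmless because a
  transition only asks for tokens to be present; being below the true marking is thus an invariant.
  The base is a power of two whose exponent is computed in unary, so a number is a sequence of
  blocks of equal length and the reduction does no arithmetic on large numbers.\<close>

definition signed :: "(int \<times> 'a) list \<Rightarrow> bool" where
  "signed ps \<longleftrightarrow> (\<forall>(s, x) \<in> set ps. s = 1 \<or> s = -1)"

definition splits :: "nat list \<Rightarrow> bool" where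
  "splits d \<longleftrightarrow> (\<exists>ps. map snd ps = d \<and> signed ps \<and>
     (\<Sum>(s, x)\<leftarrow>ps. s * int x) = 0)"

lemma signed_simps [simp]:
  "signed []" "signed ((s, x) # ps) \<longleftrightarrow> (s = 1 \<or> s = -1) \<and> signed ps"
  "signed (ps @ qs) \<longleftrightarrow> signed ps \<and> signed qs"
  by (auto simp: signed_def)

text \<open>Equal numbers may be divided between the two parts, so the signs have to be chosen
  position by position along the list.\<close>

lemma signs_of_submultisets:
  assumes "mset d = M1 + M2"
  shows "\<exists>ps. map snd ps = d \<and> signed ps \<and>
     (\<Sum>(s, x)\<leftarrow>ps. s * int x) = int (\<Sum>\<^sub># M1) - int (\<Sum>\<^sub># M2)"
  using assms
proof (induction d arbitrary: M1 M2)
  case Nil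
  then show ?case by auto
next
  case (Cons x d)
  have "x \<in># M1 + M2" using Cons.prems by (metis list.set_intros(1) set_mset_mset)
  then consider "x \<in># M1" | "x \<in># M2" by auto
  then show ?case
  proof cases
    case 1
    then obtain M where M: "M1 = add_mset x M" by (metis mset_add)
    with Cons.prems have "mset d = M + M2" by simp
    from Cons.IH[OF this] obtain ps where "map snd ps = d" "signed ps"
      "(\<Sum>(s, x)\<leftarrow>ps. s * int x) = int (\<Sum>\<^sub># M) - int (\<Sum>\<^sub># M2)" by auto
    then show ?thesis using M by (intro exI[of _ "(1, x) # ps"]) auto
  next
    case 2
    then obtain M where M: "M2 = add_mset x M" by (metis mset_add)
    with Cons.prems have "mset d = M1 + M" by simp
    from Cons.IH[OF this] obtain ps where "map snd ps = d" "signed ps"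
      "(\<Sum>(s, x)\<leftarrow>ps. s * int x) = int (\<Sum>\<^sub># M1) - int (\<Sum>\<^sub># M)" by auto
    then show ?thesis using M by (intro exI[of _ "(-1, x) # ps"]) auto
  qed
qed

text \<open>Every edge has exactly one end in \<open>A\<close> and so adds one to exactly one of the
  degrees summed.\<close>

lemma sum_vertex_degree_bipartite:
  assumes "finite A" "\<And>e. e \<in># E \<Longrightarrow> \<exists>a \<in> A. \<exists>b. b \<notin> A \<and> e = {a, b}"
  shows "(\<Sum>v\<in>A. vertex_degree E v) = size E"
  using assms(2)
proof (induction E)
  case empty
  then show ?case by (simp add: vertex_degree_def)
next
  case (add e E)
  obtain a b where e: "a \<in> A" "b \<notin> A" "e = {a, b}" using add.prems[of e] by auto
  have "(\<Sum>v\<in>A. vertex_degree (add_mset e E) v) =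
      (\<Sum>v\<in>A. (if v = a then 1 else 0) + vertex_degree E v)"
    using e by (intro sum.cong) (auto simp: vertex_degree_def)
  also have "\<dots> = Suc (size E)"
    using add e(1) assms(1) by (simp add: sum.distrib)
  finally show ?case by simp
qed

lemma splits_if_realizable:
  assumes "bipartite_multigraph_realizable d"
  shows "splits d"
proof -
  obtain V :: "nat set" and E where VE: "loopless_multigraph V E" "bipartite V (set_mset E)"
    "degrees_of V E = d"
    using assms by (auto simp: bipartite_multigraph_realizable_def)
  obtain A B where AB: "A \<union> B = V" "A \<inter> B = {}" "\<forall>e \<in># E. \<exists>a\<in>A. \<exists>b\<in>B. e = {a, b}"
    using VE(2) by (auto simp: bipartite_def)
  have fin: "finite A" "finite B" using VE(1) AB(1) by (auto simp: loopless_multigraph_def)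
  have "mset d = image_mset (vertex_degree E) (mset_set (A \<union> B))"
    using VE(3) AB(1) by (auto simp: degrees_of_def)
  also have "\<dots> = image_mset (vertex_degree E) (mset_set A) + image_mset (vertex_degree E) (mset_set B)"
    using fin AB(2) by (simp add: mset_set_Union)
  finally obtain ps where ps: "map snd ps = d" "signed ps"
    "(\<Sum>(s, x)\<leftarrow>ps. s * int x) = int (\<Sum>v\<in>A. vertex_degree E v) - int (\<Sum>v\<in>B. vertex_degree E v)"
    using signs_of_submultisets[of d] unfolding sum_unfold_sum_mset by blast
  have "(\<Sum>v\<in>A. vertex_degree E v) = size E"
  proof (intro sum_vertex_degree_bipartite)
    fix e assume "e \<in># E"
    then obtain a b where "a \<in> A" "b \<in> B" "e = {a, b}" using AB(3) by blast
    then have "a \<in> A" "b \<notin> A" "e = {a, b}" using AB(2) by auto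
    then show "\<exists>a \<in> A. \<exists>b. b \<notin> A \<and> e = {a, b}" by blast
  qed (rule fin)
  moreover have "(\<Sum>v\<in>B. vertex_degree E v) = size E"
  proof (intro sum_vertex_degree_bipartite)
    fix e assume "e \<in># E"
    then obtain a b where "a \<in> A" "b \<in> B" "e = {a, b}" using AB(3) by blast
    then have "b \<in> B" "a \<notin> B" "e = {b, a}" using AB(2) by auto
    then show "\<exists>b \<in> B. \<exists>a. a \<notin> B \<and> e = {b, a}" by blast
  qed (rule fin)
  ultimately show ?thesis using ps by (auto simp: splits_def)
qed

lemma count_mset_concat_replicate:
  assumes "distinct is"
  shows "count (mset (concat (map (\<lambda>i. replicate (f i) i) is))) v = (if v \<in> set is then f v else 0)"
  using assms by (induction "is") auto

lemma size_filter_pairs: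
  assumes "length xs = length ys" "v \<notin> set ys"
  shows "size {#e \<in># mset (map2 (\<lambda>a b. {a, b}) xs ys). v \<in> e#} = count (mset xs) v"
  using assms by (induction xs ys rule: list_induct2) auto

lemma map2_pair_commute: "map2 (\<lambda>a b. {a, b}) xs ys = map2 (\<lambda>a b. {a, b}) ys xs"
  by (induction xs ys rule: list_induct2') auto

lemma sum_list_signs_filter:
  assumes "\<forall>i \<in> set is. f i = 1 \<or> f i = (-1::int)"
  shows "(\<Sum>i\<leftarrow>is. f i * int (g i)) =
    int (\<Sum>i\<leftarrow>filter (\<lambda>i. f i = 1) is. g i) - int (\<Sum>i\<leftarrow>filter (\<lambda>i. f i \<noteq> 1) is. g i)"
  using assms by (induction "is") auto

text \<open>Each index is written down as often as its degree demands. The lists of the two sides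
  then have equal length, and zipping them yields the edges.\<close>

lemma realizable_if_splits:
  assumes "splits d" "sorted_wrt (\<ge>) d"
  shows "bipartite_multigraph_realizable d"
proof -
  obtain ps where ps: "map snd ps = d" "signed ps"
    "(\<Sum>(s, x)\<leftarrow>ps. s * int x) = 0"
    using assms by (auto simp: splits_def)
  define n where "n = length d"
  have lps: "length ps = n" using ps(1) by (auto simp: n_def)
  define s where "s i = fst (ps ! i)" for i
  have dn: "d ! i = snd (ps ! i)" if "i < n" for i using ps(1) that lps by auto
  define ia where "ia = filter (\<lambda>i. s i = 1) [0..<n]"
  define ib where "ib = filter (\<lambda>i. s i \<noteq> 1) [0..<n]"
  define la where "la = concat (map (\<lambda>i. replicate (d ! i) i) ia)"
  define lb where "lb = concat (map (\<lambda>i. replicate (d ! i) i) ib)"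
  have "(\<Sum>(s, x)\<leftarrow>ps. s * int x) = (\<Sum>i\<leftarrow>[0..<n]. s i * int (d ! i))"
  proof -
    have "map (\<lambda>(s, x). s * int x) ps = map (\<lambda>i. s i * int (d ! i)) [0..<n]"
      using dn lps by (intro nth_equalityI) (auto simp: s_def split_beta)
    then show ?thesis by metis
  qed
  moreover have "\<forall>i\<in>set [0..<n]. s i = 1 \<or> s i = -1"
    using ps(2) lps by (auto simp: s_def signed_def split_beta)
  ultimately have "(\<Sum>i\<leftarrow>ia. d ! i) = (\<Sum>i\<leftarrow>ib. d ! i)"
    using ps(3) sum_list_signs_filter[of "[0..<n]" s "\<lambda>i. d ! i"] by (simp add: ia_def ib_def)
  then have len: "length la = length lb"
    by (simp add: la_def lb_def length_concat o_def)
  have sets: "set la \<subseteq> set ia" "set lb \<subseteq> set ib" by (auto simp: la_def lb_def)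
  have disj: "set ia \<inter> set ib = {}" "set ia \<union> set ib = {..<n}" by (auto simp: ia_def ib_def)
  define E where "E = mset (map2 (\<lambda>a b. {a, b}) la lb)"
  have pair: "\<exists>a\<in>set ia. \<exists>b\<in>set ib. e = {a, b}" if "e \<in># E" for e
  proof -
    have "e \<in> (\<lambda>(a, b). {a, b}) ` set (zip la lb)" using that by (simp add: E_def)
    then obtain p where p: "p \<in> set (zip la lb)" "e = (\<lambda>(a, b). {a, b}) p" by blast
    obtain a b where "p = (a, b)" by (cases p)
    with p have ab: "(a, b) \<in> set (zip la lb)" "e = {a, b}" by simp_all
    have "a \<in> set ia" "b \<in> set ib"
      using set_zip_leftD[OF ab(1)] set_zip_rightD[OF ab(1)] sets by blast+
    then show ?thesis using ab(2) by blast
  qed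
  have dist: "distinct ia" "distinct ib" by (auto simp: ia_def ib_def)
  have deg: "vertex_degree E v = d ! v" if "v < n" for v
  proof (cases "v \<in> set ia")
    case True
    then have "v \<notin> set lb" using sets disj by auto
    then show ?thesis using True size_filter_pairs[OF len] dist
      unfolding vertex_degree_def E_def by (simp add: la_def count_mset_concat_replicate)
  next
    case False
    then have "v \<in> set ib" "v \<notin> set la" using that sets disj by auto
    then show ?thesis using size_filter_pairs[OF len[symmetric]] dist
      unfolding vertex_degree_def E_def
      by (subst map2_pair_commute) (simp add: lb_def count_mset_concat_replicate)
  qed
  have "loopless_multigraph {..<n} E"
    using pair disj unfolding loopless_multigraph_def by (fastforce simp: card_insert_if)
  moreover have "bipartite {..<n} (set_mset E)"
    unfolding bipartite_def using disj pair by (intro exI[of _ "set ia"] exI[of _ "set ib"]) simp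
  moreover have "degrees_of {..<n} E = d"
  proof -
    have "image_mset (vertex_degree E) (mset_set {..<n}) = image_mset ((!) d) (mset_set {..<n})"
      by (intro image_mset_cong) (auto simp: deg)
    also have "\<dots> = mset (map ((!) d) [0..<n])"
      by (simp add: mset_map lessThan_atLeast0 flip: mset_upt)
    also have "map ((!) d) [0..<n] = d" by (simp add: n_def map_nth)
    finally have "degrees_of {..<n} E = rev (sort d)" by (simp add: degrees_of_def)
    also have "sort d = rev d"
      using assms(2) by (intro properties_for_sort) (auto simp: sorted_wrt_rev)
    finally show ?thesis by simp
  qed
  ultimately show ?thesis by (auto simp: bipartite_multigraph_realizable_def)
qed

section \<open>Balanced digit vectors\<close>

fun num :: "nat \<Rightarrow> bool list \<Rightarrow> nat" where
  "num B [] = 0"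
| "num B (b # bs) = of_bool b + B * num B bs"

text \<open>The factor \<open>2 ^ p\<close> turns each digit into a block of \<open>p\<close> zeros followed by the digit, and makes
  all values even for \<open>p > 0\<close>.\<close>

definition val :: "nat \<Rightarrow> bool list \<Rightarrow> nat" where
  "val p xs = 2 ^ p * num (2 ^ Suc p) xs"

text \<open>Rows beyond the end of a list count as zero, so lists of different lengths can be added
  and all rows can be quantified over.\<close>

definition dg :: "bool list \<Rightarrow> nat \<Rightarrow> int" where
  "dg xs r = of_bool (r < length xs \<and> xs ! r)"

definition rowsum :: "(int \<times> bool list) list \<Rightarrow> nat \<Rightarrow> int" where
  "rowsum ps r = (\<Sum>(s, xs)\<leftarrow>ps. s * dg xs r)"

definition balanced :: "bool list list \<Rightarrow> bool" where
  "balanced xss \<longleftrightarrow> (\<exists>ps. map snd ps = xss \<and> signed ps \<and> (\<forall>r. rowsum ps r = 0))"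

lemma rowsum_simps [simp]:
  "rowsum [] r = 0" "rowsum ((s, xs) # ps) r = s * dg xs r + rowsum ps r"
  "rowsum (ps @ qs) r = rowsum ps r + rowsum qs r"
  by (auto simp: rowsum_def)

lemma dg_append: "dg (xs @ ys) r = (if r < length xs then dg xs r else dg ys (r - length xs))"
  by (auto simp: dg_def nth_append)

lemma dg_replicate_False [simp]: "dg (replicate n False) r = 0"
  by (auto simp: dg_def)

lemma dg_Nil [simp]: "dg [] r = 0" and dg_Cons: "dg (b # bs) r = (if r = 0 then of_bool b else dg bs (r - 1))"
  by (auto simp: dg_def nth_Cons split: nat.splits)

lemma num_tl: "int (num B xs) = dg xs 0 + int B * int (num B (tl xs))"
  by (cases xs) (auto simp: dg_def)

lemma dg_tl: "dg (tl xs) r = dg xs (Suc r)"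
  by (cases xs) (auto simp: dg_def)

lemma abs_rowsum_le: "signed ps \<Longrightarrow> \<bar>rowsum ps r\<bar> \<le> int (length ps)"
proof (induction ps)
  case (Cons p ps)
  obtain s xs where "p = (s, xs)" by (cases p)
  moreover from this Cons.prems have "\<bar>s * dg xs r\<bar> \<le> 1" by (auto simp: dg_def)
  ultimately show ?case using Cons by auto
qed auto

lemma num_sum_tl:
  "(\<Sum>(s, xs)\<leftarrow>ps. s * int (num B xs)) =
    rowsum ps 0 + int B * (\<Sum>(s, xs)\<leftarrow>map (\<lambda>(s, xs). (s, tl xs)) ps. s * int (num B xs))"
proof (induction ps)
  case (Cons p ps)
  obtain s xs where "p = (s, xs)" by (cases p)
  then show ?case using Cons num_tl[of B xs] by (simp add: algebra_simps)
qed simp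

text \<open>If the total is 0, the lowest row sum is a multiple of \<open>B\<close>; it is smaller
  than \<open>B\<close> in absolute value since fewer than \<open>B\<close> signs occur. So it
  vanishes and the tails pose the same problem. The induction runs on a common length bound because
  all lists are shortened at once.\<close>

lemma num_sum_eq_0_iff:
  assumes "signed ps" "length ps < B" "\<forall>(s, xs) \<in> set ps. length xs \<le> n"
  shows "(\<Sum>(s, xs)\<leftarrow>ps. s * int (num B xs)) = 0 \<longleftrightarrow> (\<forall>r. rowsum ps r = 0)"
  using assms
proof (induction n arbitrary: ps)
  case 0
  have "(\<Sum>(s, xs)\<leftarrow>ps. s * int (num B xs)) = 0" "rowsum ps r = 0" for r
    using 0(3) by (induction ps) auto
  then show ?case by simp
next
  case (Suc n)
  define qs where "qs = map (\<lambda>(s, xs). (s, tl xs)) ps"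
  define V where "V = (\<Sum>(s, xs)\<leftarrow>qs. s * int (num B xs))"
  have "(\<Sum>(s, xs)\<leftarrow>ps. s * int (num B xs)) = rowsum ps 0 + int B * V"
    unfolding V_def qs_def by (rule num_sum_tl)
  moreover have "rowsum ps 0 + int B * V = 0 \<longleftrightarrow> rowsum ps 0 = 0 \<and> V = 0"
  proof
    assume *: "rowsum ps 0 + int B * V = 0"
    have "\<bar>rowsum ps 0\<bar> < int B" using abs_rowsum_le[OF Suc.prems(1), of 0] Suc.prems(2) by linarith
    moreover have "int B dvd rowsum ps 0" using * by (metis add.commute add_eq_0_iff dvd_minus_iff dvd_triv_left)
    ultimately have "rowsum ps 0 = 0" by (metis abs_of_nat dvd_imp_le_int linorder_not_le)
    with * Suc.prems(2) show "rowsum ps 0 = 0 \<and> V = 0" by auto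
  qed auto
  moreover have "V = 0 \<longleftrightarrow> (\<forall>r. rowsum qs r = 0)"
    unfolding V_def
  proof (rule Suc.IH)
    show "signed qs" using Suc.prems(1) by (auto simp: signed_def qs_def)
    show "length qs < B" using Suc.prems(2) by (simp add: qs_def)
    show "\<forall>(s, xs)\<in>set qs. length xs \<le> n" using Suc.prems(3) by (fastforce simp: qs_def)
  qed
  moreover have "rowsum qs r = rowsum ps (Suc r)" for r
    unfolding qs_def by (induction ps) (auto simp: dg_tl)
  ultimately show ?case by (metis not0_implies_Suc)
qed

lemma signed_sum_val:
  assumes "signed ps" "length ps < 2 ^ Suc p"
  shows "(\<Sum>(s, xs)\<leftarrow>ps. s * int (val p xs)) = 0 \<longleftrightarrow> (\<forall>r. rowsum ps r = 0)"
proof -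
  have "(\<Sum>(s, xs)\<leftarrow>ps. s * int (val p xs)) = 2 ^ p * (\<Sum>(s, xs)\<leftarrow>ps. s * int (num (2 ^ Suc p) xs))"
    by (induction ps) (auto simp: val_def algebra_simps)
  moreover have "\<forall>(s, xs)\<in>set ps. length xs \<le> Max (insert 0 ((length \<circ> snd) ` set ps))"
    by (auto intro!: Max_ge image_eqI)
  ultimately show ?thesis using num_sum_eq_0_iff[OF assms] by simp
qed

lemma splits_map_val_iff:
  assumes "length xss < 2 ^ Suc p"
  shows "splits (map (val p) xss) \<longleftrightarrow> balanced xss"
proof
  assume "splits (map (val p) xss)"
  then obtain ps where ps: "map snd ps = map (val p) xss" "signed ps"
    "(\<Sum>(s, x)\<leftarrow>ps. s * int x) = 0"
    unfolding splits_def by blast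
  define qs where "qs = zip (map fst ps) xss"
  have len: "length ps = length xss" using ps(1) by (metis length_map)
  then have qs: "map snd qs = xss" "length qs = length xss" by (auto simp: qs_def)
  have ps_eq: "ps = map (\<lambda>(s, xs). (s, val p xs)) qs"
  proof (rule nth_equalityI)
    fix i assume i: "i < length ps"
    then have "snd (ps ! i) = val p (xss ! i)" using ps(1) len by (metis nth_map)
    then show "ps ! i = map (\<lambda>(s, xs). (s, val p xs)) qs ! i"
      using i len by (simp add: qs_def prod_eq_iff)
  qed (simp add: len qs)
  have "signed qs" using ps(2) unfolding ps_eq signed_def by fastforce
  moreover from ps(3) have "(\<Sum>(s, xs)\<leftarrow>qs. s * int (val p xs)) = 0"
    unfolding ps_eq by (simp add: o_def split_def)
  ultimately have "\<forall>r. rowsum qs r = 0" using signed_sum_val assms qs(2) by metis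
  then show "balanced xss" using \<open>signed qs\<close> qs(1) by (auto simp: balanced_def)
next
  assume "balanced xss"
  then obtain qs where qs: "map snd qs = xss" "signed qs" "\<forall>r. rowsum qs r = 0"
    by (auto simp: balanced_def)
  then have "(\<Sum>(s, xs)\<leftarrow>qs. s * int (val p xs)) = 0"
    using signed_sum_val[of qs p] assms by auto
  then have "(\<Sum>(s, x)\<leftarrow>map (\<lambda>(s, xs). (s, val p xs)) qs. s * int x) = 0"
    by (simp add: o_def split_def)
  moreover have "map snd (map (\<lambda>(s, xs). (s, val p xs)) qs) = map (val p) xss"
    using qs(1) by auto
  moreover have "signed (map (\<lambda>(s, xs). (s, val p xs)) qs)"
    using qs(2) by (auto simp: signed_def)
  ultimately show "splits (map (val p) xss)" unfolding splits_def by blast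
qed

section \<open>Order and binary encoding of the values\<close>

lemma num_less: "2 \<le> B \<Longrightarrow> num B xs < B ^ length xs"
proof (induction xs)
  case (Cons b bs)
  then have "B * (num B bs + 1) \<le> B * B ^ length bs" by (intro mult_left_mono) auto
  moreover have "num B (b # bs) < B * (num B bs + 1)" using Cons.prems by (cases b) auto
  ultimately show ?case by simp
qed simp

lemma num_replicate_append: "num B (replicate n False @ xs) = B ^ n * num B xs"
  by (induction n) auto

lemma num_ge: "2 \<le> B \<Longrightarrow> xs \<noteq> [] \<Longrightarrow> last xs \<Longrightarrow> B ^ (length xs - 1) \<le> num B xs"
proof (induction xs)
  case (Cons b bs)
  show ?case
  proof (cases "bs = []")
    case False
    then have "B * B ^ (length bs - 1) \<le> B * num B bs" using Cons by (intro mult_left_mono) auto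
    also have "\<dots> \<le> num B (b # bs)" by simp
    also have "B * B ^ (length bs - 1) = B ^ (length (b # bs) - 1)" using False by (cases bs) auto
    finally show ?thesis .
  qed (use Cons in auto)
qed simp

text \<open>A leading digit 1 dominates everything shorter, so most of the sorting is decided by
  lengths, without looking at the contents.\<close>

lemma val_ge_shorter:
  assumes "length ys < length xs" "last xs"
  shows "val p ys \<le> val p xs"
proof -
  define B :: nat where "B = 2 ^ Suc p"
  have B: "2 \<le> B" by (simp add: B_def)
  have "num B ys < B ^ length ys" using B by (rule num_less)
  also have "\<dots> \<le> B ^ (length xs - 1)" using B assms(1) by (intro power_increasing) auto
  also have "\<dots> \<le> num B xs" using B assms by (intro num_ge) auto
  finally show ?thesis by (simp add: val_def B_def)
qed

text \<open>Among lists of one length with leading digit 1 the bare power is the least. This settles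
  the comparisons between numbers of equal length.\<close>

lemma val_ge_power:
  assumes "length xs = Suc n" "last xs"
  shows "val p (replicate n False @ [True]) \<le> val p xs"
proof -
  define B :: nat where "B = 2 ^ Suc p"
  have "2 \<le> B" "xs \<noteq> []" using assms by (auto simp: B_def)
  from num_ge[OF this assms(2)] assms(1)
  have "num B (replicate n False @ [True]) \<le> num B xs" by (simp add: num_replicate_append)
  then show ?thesis by (simp add: val_def B_def)
qed

lemma val_pos: "xs \<noteq> [] \<Longrightarrow> last xs \<Longrightarrow> 0 < val p xs"
  using num_ge[of "2 ^ Suc p" xs] unfolding val_def
  by (metis gr0I le_zero_eq mult_is_0 power_not_zero zero_neq_numeral power_Suc one_le_power one_le_numeral mult_le_mono2 mult.right_neutral)

lemma even_val: "0 < p \<Longrightarrow> even (val p xs)"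
  by (simp add: val_def)

text \<open>\<open>encode_nat\<close> puts a True before every binary digit, so
  \<open>[True, False]\<close> is an encoded zero digit: each digit becomes \<open>p\<close> of
  these followed by its own pair.\<close>

definition expand :: "nat \<Rightarrow> bool list \<Rightarrow> bool list" where
  "expand p xs = concat (map (\<lambda>b. concat (replicate p [True, False]) @ [True, b]) xs)"

lemma expand_simps [simp]:
  "expand p [] = []" "expand p (b # bs) = concat (replicate p [True, False]) @ True # b # expand p bs"
  "expand p (xs @ ys) = expand p xs @ expand p ys"
  by (auto simp: expand_def)

lemma expand_concat: "expand p (concat xss) = concat (map (expand p) xss)"
  by (induction xss) auto

lemma binary_double: "0 < n \<Longrightarrow> binary (2 * n) = False # binary n"
  by (subst binary.simps) auto

lemma binary_power_mult: "0 < n \<Longrightarrow> binary (2 ^ k * n) = replicate k False @ binary n"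
  by (induction k) (auto simp: binary_double mult.assoc)

lemma binary_of_bool_add: "0 < n \<or> b \<Longrightarrow> binary (of_bool b + 2 * n) = b # binary n"
  by (subst binary.simps) auto

text \<open>Lists start with the least significant digit; the last one has to be 1 because
  \<open>binary\<close> produces no leading zeros.\<close>

lemma binary_val:
  assumes "xs = [] \<or> last xs"
  shows "binary (val p xs) = concat (map (\<lambda>b. replicate p False @ [b]) xs)"
  using assms
proof (induction xs)
  case Nil
  then show ?case by (simp add: val_def binary.simps)
next
  case (Cons b bs)
  have pos: "0 < val p bs \<or> b" using Cons.prems val_pos[of bs p] by (auto split: if_splits)
  have "val p (b # bs) = 2 ^ p * (of_bool b + 2 * val p bs)"
    by (simp add: val_def algebra_simps)
  also have "binary \<dots> = replicate p False @ binary (of_bool b + 2 * val p bs)"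
    using pos by (intro binary_power_mult) auto
  also have "binary (of_bool b + 2 * val p bs) = b # binary (val p bs)"
    using pos by (rule binary_of_bool_add)
  finally show ?case using Cons by (auto split: if_splits)
qed

lemma encode_nat_val:
  assumes "xs = [] \<or> last xs"
  shows "encode_nat (val p xs) = expand p xs @ [False]"
proof -
  have "concat (map (\<lambda>b. [True, b]) (concat (map (\<lambda>b. replicate p False @ [b]) xs))) = expand p xs"
    by (induction xs) (auto simp: map_replicate_const)
  then show ?thesis using binary_val[OF assms] by (simp add: encode_nat_def)
qed

section \<open>Chains of items\<close>

text \<open>\<open>k\<close> is the number of items that follow.  Each item owns four rows of tags, ordered
  downwards so that the numbers come out sorted; the topmost bit of its first number is the
  lowest tag row of the preceding item, which forces the numbers with content \<open>P\<close> (\<open>C\<close>) and no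
  counterpart to carry one and the same (the opposite) sign.\<close>

definition item :: "nat \<Rightarrow> bool \<Rightarrow> bool list \<Rightarrow> bool list \<Rightarrow> nat \<Rightarrow> bool list list" where
  "item R free P C k = (let z = replicate (4 * k) False in
     if free then
       [P @ z @ [False, False, False, True, True], C @ z @ [True, False, False, True],
        P @ z @ [False, True, True], replicate R False @ z @ [False, False, True], C @ z @ [False, True]]
     else
       [P @ z @ [False, False, False, True, True], C @ z @ [False, False, True, True],
        P @ z @ [False, True, True], C @ z @ [True, True]])"

text \<open>The closing number has no content. It fixes the common sign, being the partner of the
  last item in that item's lowest tag row.\<close>

fun nums :: "nat \<Rightarrow> ('l \<Rightarrow> bool) \<Rightarrow> ('l \<Rightarrow> bool list) \<Rightarrow> ('l \<Rightarrow> bool list) \<Rightarrow> 'l list \<Rightarrow> bool list list" where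
  "nums R fr P C [] = [replicate R False @ [True]]"
| "nums R fr P C (l # ls) = item R (fr l) (P l) (C l) (length ls) @ nums R fr P C ls"

text \<open>The two numbers in front have no content. The first absorbs the sign that the topmost
  tag row of the chain leaves over, the second cancels the top digit of the first.\<close>

definition all_nums :: "nat \<Rightarrow> ('l \<Rightarrow> bool) \<Rightarrow> ('l \<Rightarrow> bool list) \<Rightarrow> ('l \<Rightarrow> bool list) \<Rightarrow> 'l list \<Rightarrow> bool list list" where
  "all_nums R fr P C ls =
     (let z = replicate (R + 4 * length ls) False in [z @ [True, True], z @ [False, True]]) @ nums R fr P C ls"

lemma dg_content:
  assumes "length P = R"
  shows "dg (P @ replicate n False @ pat) r =
    (if r < R then dg P r else if r < R + n then 0 else dg pat (r - R - n))"
  using assms by (auto simp: dg_append)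

definition contents :: "nat \<Rightarrow> ('l \<Rightarrow> bool list) \<Rightarrow> ('l \<Rightarrow> bool list) \<Rightarrow> 'l set \<Rightarrow> bool" where
  "contents R P C A \<longleftrightarrow> (\<forall>l \<in> A. length (P l) = R \<and> length (C l) = R)"

lemma contents_insert [simp]:
  "contents R P C (insert l A) \<longleftrightarrow> length (P l) = R \<and> length (C l) = R \<and> contents R P C A"
  by (auto simp: contents_def)

lemma rowsum_above:
  assumes "\<forall>xs \<in> snd ` set ps. length xs \<le> r"
  shows "rowsum ps r = 0"
  using assms by (induction ps) (auto simp: dg_def)

lemma length_nums:
  assumes "contents R P C (set ls)" "xs \<in> set (nums R fr P C ls)"
  shows "length xs \<le> R + 4 * length ls + 1"
  using assms
proof (induction ls)
  case (Cons l ls)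
  from Cons.prems(2) consider "xs \<in> set (item R (fr l) (P l) (C l) (length ls))" | "xs \<in> set (nums R fr P C ls)"
    by auto
  then show ?case
  proof cases
    case 1
    then show ?thesis using Cons.prems(1) by (auto simp: item_def Let_def split: if_splits)
  qed (use Cons in fastforce)
qed simp

lemma map_snd_eq_ConsE:
  assumes "map snd ps = x # xs"
  obtains s qs where "ps = (s, x) # qs" "map snd qs = xs"
  using assms by (cases ps) auto

lemma rowsum_above_nums:
  assumes "contents R P C (set ls)" "map snd qs = nums R fr P C ls" "R + 4 * length ls < r"
  shows "rowsum qs r = 0"
proof (rule rowsum_above, rule ballI)
  fix xs assume "xs \<in> snd ` set qs"
  then have "xs \<in> set (nums R fr P C ls)" by (metis assms(2) set_map)
  from length_nums[OF assms(1) this] assms(3) show "length xs \<le> r" by simp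
qed

text \<open>Only row \<open>R + 4 * length ls\<close> is left unbalanced; its sum \<sigma> is met by
  the item in front in its lowest tag row, and that item hands the same \<sigma> on in its topmost
  row. In a free item the four tag equations give the first \<open>P\<close> and \<open>C\<close>
  the signs \<sigma> and \<open>-\<sigma>\<close> and the second pair opposite signs that stay free;
  in a constant item they determine all four signs.\<close>

lemma rowsum_nums_sound:
  assumes "distinct ls" "contents R P C (set ls)" "map snd ps = nums R fr P C ls" "signed ps"
    "\<And>r. R \<le> r \<Longrightarrow> r < R + 4 * length ls \<Longrightarrow> rowsum ps r = 0"
  shows "\<exists>e \<sigma>. (\<sigma> = 1 \<or> \<sigma> = -1) \<and> rowsum ps (R + 4 * length ls) = \<sigma> \<and>
    (\<forall>l \<in> set ls. (e l = 1 \<or> e l = -1) \<and> (\<not> fr l \<longrightarrow> e l = \<sigma>)) \<and>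
    (\<forall>r<R. rowsum ps r = (\<Sum>l \<in> set ls. (e l + \<sigma>) * (dg (P l) r - dg (C l) r)))"
  using assms
proof (induction ls arbitrary: ps)
  case Nil
  then obtain s where "ps = [(s, replicate R False @ [True])]"
    by (auto elim!: map_snd_eq_ConsE)
  then show ?case using Nil.prems(4) by (auto simp: dg_append dg_Cons)
next
  case (Cons l ls)
  define k where "k = length ls"
  have len: "length (P l) = R" "length (C l) = R" "length (replicate R False) = R"
    using Cons.prems by auto
  note dgs = len[THEN dg_content]
  show ?case
  proof (cases "fr l")
    case True
    then have "map snd ps = item R True (P l) (C l) k @ nums R fr P C ls"
      using Cons.prems by (simp add: k_def)
    then obtain s1 s2 s3 s4 s5 qs where qs: "map snd qs = nums R fr P C ls" and
      ps: "ps = (s1, P l @ replicate (4 * k) False @ [False, False, False, True, True]) #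
        (s2, C l @ replicate (4 * k) False @ [True, False, False, True]) #
        (s3, P l @ replicate (4 * k) False @ [False, True, True]) #
        (s4, replicate R False @ replicate (4 * k) False @ [False, False, True]) #
        (s5, C l @ replicate (4 * k) False @ [False, True]) # qs"
      unfolding item_def Let_def if_True if_False append_Cons append_Nil
      by (elim map_snd_eq_ConsE) (simp only:)
    have above: "rowsum qs r = 0" if "r > R + 4 * k" for r
      using that Cons.prems(2) by (intro rowsum_above_nums[OF _ qs]) (auto simp: k_def)
    have rows: "rowsum qs r = 0" if "R \<le> r" "r < R + 4 * length ls" for r
      using Cons.prems(5)[of r] that by (simp add: ps dgs k_def)
    have "distinct ls" "contents R P C (set ls)" "signed qs"
      using Cons.prems by (simp_all add: ps)
    from Cons.IH[OF this(1,2) qs this(3) rows] obtain e \<sigma> where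
      e: "\<sigma> = 1 \<or> \<sigma> = -1" "rowsum qs (R + 4 * k) = \<sigma>"
        "\<forall>l \<in> set ls. (e l = 1 \<or> e l = -1) \<and> (\<not> fr l \<longrightarrow> e l = \<sigma>)"
        "\<forall>r<R. rowsum qs r = (\<Sum>l \<in> set ls. (e l + \<sigma>) * (dg (P l) r - dg (C l) r))"
      unfolding k_def by blast
    have "s2 = - \<sigma>" using Cons.prems(5)[of "R + 4 * k"] e(2) by (simp add: ps dgs dg_Cons k_def)
    moreover have "s5 = - s3" using Cons.prems(5)[of "R + 4 * k + 1"] above by (simp add: ps dgs dg_Cons k_def)
    moreover have "s4 = - s3" using Cons.prems(5)[of "R + 4 * k + 2"] above by (simp add: ps dgs dg_Cons k_def)
    moreover have "s1 = - s2" using Cons.prems(5)[of "R + 4 * k + 3"] above by (simp add: ps dgs dg_Cons k_def)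
    moreover have "rowsum ps (R + 4 * length (l # ls)) = s1" using above by (simp add: ps dgs dg_Cons k_def)
    moreover have "s3 = 1 \<or> s3 = -1" using Cons.prems(4) by (simp add: ps)
    moreover have "(\<Sum>l' \<in> set ls. ((e(l := s3)) l' + \<sigma>) * (dg (P l') r - dg (C l') r)) =
      (\<Sum>l' \<in> set ls. (e l' + \<sigma>) * (dg (P l') r - dg (C l') r))" for r
      using Cons.prems(1) by (intro sum.cong) auto
    ultimately show ?thesis using e Cons.prems(1) True
      by (intro exI[of _ "e(l := s3)"] exI[of _ \<sigma>]) (auto simp: ps dgs algebra_simps)
  next
    case False
    then have "map snd ps = item R False (P l) (C l) k @ nums R fr P C ls"
      using Cons.prems by (simp add: k_def)
    then obtain s1 s2 s3 s4 qs where qs: "map snd qs = nums R fr P C ls" and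
      ps: "ps = (s1, P l @ replicate (4 * k) False @ [False, False, False, True, True]) #
        (s2, C l @ replicate (4 * k) False @ [False, False, True, True]) #
        (s3, P l @ replicate (4 * k) False @ [False, True, True]) #
        (s4, C l @ replicate (4 * k) False @ [True, True]) # qs"
      unfolding item_def Let_def if_True if_False append_Cons append_Nil
      by (elim map_snd_eq_ConsE) (simp only:)
    have above: "rowsum qs r = 0" if "r > R + 4 * k" for r
      using that Cons.prems(2) by (intro rowsum_above_nums[OF _ qs]) (auto simp: k_def)
    have rows: "rowsum qs r = 0" if "R \<le> r" "r < R + 4 * length ls" for r
      using Cons.prems(5)[of r] that by (simp add: ps dgs k_def)
    have "distinct ls" "contents R P C (set ls)" "signed qs"
      using Cons.prems by (simp_all add: ps)
    from Cons.IH[OF this(1,2) qs this(3) rows] obtain e \<sigma> where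
      e: "\<sigma> = 1 \<or> \<sigma> = -1" "rowsum qs (R + 4 * k) = \<sigma>"
        "\<forall>l \<in> set ls. (e l = 1 \<or> e l = -1) \<and> (\<not> fr l \<longrightarrow> e l = \<sigma>)"
        "\<forall>r<R. rowsum qs r = (\<Sum>l \<in> set ls. (e l + \<sigma>) * (dg (P l) r - dg (C l) r))"
      unfolding k_def by blast
    have "s4 = - \<sigma>" using Cons.prems(5)[of "R + 4 * k"] e(2) by (simp add: ps dgs dg_Cons k_def)
    moreover have "s4 = - s3" using Cons.prems(5)[of "R + 4 * k + 1"] above by (simp add: ps dgs dg_Cons k_def)
    moreover have "s3 = - s2" using Cons.prems(5)[of "R + 4 * k + 2"] above by (simp add: ps dgs dg_Cons k_def)
    moreover have "s1 = - s2" using Cons.prems(5)[of "R + 4 * k + 3"] above by (simp add: ps dgs dg_Cons k_def)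
    moreover have "rowsum ps (R + 4 * length (l # ls)) = s1" using above by (simp add: ps dgs dg_Cons k_def)
    moreover have "(\<Sum>l' \<in> set ls. ((e(l := \<sigma>)) l' + \<sigma>) * (dg (P l') r - dg (C l') r)) =
      (\<Sum>l' \<in> set ls. (e l' + \<sigma>) * (dg (P l') r - dg (C l') r))" for r
      using Cons.prems(1) by (intro sum.cong) auto
    ultimately show ?thesis using e Cons.prems(1) False
      by (intro exI[of _ "e(l := \<sigma>)"] exI[of _ \<sigma>]) (auto simp: ps dgs algebra_simps)
  qed
qed

lemma rowsum_nums_complete:
  assumes "distinct ls" "contents R P C (set ls)" "\<sigma> = 1 \<or> \<sigma> = -1"
    "\<And>l. l \<in> set ls \<Longrightarrow> (e l = 1 \<or> e l = -1) \<and> (\<not> fr l \<longrightarrow> e l = \<sigma>)"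
  shows "\<exists>ps. map snd ps = nums R fr P C ls \<and> signed ps \<and>
    (\<forall>r \<ge> R. rowsum ps r = (if r = R + 4 * length ls then \<sigma> else 0)) \<and>
    (\<forall>r<R. rowsum ps r = (\<Sum>l \<in> set ls. (e l + \<sigma>) * (dg (P l) r - dg (C l) r)))"
  using assms
proof (induction ls)
  case Nil
  then show ?case
    by (intro exI[of _ "[(\<sigma>, replicate R False @ [True])]"]) (auto simp: dg_append dg_Cons)
next
  case (Cons l ls)
  define k where "k = length ls"
  have len: "length (P l) = R" "length (C l) = R" "length (replicate R False) = R"
    using Cons.prems by auto
  note dgs = len[THEN dg_content]
  have "distinct ls" "contents R P C (set ls)" "l' \<in> set ls \<Longrightarrow> (e l' = 1 \<or> e l' = -1) \<and> (\<not> fr l' \<longrightarrow> e l' = \<sigma>)" for l'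
    using Cons.prems by auto
  from Cons.IH[OF this(1,2) Cons.prems(3) this(3)]
  obtain qs where qs: "map snd qs = nums R fr P C ls" "signed qs"
    "\<forall>r \<ge> R. rowsum qs r = (if r = R + 4 * k then \<sigma> else 0)"
    "\<forall>r<R. rowsum qs r = (\<Sum>l \<in> set ls. (e l + \<sigma>) * (dg (P l) r - dg (C l) r))"
    unfolding k_def by blast
  define s where "s = e l"
  have s: "s = 1 \<or> s = -1" using Cons.prems(4)[of l] by (simp add: s_def)
  \<comment> \<open>An item touches the tag rows at offsets 0 to 4 from \<open>R + 4 * k\<close>;
    above them everything is zero.\<close>
  have small: "x = 0 \<or> x = 1 \<or> x = 2 \<or> x = 3 \<or> x = 4 \<or> x > 4" for x :: nat by arith
  show ?case
  proof (cases "fr l")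
    case True
    define ps where "ps = (\<sigma>, P l @ replicate (4 * k) False @ [False, False, False, True, True]) #
        (-\<sigma>, C l @ replicate (4 * k) False @ [True, False, False, True]) #
        (s, P l @ replicate (4 * k) False @ [False, True, True]) #
        (-s, replicate R False @ replicate (4 * k) False @ [False, False, True]) #
        (-s, C l @ replicate (4 * k) False @ [False, True]) # qs"
    have "rowsum ps r = (if r = R + 4 * length (l # ls) then \<sigma> else 0)" if "R \<le> r" for r
    proof (cases "r < R + 4 * k")
      case False
      then obtain j where "r = R + 4 * k + j" using le_Suc_ex linorder_not_less by blast
      then show ?thesis using that qs(3) small[of j] by (auto simp: ps_def dgs dg_Cons k_def)
    qed (use that qs(3) in \<open>auto simp: ps_def dgs k_def\<close>)
    moreover have "map snd ps = nums R fr P C (l # ls)"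
      using True qs(1) by (simp add: ps_def item_def k_def Let_def)
    moreover have "signed ps" using qs(2) s Cons.prems(3) by (auto simp: ps_def)
    ultimately show ?thesis using qs(4) Cons.prems(1)
      by (intro exI[of _ ps]) (auto simp: ps_def dgs s_def algebra_simps)
  next
    case False
    have s\<sigma>: "e l = \<sigma>" using False Cons.prems(4)[of l] by simp
    define ps where "ps = (\<sigma>, P l @ replicate (4 * k) False @ [False, False, False, True, True]) #
        (-\<sigma>, C l @ replicate (4 * k) False @ [False, False, True, True]) #
        (\<sigma>, P l @ replicate (4 * k) False @ [False, True, True]) #
        (-\<sigma>, C l @ replicate (4 * k) False @ [True, True]) # qs"
    have "rowsum ps r = (if r = R + 4 * length (l # ls) then \<sigma> else 0)" if "R \<le> r" for r
    proof (cases "r < R + 4 * k")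
      case False
      then obtain j where "r = R + 4 * k + j" using le_Suc_ex linorder_not_less by blast
      then show ?thesis using that qs(3) small[of j] by (auto simp: ps_def dgs dg_Cons k_def)
    qed (use that qs(3) in \<open>auto simp: ps_def dgs k_def\<close>)
    moreover have "map snd ps = nums R fr P C (l # ls)"
      using False qs(1) by (simp add: ps_def item_def k_def Let_def)
    moreover have "signed ps" using qs(2) s Cons.prems(3) by (auto simp: ps_def)
    ultimately show ?thesis using qs(4) Cons.prems(1) s\<sigma>
      by (intro exI[of _ ps]) (auto simp: ps_def dgs algebra_simps)
  qed
qed

text \<open>An item counts as on if its free sign agrees with the common one. Then
  \<open>e l + \<sigma>\<close> is \<open>2 * \<sigma>\<close>, otherwise it is 0, and the factor
  \<open>2 * \<sigma>\<close> cancels from every row.\<close>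

lemma balanced_all_nums_iff:
  assumes "distinct ls" "contents R P C (set ls)"
  shows "balanced (all_nums R fr P C ls) \<longleftrightarrow>
    (\<exists>on. (\<forall>l \<in> set ls. \<not> fr l \<longrightarrow> on l) \<and>
      (\<forall>r<R. (\<Sum>l \<in> set ls. of_bool (on l) * (dg (P l) r - dg (C l) r)) = 0))"
proof
  define n where "n = R + 4 * length ls"
  assume "balanced (all_nums R fr P C ls)"
  then obtain ps where ps: "map snd ps = all_nums R fr P C ls" "signed ps" "\<forall>r. rowsum ps r = 0"
    by (auto simp: balanced_def)
  then obtain s1 s2 qs where qs: "map snd qs = nums R fr P C ls" and
    ps_eq: "ps = (s1, replicate n False @ [True, True]) # (s2, replicate n False @ [False, True]) # qs"
    unfolding all_nums_def Let_def n_def append_Cons append_Nil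
    by (elim map_snd_eq_ConsE) (simp only:)
  have row: "rowsum qs r = 0" if "r < n" for r
    using ps(3)[rule_format, of r] that by (auto simp: ps_eq dg_append)
  obtain e \<sigma> where e: "\<sigma> = 1 \<or> \<sigma> = -1"
        "\<forall>l \<in> set ls. (e l = 1 \<or> e l = -1) \<and> (\<not> fr l \<longrightarrow> e l = \<sigma>)"
        "\<forall>r<R. rowsum qs r = (\<Sum>l \<in> set ls. (e l + \<sigma>) * (dg (P l) r - dg (C l) r))"
    using rowsum_nums_sound[OF assms qs] ps(2) row by (auto simp: ps_eq n_def)
  define on where "on l \<longleftrightarrow> e l = \<sigma>" for l
  have "(\<Sum>l \<in> set ls. (e l + \<sigma>) * (dg (P l) r - dg (C l) r)) =
     2 * \<sigma> * (\<Sum>l \<in> set ls. of_bool (on l) * (dg (P l) r - dg (C l) r))" for r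
    unfolding sum_distrib_left
  proof (intro sum.cong refl)
    fix l assume "l \<in> set ls"
    then have "e l = 1 \<or> e l = -1" using e(2) by blast
    then show "(e l + \<sigma>) * (dg (P l) r - dg (C l) r) = 2 * \<sigma> * (of_bool (on l) * (dg (P l) r - dg (C l) r))"
      using e(1) by (auto simp: on_def)
  qed
  then have "(\<Sum>l \<in> set ls. of_bool (on l) * (dg (P l) r - dg (C l) r)) = 0" if "r < R" for r
    using row[of r] e(1,3) that by (auto simp: n_def)
  then show "\<exists>on. (\<forall>l \<in> set ls. \<not> fr l \<longrightarrow> on l) \<and>
      (\<forall>r<R. (\<Sum>l \<in> set ls. of_bool (on l) * (dg (P l) r - dg (C l) r)) = 0)"
    using e(2) by (intro exI[of _ on]) (auto simp: on_def)
next
  define n where "n = R + 4 * length ls"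
  assume "\<exists>on. (\<forall>l \<in> set ls. \<not> fr l \<longrightarrow> on l) \<and>
      (\<forall>r<R. (\<Sum>l \<in> set ls. of_bool (on l) * (dg (P l) r - dg (C l) r)) = 0)"
  then obtain on where on: "\<forall>l \<in> set ls. \<not> fr l \<longrightarrow> on l"
    "\<forall>r<R. (\<Sum>l \<in> set ls. of_bool (on l) * (dg (P l) r - dg (C l) r)) = 0" by blast
  \<comment> \<open>By symmetry the common sign can be taken to be 1.\<close>
  define e where "e l = (if on l then 1 else -1 :: int)" for l
  have "\<exists>qs. map snd qs = nums R fr P C ls \<and> signed qs \<and>
    (\<forall>r \<ge> R. rowsum qs r = (if r = R + 4 * length ls then 1 else 0)) \<and>
    (\<forall>r<R. rowsum qs r = (\<Sum>l \<in> set ls. (e l + 1) * (dg (P l) r - dg (C l) r)))"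
    using on(1) by (intro rowsum_nums_complete assms) (auto simp: e_def)
  then obtain qs where qs: "map snd qs = nums R fr P C ls" "signed qs"
    "\<forall>r \<ge> R. rowsum qs r = (if r = n then 1 else 0)"
    "\<forall>r<R. rowsum qs r = (\<Sum>l \<in> set ls. (e l + 1) * (dg (P l) r - dg (C l) r))"
    unfolding n_def by blast
  have "(\<Sum>l \<in> set ls. (e l + 1) * (dg (P l) r - dg (C l) r)) =
     2 * (\<Sum>l \<in> set ls. of_bool (on l) * (dg (P l) r - dg (C l) r))" for r
    unfolding sum_distrib_left by (intro sum.cong) (auto simp: e_def)
  then have low: "rowsum qs r = 0" if "r < R" for r using qs(4) on(2) that by simp
  define ps where "ps = (-1, replicate n False @ [True, True]) # (1, replicate n False @ [False, True]) # qs"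
  have "rowsum ps r = 0" for r
  proof -
    consider "r < R" | "R \<le> r" "r < n" | "r = n" | "r = n + 1" | "r > n + 1" by linarith
    then show ?thesis
      using low qs(3) by cases (auto simp: ps_def n_def dg_append dg_Cons)
  qed
  moreover have "map snd ps = all_nums R fr P C ls"
    using qs(1) by (simp add: ps_def all_nums_def n_def Let_def)
  ultimately show "balanced (all_nums R fr P C ls)"
    using qs(2) by (auto simp: balanced_def ps_def intro!: exI[of _ ps])
qed

lemma last_all_nums:
  assumes "contents R P C (set ls)" "xs \<in> set (all_nums R fr P C ls)"
  shows "xs \<noteq> [] \<and> last xs"
proof -
  have "xs \<noteq> [] \<and> last xs" if "xs \<in> set (nums R fr P C ls)" for xs
    using that by (induction ls) (auto simp: item_def Let_def split: if_splits)
  then show ?thesis using assms(2) by (auto simp: all_nums_def Let_def)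
qed

text \<open>Lengths decrease strictly along the list, except for one tie in each free item. The
  number without content in a free item makes the second \<open>P\<close> longer than its partner
  \<open>C\<close>; if the two shared their top row, their order would depend on the
  contents.\<close>

lemma sorted_vals_nums:
  assumes "contents R P C (set ls)"
  shows "sorted_wrt (\<ge>) (map (val p) (nums R fr P C ls))"
  using assms
proof (induction ls)
  case (Cons l ls)
  define k where "k = length ls"
  let ?it = "item R (fr l) (P l) (C l) k"
  have len: "length (P l) = R" "length (C l) = R"
    using Cons.prems by auto
  have "val p ys \<le> val p xs" if xs: "xs \<in> set ?it" and ys: "ys \<in> set (nums R fr P C ls)" for xs ys
  proof (rule val_ge_shorter)
    show "length ys < length xs" "last xs"
      using length_nums[OF _ ys] xs Cons.prems len
      by (auto simp: item_def Let_def k_def split: if_splits)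
  qed
  moreover have "sorted_wrt (\<ge>) (map (val p) ?it)"
  proof -
    have "val p (replicate R False @ replicate (4 * k) False @ [False, False, True]) \<le>
      val p (P l @ replicate (4 * k) False @ [False, True, True])"
      using val_ge_power[of "P l @ replicate (4 * k) False @ [False, True, True]" "R + 4 * k + 2" p] len
      by (simp add: replicate_add numeral_2_eq_2 replicate_app_Cons_same)
    then show ?thesis using len by (auto simp: item_def Let_def intro!: val_ge_shorter)
  qed
  ultimately show ?case using Cons by (auto simp: sorted_wrt_append k_def)
qed simp

lemma sorted_vals_all_nums:
  assumes "contents R P C (set ls)"
  shows "sorted_wrt (\<ge>) (map (val p) (all_nums R fr P C ls))"
proof -
  define z where "z = replicate (R + 4 * length ls) False"
  have "val p ys \<le> val p (z @ [b, True])" if ys: "ys \<in> set (nums R fr P C ls)" for ys b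
    using length_nums[OF assms ys] by (intro val_ge_shorter) (auto simp: z_def)
  moreover have "val p (z @ [False, True]) \<le> val p (z @ [True, True])"
    using val_ge_power[of "z @ [True, True]" "R + 4 * length ls + 1" p]
    by (simp add: z_def replicate_app_Cons_same)
  ultimately show ?thesis
    using sorted_vals_nums[OF assms] by (auto simp: all_nums_def Let_def z_def)
qed

lemma degree_sequence_vals_all_nums:
  assumes "contents R P C (set ls)" "0 < p"
  shows "degree_sequence (map (val p) (all_nums R fr P C ls))"
proof -
  have "even (sum_list (map (val p) xss))" for xss
    using assms(2) by (induction xss) (auto simp: even_val)
  moreover have "0 < val p xs" if "xs \<in> set (all_nums R fr P C ls)" for xs
    using last_all_nums[OF assms(1) that] by (intro val_pos) auto
  ultimately show ?thesis
    using sorted_vals_all_nums[OF assms(1)] by (auto simp: degree_sequence_def)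
qed

lemma realizable_vals_all_nums_iff:
  assumes "distinct ls" "contents R P C (set ls)" "length (all_nums R fr P C ls) < 2 ^ Suc p"
  shows "bipartite_multigraph_realizable (map (val p) (all_nums R fr P C ls)) \<longleftrightarrow>
    (\<exists>on. (\<forall>l \<in> set ls. \<not> fr l \<longrightarrow> on l) \<and>
      (\<forall>r<R. (\<Sum>l \<in> set ls. of_bool (on l) * (dg (P l) r - dg (C l) r)) = 0))"
  unfolding balanced_all_nums_iff[OF assms(1,2), symmetric] splits_map_val_iff[OF assms(3), symmetric]
  using splits_if_realizable realizable_if_splits[OF _ sorted_vals_all_nums[OF assms(2)]] by blast

lemma length_all_nums: "length (all_nums R fr P C ls) \<le> 5 * length ls + 3"
proof -
  have "length (nums R fr P C ls) \<le> 5 * length ls + 1"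
    by (induction ls) (auto simp: item_def Let_def)
  then show ?thesis by (simp add: all_nums_def Let_def)
qed

section \<open>Layered Petri nets\<close>

definition shift :: "nat \<Rightarrow> (nat \<times> nat) set \<Rightarrow> (nat \<times> nat) set" where
  "shift i A = (\<lambda>(\<delta>, k). (i + \<delta>, k)) ` A"

lemma mem_shift: "(b, k) \<in> shift i A \<longleftrightarrow> i \<le> b \<and> (b - i, k) \<in> A"
  by (force simp: shift_def)

datatype lab = Tile nat nat nat | Const nat

text \<open>A transition \<open>(\<sigma>, A, \<sigma>', B)\<close> replaces the control token \<open>\<sigma>\<close> by \<open>\<sigma>'\<close> and the
  tokens \<open>A\<close> by \<open>B\<close>, the latter relative to a position \<open>i < N\<close>; a token is a pair of a position
  (offset by one) and a kind.  In each of the \<open>T\<close> rounds the other tokens are kept or discarded.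
  The tokens at time \<open>t \<le> T\<close> are the rows \<open>t * L, \<dots>, t * L + L - 1\<close>.\<close>

type_synonym side = "(nat \<times> nat) set \<times> nat set"

locale net =
  fixes KK SS N T :: nat
    and trans :: "(nat \<times> (nat \<times> nat) set \<times> nat \<times> (nat \<times> nat) set) list"
  assumes wf_trans: "(\<sigma>, A, \<sigma>', B) \<in> set trans \<Longrightarrow>
      \<sigma> < SS \<and> \<sigma>' < SS \<and> A \<subseteq> {..<3} \<times> {..<KK} \<and> B \<subseteq> {..<3} \<times> {..<KK}"
    and T_pos: "0 < T"
begin

text \<open>Positions run from 0 to \<open>N + 1\<close>, since a transition at \<open>i < N\<close>
  reaches \<open>i\<close>, \<open>i + 1\<close> and \<open>i + 2\<close>. The last
  \<open>SS\<close> rows of a layer hold the control token.\<close>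

definition "L = KK * (N + 2) + SS"

definition pat :: "(nat \<times> nat) set \<Rightarrow> bool list" where
  "pat A = map (\<lambda>z. (z div KK, z mod KK) \<in> A) [0..<3 * KK]"

definition spat :: "nat set \<Rightarrow> bool list" where
  "spat S = map (\<lambda>\<sigma>. \<sigma> \<in> S) [0..<SS]"

definition lvec :: "nat \<Rightarrow> side \<Rightarrow> bool list" where
  "lvec i X = replicate (KK * i) False @ pat (fst X) @ replicate (KK * (N - 1 - i)) False @ spat (snd X)"

text \<open>Passing on and discarding act on the centre \<open>i + 1\<close> of a tile, that is, on
  positions 1 to \<open>N\<close>. A token at position 0 or \<open>N + 1\<close> can be consumed
  only by a transition.\<close>

definition kinds :: "(side \<times> side) list" where
  "kinds = map (\<lambda>k. (({(1, k)}, {}), ({(1, k)}, {}))) [0..<KK] @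
     map (\<lambda>k. (({(1, k)}, {}), ({}, {}))) [0..<KK] @
     map (\<lambda>(\<sigma>, A, \<sigma>', B). ((A, {\<sigma>}), (B, {\<sigma>'}))) trans"

definition "loc_row b k = KK * b + k"
definition "st_row \<sigma> = KK * (N + 2) + \<sigma>"

lemma length_lvec: "i < N \<Longrightarrow> length (lvec i X) = L"
proof -
  assume "i < N"
  then obtain j where "N = i + 1 + j" by (metis Suc_eq_plus1 less_iff_Suc_add add_Suc)
  then show ?thesis unfolding lvec_def pat_def spat_def L_def by (simp add: algebra_simps)
qed

lemma row_less: "b < N + 2 \<Longrightarrow> k < KK \<Longrightarrow> loc_row b k < KK * (N + 2)"
proof -
  assume "b < N + 2" "k < KK"
  then have "KK * b + k < KK * (b + 1)" "KK * (b + 1) \<le> KK * (N + 2)"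
    by (simp, intro mult_le_mono2, simp)
  then show ?thesis by (simp add: loc_row_def)
qed

lemma row_cases:
  assumes "s < L"
  obtains b k where "b < N + 2" "k < KK" "s = loc_row b k" | \<sigma> where "\<sigma> < SS" "s = st_row \<sigma>"
proof (cases "s < KK * (N + 2)")
  case True
  then have "0 < KK" by (cases KK) auto
  moreover have "s div KK < N + 2" using True by (metis less_mult_imp_div_less mult.commute)
  ultimately show ?thesis using that(1)[of "s div KK" "s mod KK"] by (simp add: loc_row_def)
next
  case False
  then show ?thesis using that(2)[of "s - KK * (N + 2)"] assms by (simp add: L_def st_row_def)
qed

lemma dg_lvec_st: "i < N \<Longrightarrow> \<sigma> < SS \<Longrightarrow> dg (lvec i X) (st_row \<sigma>) = of_bool (\<sigma> \<in> snd X)"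
proof -
  assume "i < N" "\<sigma> < SS"
  then obtain j where j: "N = i + 1 + j" by (metis Suc_eq_plus1 less_iff_Suc_add add_Suc)
  define xs where "xs = replicate (KK * i) False @ pat (fst X) @ replicate (KK * j) False"
  have "lvec i X = xs @ spat (snd X)" using j unfolding lvec_def xs_def by simp
  moreover have "st_row \<sigma> = length xs + \<sigma>"
    using j unfolding xs_def pat_def st_row_def by (simp add: algebra_simps)
  ultimately show ?thesis using \<open>\<sigma> < SS\<close> by (simp add: dg_append) (simp add: dg_def spat_def)
qed

lemma dg_lvec_loc:
  assumes "i < N" "b < N + 2" "k < KK" "fst X \<subseteq> {..<3} \<times> {..<KK}"
  shows "dg (lvec i X) (loc_row b k) = of_bool ((b, k) \<in> shift i (fst X))"
proof -
  from assms(1) obtain j where j: "N = i + 1 + j" by (metis Suc_eq_plus1 less_iff_Suc_add add_Suc)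
  have lv: "lvec i X = replicate (KK * i) False @ pat (fst X) @ replicate (KK * j) False @ spat (snd X)"
    using j unfolding lvec_def by simp
  have len: "length (pat (fst X)) = 3 * KK" by (simp add: pat_def)
  consider "b < i" | \<delta> where "b = i + \<delta>" "\<delta> < 3" | \<delta> where "b = i + 3 + \<delta>"
    by (metis le_Suc_ex linorder_not_less nat_add_left_cancel_less)
  then show ?thesis
  proof cases
    case 1
    then have "KK * b + k < KK * i" using assms(3) 
      by (metis add.commute less_le_trans mult_Suc_right mult_le_mono2 nat_add_left_cancel_less Suc_leI add_less_cancel_left)
    then show ?thesis using 1 by (simp add: lv dg_append loc_row_def mem_shift)
  next
    case (2 \<delta>)
    have "KK * \<delta> + k < KK * (\<delta> + 1)" using assms(3) by simp
    also have "\<dots> \<le> KK * 3" using 2(2) by (intro mult_le_mono2) simp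
    finally have "KK * \<delta> + k < 3 * KK" by (simp add: mult.commute)
    then show ?thesis using assms(3)
      by (simp add: lv dg_append len loc_row_def mem_shift 2(1) algebra_simps) (simp add: dg_def pat_def)
  next
    case (3 \<delta>)
    have "KK * \<delta> + k < KK * (\<delta> + 1)" using assms(3) by simp
    also have "\<dots> \<le> KK * j" using assms(2) 3 j by (intro mult_le_mono2) simp
    finally have "KK * \<delta> + k < KK * j" .
    moreover have "(b - i, k) \<notin> fst X" using assms(4) 3 by auto
    ultimately show ?thesis
      by (simp add: lv dg_append len loc_row_def mem_shift 3 algebra_simps)
  qed
qed

definition cvec :: "nat \<Rightarrow> bool list \<Rightarrow> bool list" where
  "cvec t v = replicate (t * L) False @ v @ replicate ((T - t) * L) False"

lemma length_cvec: "t \<le> T \<Longrightarrow> length v = L \<Longrightarrow> length (cvec t v) = (T + 1) * L"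
proof -
  assume "t \<le> T" "length v = L"
  then obtain j where "T = t + j" using le_Suc_ex by blast
  then show ?thesis using \<open>length v = L\<close> unfolding cvec_def by (simp add: algebra_simps)
qed

lemma dg_cvec:
  assumes "length v = L" "s < L"
  shows "dg (cvec t v) (t' * L + s) = (if t' = t then dg v s else 0)"
proof -
  consider "t' < t" | "t' = t" | "t < t'" by linarith
  then show ?thesis
  proof cases
    case 1
    then have "Suc t' * L \<le> t * L" by (intro mult_le_mono1) simp
    then have "t' * L + s < t * L" using assms(2) by simp
    then show ?thesis using 1 by (simp add: cvec_def dg_append)
  next
    case 2
    then show ?thesis using assms by (simp add: cvec_def dg_append)
  next
    case 3
    then have "Suc t * L \<le> t' * L" by (intro mult_le_mono1) simp
    then have "\<not> t' * L + s < t * L" "\<not> t' * L + s - t * L < L" using assms by auto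
    then show ?thesis using 3 assms by (simp add: cvec_def dg_append)
  qed
qed

text \<open>A tile of round \<open>t\<close> consumes in layer \<open>t\<close> and produces in
  layer \<open>t + 1\<close>. A constant, which is always on, produces its part of the initial
  marking in layer 0 and, by \<open>tile_C\<close>, consumes its part of the final marking in layer
  \<open>T\<close>.\<close>

definition tile_P :: "(nat \<Rightarrow> bool list) \<Rightarrow> lab \<Rightarrow> bool list" where
  "tile_P I l = (case l of Tile t i c \<Rightarrow> cvec (t + 1) (lvec i (snd (kinds ! c))) | Const j \<Rightarrow> cvec 0 (I j))"

definition tile_C :: "(nat \<Rightarrow> bool list) \<Rightarrow> lab \<Rightarrow> bool list" where
  "tile_C F l = (case l of Tile t i c \<Rightarrow> cvec t (lvec i (fst (kinds ! c))) | Const j \<Rightarrow> cvec T (F j))"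

definition free :: "lab \<Rightarrow> bool" where
  "free l = (case l of Tile t i c \<Rightarrow> True | Const j \<Rightarrow> False)"

definition labs :: "nat \<Rightarrow> lab list" where
  "labs m = concat (map (\<lambda>t. concat (map (\<lambda>i. map (Tile t i) [0..<length kinds]) [0..<N])) [0..<T]) @
     map Const [0..<m]"

definition spots :: "(nat \<times> nat) set" where
  "spots = {..<N} \<times> {..<length kinds}"

definition cons :: "(nat \<times> nat) set \<Rightarrow> nat \<Rightarrow> int" where
  "cons E s = (\<Sum>(i, c) \<in> E. dg (lvec i (fst (kinds ! c))) s)"

definition prods :: "(nat \<times> nat) set \<Rightarrow> nat \<Rightarrow> int" where
  "prods E s = (\<Sum>(i, c) \<in> E. dg (lvec i (snd (kinds ! c))) s)"

definition active :: "(lab \<Rightarrow> bool) \<Rightarrow> nat \<Rightarrow> (nat \<times> nat) set" where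
  "active on t = {(i, c) \<in> spots. on (Tile t i c)}"

lemma finite_spots [simp]: "finite spots"
  by (simp add: spots_def)

lemma set_labs: "set (labs m) = (\<lambda>(t, i, c). Tile t i c) ` ({..<T} \<times> spots) \<union> Const ` {..<m}"
  by (auto simp: labs_def spots_def image_iff)

lemma distinct_labs: "distinct (labs m)"
proof -
  have 1: "distinct (map (Tile t i) ns)" if "distinct ns" for t i ns
    using that by (simp add: distinct_map inj_on_def)
  have 2: "distinct (concat (map (\<lambda>i. map (Tile t i) [0..<n]) is))" if "distinct is" for t n "is"
    using that by (induction "is") (auto simp: 1)
  have 3: "distinct (concat (map (\<lambda>t. concat (map (\<lambda>i. map (Tile t i) [0..<n]) [0..<k])) ts))" if "distinct ts" for ts n k
    using that by (induction ts) (auto simp: 2)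
  show ?thesis using 3 by (auto simp: labs_def distinct_map inj_on_def)
qed

lemma contents_labs:
  assumes "\<forall>j<m. length (I j) = L \<and> length (F j) = L"
  shows "contents ((T + 1) * L) (tile_P I) (tile_C F) (set (labs m))"
  using assms
  by (auto simp: contents_def set_labs tile_P_def tile_C_def spots_def length_lvec length_cvec)

lemma sum_labs:
  assumes "\<forall>j<m. length (I j) = L \<and> length (F j) = L" "\<forall>j<m. on (Const j)" "s < L"
  shows "(\<Sum>l \<in> set (labs m). of_bool (on l) * (dg (tile_P I l) (t' * L + s) - dg (tile_C F l) (t' * L + s))) =
    (\<Sum>t<T. of_bool (t' = t + 1) * prods (active on t) s - of_bool (t' = t) * cons (active on t) s) +
    (\<Sum>j<m. of_bool (t' = 0) * dg (I j) s - of_bool (t' = T) * dg (F j) s)"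
proof -
  let ?f = "\<lambda>l. of_bool (on l) * (dg (tile_P I l) (t' * L + s) - dg (tile_C F l) (t' * L + s))"
  have "(\<Sum>l \<in> set (labs m). ?f l) =
    (\<Sum>l \<in> (\<lambda>(t, i, c). Tile t i c) ` ({..<T} \<times> spots). ?f l) + (\<Sum>l \<in> Const ` {..<m}. ?f l)"
    unfolding set_labs by (intro sum.union_disjoint) auto
  also have "(\<Sum>l \<in> Const ` {..<m}. ?f l) = (\<Sum>j<m. ?f (Const j))"
    by (subst sum.reindex) (auto simp: inj_on_def)
  also have "\<dots> = (\<Sum>j<m. of_bool (t' = 0) * dg (I j) s - of_bool (t' = T) * dg (F j) s)"
    using assms by (intro sum.cong) (auto simp: tile_P_def tile_C_def dg_cvec)
  also have "(\<Sum>l \<in> (\<lambda>(t, i, c). Tile t i c) ` ({..<T} \<times> spots). ?f l) =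
     (\<Sum>p \<in> {..<T} \<times> spots. ?f ((\<lambda>(t, i, c). Tile t i c) p))"
    by (subst sum.reindex) (auto simp: inj_on_def)
  also have "\<dots> = (\<Sum>t<T. \<Sum>p \<in> spots. ?f (Tile t (fst p) (snd p)))"
    by (subst sum.cartesian_product) (simp add: split_beta)
  also have "\<dots> = (\<Sum>t<T. of_bool (t' = t + 1) * prods (active on t) s - of_bool (t' = t) * cons (active on t) s)"
  proof (intro sum.cong refl)
    fix t assume "t \<in> {..<T}"
    have "?f (Tile t (fst p) (snd p)) =
        (if on (Tile t (fst p) (snd p)) then
          of_bool (t' = t + 1) * dg (lvec (fst p) (snd (kinds ! snd p))) s - of_bool (t' = t) * dg (lvec (fst p) (fst (kinds ! snd p))) s else 0)"
      if ps: "p \<in> spots" for p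
    proof -
      obtain i c where p: "p = (i, c)" "i < N" using ps by (auto simp: spots_def)
      have dg: "dg (cvec t (lvec i X)) (t' * L + s) = (if t' = t then dg (lvec i X) s else 0)" for t X
        by (rule dg_cvec[OF length_lvec[OF p(2)] assms(3)])
      show ?thesis unfolding p(1) tile_P_def tile_C_def lab.case dg fst_conv snd_conv by simp
    qed
    note tile = this
    have "(\<Sum>p \<in> spots. ?f (Tile t (fst p) (snd p))) = (\<Sum>p \<in> active on t.
          of_bool (t' = t + 1) * dg (lvec (fst p) (snd (kinds ! snd p))) s - of_bool (t' = t) * dg (lvec (fst p) (fst (kinds ! snd p))) s)"
    proof (rule sum.mono_neutral_cong_right)
      show "active on t \<subseteq> spots" by (auto simp: active_def)
      show "\<forall>p \<in> spots - active on t. ?f (Tile t (fst p) (snd p)) = 0" by (auto simp: active_def)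
      fix p assume "p \<in> active on t"
      then have p: "p \<in> spots" and on: "on (Tile t (fst p) (snd p))" by (auto simp: active_def)
      show "?f (Tile t (fst p) (snd p)) = of_bool (t' = t + 1) * dg (lvec (fst p) (snd (kinds ! snd p))) s -
          of_bool (t' = t) * dg (lvec (fst p) (fst (kinds ! snd p))) s"
        unfolding tile[OF p] using on by (simp only: if_True)
    qed simp
    then show "(\<Sum>p \<in> spots. ?f (Tile t (fst p) (snd p))) =
        of_bool (t' = t + 1) * prods (active on t) s - of_bool (t' = t) * cons (active on t) s"
      by (simp add: prods_def cons_def split_beta sum_subtractf sum_distrib_left)
  qed
  finally show ?thesis .
qed

definition solution :: "nat \<Rightarrow> (nat \<Rightarrow> bool list) \<Rightarrow> (nat \<Rightarrow> bool list) \<Rightarrow> (nat \<Rightarrow> (nat \<times> nat) set) \<Rightarrow> bool" where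
  "solution m I F E \<longleftrightarrow> (\<forall>t<T. E t \<subseteq> spots) \<and> (\<forall>s<L.
     cons (E 0) s = (\<Sum>j<m. dg (I j) s) \<and>
     (\<forall>t. t + 1 < T \<longrightarrow> cons (E (t + 1)) s = prods (E t) s) \<and>
     prods (E (T - 1)) s = (\<Sum>j<m. dg (F j) s))"

text \<open>Row \<open>s\<close> of layer \<open>t\<close> balances the production of round
  \<open>t - 1\<close> against the consumption of round \<open>t\<close>, with \<open>I\<close> in
  place of the former for \<open>t = 0\<close> and \<open>F\<close> in place of the latter for
  \<open>t = T\<close>.\<close>

lemma ex_solution_iff:
  assumes "\<forall>j<m. length (I j) = L \<and> length (F j) = L"
  shows "(\<exists>on. (\<forall>l \<in> set (labs m). \<not> free l \<longrightarrow> on l) \<and> (\<forall>r < (T + 1) * L.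
      (\<Sum>l \<in> set (labs m). of_bool (on l) * (dg (tile_P I l) r - dg (tile_C F l) r)) = 0)) \<longleftrightarrow>
    (\<exists>E. solution m I F E)"
proof -
  have rows: "(\<forall>r < (T + 1) * L. Q r) \<longleftrightarrow> (\<forall>t \<le> T. \<forall>s<L. Q (t * L + s))" for Q
  proof safe
    fix t s assume *: "\<forall>r < (T + 1) * L. Q r" "t \<le> T" "s < L"
    have "t * L + s < (t + 1) * L" using *(3) by simp
    also have "\<dots> \<le> (T + 1) * L" using *(2) by (intro mult_le_mono1) simp
    finally show "Q (t * L + s)" using *(1) by blast
  next
    fix r assume *: "\<forall>t \<le> T. \<forall>s<L. Q (t * L + s)" "r < (T + 1) * L"
    then have "0 < L" by (cases L) auto
    moreover have "r div L < T + 1" using *(2) by (rule less_mult_imp_div_less)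
    ultimately show "Q r" using *(1)[rule_format, of "r div L" "r mod L"] by simp
  qed
  have key: "(\<forall>t \<le> T. \<forall>s<L. (\<Sum>t'<T. of_bool (t = t' + 1) * prods (E t') s - of_bool (t = t') * cons (E t') s) +
    (\<Sum>j<m. of_bool (t = 0) * dg (I j) s - of_bool (t = T) * dg (F j) s) = 0) \<longleftrightarrow>
    (\<forall>s<L. cons (E 0) s = (\<Sum>j<m. dg (I j) s) \<and>
     (\<forall>t. t + 1 < T \<longrightarrow> cons (E (t + 1)) s = prods (E t) s) \<and>
     prods (E (T - 1)) s = (\<Sum>j<m. dg (F j) s))" for E
  proof -
    let ?g = "\<lambda>t s. (\<Sum>t'<T. of_bool (t = t' + 1) * prods (E t') s - of_bool (t = t') * cons (E t') s) +
      (\<Sum>j<m. of_bool (t = 0) * dg (I j) s - of_bool (t = T) * dg (F j) s)"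
    have s1: "(\<Sum>t'<T. of_bool (t = t' + 1) * prods (E t') s) = (if 0 < t \<and> t \<le> T then prods (E (t - 1)) s else 0)" for t s
    proof (cases "0 < t \<and> t \<le> T")
      case True
      then have "(\<Sum>t'<T. of_bool (t = t' + 1) * prods (E t') s) = (\<Sum>t'<T. if t' = t - 1 then prods (E t') s else 0)"
        by (intro sum.cong) auto
      also have "\<dots> = prods (E (t - 1)) s" using True by (subst sum.delta) auto
      finally show ?thesis using True by simp
    qed (auto intro!: sum.neutral)
    have s2: "(\<Sum>t'<T. of_bool (t = t') * cons (E t') s) = (if t < T then cons (E t) s else 0)" for t s
    proof -
      have "(\<Sum>t'<T. of_bool (t = t') * cons (E t') s) = (\<Sum>t'<T. if t' = t then cons (E t') s else 0)"
        by (intro sum.cong) auto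
      then show ?thesis by simp
    qed
    have g: "?g t s = (if 0 < t \<and> t \<le> T then prods (E (t - 1)) s else 0) - (if t < T then cons (E t) s else 0) +
        (of_bool (t = 0) * (\<Sum>j<m. dg (I j) s) - of_bool (t = T) * (\<Sum>j<m. dg (F j) s))" for t s
      unfolding sum_subtractf s1 s2 by (simp add: sum_distrib_left)
    have g0: "?g 0 s = (\<Sum>j<m. dg (I j) s) - cons (E 0) s" for s
      unfolding g using T_pos by simp
    have gT: "?g T s = prods (E (T - 1)) s - (\<Sum>j<m. dg (F j) s)" for s
      unfolding g using T_pos by simp
    have gS: "?g (t + 1) s = prods (E t) s - cons (E (t + 1)) s" if "t + 1 < T" for t s
      unfolding g using that by simp
    have "(\<forall>t \<le> T. Q t) \<longleftrightarrow> Q 0 \<and> Q T \<and> (\<forall>t. t + 1 < T \<longrightarrow> Q (t + 1))" for Q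
    proof safe
      fix t assume *: "Q 0" "Q T" "\<forall>t. t + 1 < T \<longrightarrow> Q (t + 1)" "t \<le> T"
      then consider "t = 0" | "t = T" | "t = (t - 1) + 1" "(t - 1) + 1 < T" by linarith
      then show "Q t" using * by cases metis+
    qed auto
    note split = this
    have gS': "(\<forall>t. t + 1 < T \<longrightarrow> (\<forall>s<L. ?g (t + 1) s = 0)) \<longleftrightarrow>
        (\<forall>t. t + 1 < T \<longrightarrow> (\<forall>s<L. cons (E (t + 1)) s = prods (E t) s))"
    proof (intro iff_allI imp_cong refl)
      fix t s assume "t + 1 < T"
      show "?g (t + 1) s = 0 \<longleftrightarrow> cons (E (t + 1)) s = prods (E t) s"
        unfolding gS[OF \<open>t + 1 < T\<close>] by auto
    qed
    show ?thesis unfolding split[of "\<lambda>t. \<forall>s<L. ?g t s = 0"] gS' g0 gT right_minus_eq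
      by (auto simp: eq_commute)
  qed
  show ?thesis
  proof
    assume "\<exists>on. (\<forall>l \<in> set (labs m). \<not> free l \<longrightarrow> on l) \<and> (\<forall>r < (T + 1) * L.
      (\<Sum>l \<in> set (labs m). of_bool (on l) * (dg (tile_P I l) r - dg (tile_C F l) r)) = 0)"
    then obtain on where on: "\<forall>l \<in> set (labs m). \<not> free l \<longrightarrow> on l" "\<forall>r < (T + 1) * L.
      (\<Sum>l \<in> set (labs m). of_bool (on l) * (dg (tile_P I l) r - dg (tile_C F l) r)) = 0" by blast
    have "\<forall>j<m. on (Const j)" using on(1) by (auto simp: set_labs free_def)
    note sl = sum_labs[where m = m and I = I and F = F and on = on, OF assms this]
    have "(\<Sum>t'<T. of_bool (t = t' + 1) * prods (active on t') s - of_bool (t = t') * cons (active on t') s) +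
        (\<Sum>j<m. of_bool (t = 0) * dg (I j) s - of_bool (t = T) * dg (F j) s) = 0"
      if "t \<le> T" "s < L" for t s
      using on(2) that unfolding rows sl[OF that(2), symmetric] by blast
    then have "solution m I F (active on)"
      unfolding solution_def key[symmetric] by (auto simp: active_def)
    then show "\<exists>E. solution m I F E" by blast
  next
    assume "\<exists>E. solution m I F E"
    then obtain E where E: "solution m I F E" by blast
    define on where "on l = (case l of Tile t i c \<Rightarrow> (i, c) \<in> E t | Const j \<Rightarrow> True)" for l
    have act: "active on t = E t" if "t < T" for t
      using E that by (auto simp: active_def on_def solution_def)
    have "\<forall>r < (T + 1) * L. (\<Sum>l \<in> set (labs m). of_bool (on l) * (dg (tile_P I l) r - dg (tile_C F l) r)) = 0"
      unfolding rows
    proof (intro allI impI)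
      fix t s assume *: "t \<le> T" "s < L"
      have "(\<Sum>l \<in> set (labs m). of_bool (on l) * (dg (tile_P I l) (t * L + s) - dg (tile_C F l) (t * L + s))) =
        (\<Sum>t'<T. of_bool (t = t' + 1) * prods (E t') s - of_bool (t = t') * cons (E t') s) +
        (\<Sum>j<m. of_bool (t = 0) * dg (I j) s - of_bool (t = T) * dg (F j) s)"
        by (subst sum_labs[where m = m and I = I and F = F, OF assms _ *(2)]) (auto simp: on_def act)
      also have "\<dots> = 0" using key[of E] E * unfolding solution_def by blast
      finally show "(\<Sum>l \<in> set (labs m). of_bool (on l) * (dg (tile_P I l) (t * L + s) - dg (tile_C F l) (t * L + s))) = 0" .
    qed
    then show "\<exists>on. (\<forall>l \<in> set (labs m). \<not> free l \<longrightarrow> on l) \<and> (\<forall>r < (T + 1) * L.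
      (\<Sum>l \<in> set (labs m). of_bool (on l) * (dg (tile_P I l) r - dg (tile_C F l) r)) = 0)"
      by (intro exI[of _ on]) (auto simp: set_labs free_def on_def)
  qed
qed

end

section \<open>Layers as steps of the lossy net\<close>

context net
begin

lemma length_kinds: "length kinds = 2 * KK + length trans"
  by (simp add: kinds_def)

lemma kinds_pass: "k < KK \<Longrightarrow> kinds ! k = (({(1, k)}, {}), ({(1, k)}, {}))"
  by (simp add: kinds_def nth_append)

lemma kinds_discard: "k < KK \<Longrightarrow> kinds ! (KK + k) = (({(1, k)}, {}), ({}, {}))"
  by (simp add: kinds_def nth_append)

lemma kinds_trans:
  "j < length trans \<Longrightarrow> trans ! j = (\<sigma>, A, \<sigma>', B) \<Longrightarrow> kinds ! (2 * KK + j) = ((A, {\<sigma>}), (B, {\<sigma>'}))"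
  by (simp add: kinds_def nth_append)

lemma kinds_cases:
  assumes "c < length kinds"
  obtains (pass) k where "k < KK" "c = k" | (discard) k where "k < KK" "c = KK + k"
    | (trans) j \<sigma> A \<sigma>' B where "j < length trans" "c = 2 * KK + j" "trans ! j = (\<sigma>, A, \<sigma>', B)"
      "(\<sigma>, A, \<sigma>', B) \<in> set trans"
proof -
  consider "c < KK" | "KK \<le> c" "c < 2 * KK" | "2 * KK \<le> c" by linarith
  then show ?thesis
  proof cases
    case 1
    then show ?thesis using pass by blast
  next
    case 2
    then show ?thesis using discard[of "c - KK"] by simp
  next
    case 3
    obtain \<sigma> A \<sigma>' B where "trans ! (c - 2 * KK) = (\<sigma>, A, \<sigma>', B)" by (metis prod_cases4)
    then show ?thesis using trans[of "c - 2 * KK"] 3 assms nth_mem[of "c - 2 * KK" trans] by (simp add: length_kinds)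
  qed
qed

lemma kinds_subset:
  assumes "c < length kinds"
  shows "fst (fst (kinds ! c)) \<subseteq> {..<3} \<times> {..<KK}" "fst (snd (kinds ! c)) \<subseteq> {..<3} \<times> {..<KK}"
proof -
  have "fst (fst (kinds ! c)) \<subseteq> {..<3} \<times> {..<KK} \<and> fst (snd (kinds ! c)) \<subseteq> {..<3} \<times> {..<KK}"
    using assms
  proof (cases rule: kinds_cases)
    case (trans j \<sigma> A \<sigma>' B)
    then show ?thesis using wf_trans[OF trans(4)] by (simp add: kinds_trans)
  qed (simp_all add: kinds_pass kinds_discard)
  then show "fst (fst (kinds ! c)) \<subseteq> {..<3} \<times> {..<KK}" "fst (snd (kinds ! c)) \<subseteq> {..<3} \<times> {..<KK}"
    by simp_all
qed

definition Cl :: "nat \<times> nat \<Rightarrow> (nat \<times> nat) set" where "Cl p = shift (fst p) (fst (fst (kinds ! snd p)))"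
definition Pl :: "nat \<times> nat \<Rightarrow> (nat \<times> nat) set" where "Pl p = shift (fst p) (fst (snd (kinds ! snd p)))"
definition Cs :: "nat \<times> nat \<Rightarrow> nat set" where "Cs p = snd (fst (kinds ! snd p))"
definition Ps :: "nat \<times> nat \<Rightarrow> nat set" where "Ps p = snd (snd (kinds ! snd p))"

lemma cons_loc:
  assumes "E \<subseteq> spots" "b < N + 2" "k < KK"
  shows "cons E (loc_row b k) = (\<Sum>p\<in>E. of_bool ((b, k) \<in> Cl p))"
    "prods E (loc_row b k) = (\<Sum>p\<in>E. of_bool ((b, k) \<in> Pl p))"
proof -
  have "fst p < N \<and> snd p < length kinds" if "p \<in> E" for p
    using assms(1) that by (auto simp: spots_def)
  then show "cons E (loc_row b k) = (\<Sum>p\<in>E. of_bool ((b, k) \<in> Cl p))"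
    "prods E (loc_row b k) = (\<Sum>p\<in>E. of_bool ((b, k) \<in> Pl p))"
    unfolding cons_def prods_def split_beta Cl_def Pl_def
    using assms(2,3) by (auto intro!: sum.cong simp: dg_lvec_loc kinds_subset)
qed

lemma cons_st:
  assumes "E \<subseteq> spots" "\<sigma> < SS"
  shows "cons E (st_row \<sigma>) = (\<Sum>p\<in>E. of_bool (\<sigma> \<in> Cs p))"
    "prods E (st_row \<sigma>) = (\<Sum>p\<in>E. of_bool (\<sigma> \<in> Ps p))"
proof -
  have "fst p < N" if "p \<in> E" for p
    using assms(1) that by (auto simp: spots_def)
  then show "cons E (st_row \<sigma>) = (\<Sum>p\<in>E. of_bool (\<sigma> \<in> Cs p))"
    "prods E (st_row \<sigma>) = (\<Sum>p\<in>E. of_bool (\<sigma> \<in> Ps p))"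
    unfolding cons_def prods_def split_beta Cs_def Ps_def
    using assms(2) by (simp_all add: dg_lvec_st)
qed

lemma spots_cases:
  assumes "p \<in> spots"
  obtains (other) k where "k < KK" "fst p < N" "Cl p = {(fst p + 1, k)}" "Pl p \<subseteq> Cl p" "Cs p = {}" "Ps p = {}"
    | (trans) \<sigma> A \<sigma>' B where "(\<sigma>, A, \<sigma>', B) \<in> set trans" "fst p < N" "Cl p = shift (fst p) A" "Pl p = shift (fst p) B"
      "Cs p = {\<sigma>}" "Ps p = {\<sigma>'}"
proof -
  have "snd p < length kinds" "fst p < N" using assms by (auto simp: spots_def)
  from this(1) show ?thesis
  proof (cases rule: kinds_cases)
    case (pass k)
    then show ?thesis using other[of k] \<open>fst p < N\<close>
      by (auto simp: Cl_def Pl_def Cs_def Ps_def kinds_pass shift_def)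
  next
    case (discard k)
    then show ?thesis using other[of k] \<open>fst p < N\<close>
      by (auto simp: Cl_def Pl_def Cs_def Ps_def kinds_discard shift_def)
  next
    case (trans j \<sigma> A \<sigma>' B)
    then show ?thesis using that(2)[of \<sigma> A \<sigma>' B] \<open>fst p < N\<close>
      by (auto simp: Cl_def Pl_def Cs_def Ps_def kinds_trans)
  qed
qed

text \<open>Only a transition can consume the control token, and a second active transition would
  need a second one. So exactly one transition is active, and every other active tile produces at
  most what it consumes.\<close>

lemma layer_sound:
  assumes "E \<subseteq> spots" "\<sigma> < SS" "\<forall>\<sigma>'<SS. cons E (st_row \<sigma>') = of_bool (\<sigma>' = \<sigma>)"
  shows "\<exists>A \<sigma>' B i. (\<sigma>, A, \<sigma>', B) \<in> set trans \<and> i < N \<and>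
    (\<forall>\<sigma>''<SS. prods E (st_row \<sigma>'') = of_bool (\<sigma>'' = \<sigma>')) \<and>
    (\<forall>b < N + 2. \<forall>k < KK. of_bool ((b, k) \<in> shift i A) \<le> cons E (loc_row b k) \<and>
      prods E (loc_row b k) \<le> cons E (loc_row b k) - of_bool ((b, k) \<in> shift i A) + of_bool ((b, k) \<in> shift i B))"
proof -
  have fin: "finite E" using assms(1) finite_spots by (rule finite_subset)
  have st: "(\<Sum>p\<in>E. of_bool (\<sigma>' \<in> Cs p)) = (of_bool (\<sigma>' = \<sigma>) :: int)" if "\<sigma>' < SS" for \<sigma>'
    using assms(3) cons_st[OF assms(1) that] that by simp
  have "\<exists>p \<in> E. \<sigma> \<in> Cs p"
  proof (rule ccontr)
    assume "\<not> (\<exists>p \<in> E. \<sigma> \<in> Cs p)"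
    then have "(\<Sum>p\<in>E. of_bool (\<sigma> \<in> Cs p)) = (0 :: int)" by (intro sum.neutral) auto
    then show False using st[OF assms(2)] by simp
  qed
  then obtain p where p: "p \<in> E" "\<sigma> \<in> Cs p" by blast
  from p(1) assms(1) have "p \<in> spots" by blast
  then have "\<exists>A \<sigma>' B. (\<sigma>, A, \<sigma>', B) \<in> set trans \<and> fst p < N \<and> Cl p = shift (fst p) A \<and>
      Pl p = shift (fst p) B \<and> Cs p = {\<sigma>} \<and> Ps p = {\<sigma>'}"
  proof (cases rule: spots_cases)
    case (trans s A s' B)
    then have "s = \<sigma>" using p(2) by simp
    with trans show ?thesis by (intro exI[of _ A] exI[of _ s'] exI[of _ B]) simp
  qed (use p(2) in simp)
  then obtain A \<sigma>' B where tr: "(\<sigma>, A, \<sigma>', B) \<in> set trans" "fst p < N" "Cl p = shift (fst p) A" "Pl p = shift (fst p) B"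
      "Cs p = {\<sigma>}" "Ps p = {\<sigma>'}"
    by (elim exE conjE) (rule that)
  have rest: "Pl q \<subseteq> Cl q \<and> Ps q = {}" if q: "q \<in> E - {p}" for q
  proof -
    from q assms(1) have "q \<in> spots" by blast
    then show ?thesis
    proof (cases rule: spots_cases)
      case (trans \<sigma>'' A' \<sigma>3 B')
      then have lt: "\<sigma>'' < SS" using wf_trans by blast
      have "(\<Sum>r\<in>{p, q}. of_bool (\<sigma>'' \<in> Cs r)) \<le> (\<Sum>r\<in>E. of_bool (\<sigma>'' \<in> Cs r) :: int)"
        using q p(1) by (intro sum_mono2 fin) auto
      moreover have "(\<Sum>r\<in>{p, q}. of_bool (\<sigma>'' \<in> Cs r) :: int) = of_bool (\<sigma>'' = \<sigma>) + 1"
        using q tr(5) trans(5) by auto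
      ultimately show ?thesis using st[OF lt] by (auto split: if_splits)
    qed auto
  qed
  have split: "(\<Sum>q\<in>E. g q) = g p + (\<Sum>q\<in>E - {p}. g q)" for g :: "nat \<times> nat \<Rightarrow> int"
    using fin p(1) by (rule sum.remove)
  have "prods E (st_row \<sigma>'') = of_bool (\<sigma>'' = \<sigma>')" if "\<sigma>'' < SS" for \<sigma>''
    unfolding cons_st[OF assms(1) that] split using rest tr(6) by simp
  moreover have "of_bool ((b, k) \<in> shift (fst p) A) \<le> cons E (loc_row b k)"
    "prods E (loc_row b k) \<le> cons E (loc_row b k) - of_bool ((b, k) \<in> shift (fst p) A) + of_bool ((b, k) \<in> shift (fst p) B)"
    if bk: "b < N + 2" "k < KK" for b k
  proof -
    show "of_bool ((b, k) \<in> shift (fst p) A) \<le> cons E (loc_row b k)"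
      unfolding cons_loc[OF assms(1) bk] split tr(3) by (simp add: sum_nonneg)
    have "(\<Sum>q\<in>E - {p}. of_bool ((b, k) \<in> Pl q)) \<le> (\<Sum>q\<in>E - {p}. of_bool ((b, k) \<in> Cl q) :: int)"
      using rest by (intro sum_mono) auto
    then show "prods E (loc_row b k) \<le> cons E (loc_row b k) - of_bool ((b, k) \<in> shift (fst p) A) + of_bool ((b, k) \<in> shift (fst p) B)"
      unfolding cons_loc[OF assms(1) bk] split tr(3,4) by simp
  qed
  ultimately show ?thesis using tr(1,2) by blast
qed

definition in_range :: "nat \<times> nat \<Rightarrow> bool" where
  "in_range x \<longleftrightarrow> fst x < N + 2 \<and> snd x < KK"

lemma shift_in_range:
  assumes "A \<subseteq> {..<3} \<times> {..<KK}" "i < N" "x \<in> shift i A"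
  shows "in_range x"
  using assms by (auto simp: in_range_def shift_def)

lemma loc_row_less_L: "in_range x \<Longrightarrow> loc_row (fst x) (snd x) < L"
  using row_less[of "fst x" "snd x"] by (simp add: in_range_def L_def)

lemma st_row_less_L: "\<sigma> < SS \<Longrightarrow> st_row \<sigma> < L"
  by (simp add: st_row_def L_def)

definition tokens :: "(nat \<Rightarrow> int) \<Rightarrow> nat \<times> nat \<Rightarrow> int" where
  "tokens v x = (if in_range x then v (loc_row (fst x) (snd x)) else 0)"

text \<open>The invariant is asked to survive any \<open>n'\<close> below the regular successor
  marking, which covers all ways of discarding tokens in the same round.\<close>

lemma solution_invariant:
  assumes sol: "solution m I F E"
    and I: "\<sigma>\<^sub>0 < SS" "\<forall>\<sigma><SS. (\<Sum>j<m. dg (I j) (st_row \<sigma>)) = of_bool (\<sigma> = \<sigma>\<^sub>0)"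
    and F: "\<sigma>\<^sub>1 < SS" "\<forall>\<sigma><SS. (\<Sum>j<m. dg (F j) (st_row \<sigma>)) = of_bool (\<sigma> = \<sigma>\<^sub>1)"
    and init: "Inv \<sigma>\<^sub>0 (tokens (\<lambda>s. \<Sum>j<m. dg (I j) s))"
    and step: "\<And>\<sigma> n A \<sigma>' B i n'. Inv \<sigma> n \<Longrightarrow> (\<sigma>, A, \<sigma>', B) \<in> set trans \<Longrightarrow> i < N \<Longrightarrow>
      \<forall>x. of_bool (x \<in> shift i A) \<le> n x \<Longrightarrow>
      \<forall>x. n' x \<le> n x - of_bool (x \<in> shift i A) + of_bool (x \<in> shift i B) \<Longrightarrow> Inv \<sigma>' n'"
  shows "\<exists>n. Inv \<sigma>\<^sub>1 n"
proof -
  \<comment> \<open>A layer is described by what the following round consumes; layer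
    \<open>T\<close> has no following round and is described by the production of the last
    one.\<close>
  define v where "v t s = (if t < T then cons (E t) s else prods (E (T - 1)) s)" for t s
  have v0: "v 0 s = (\<Sum>j<m. dg (I j) s)" if "s < L" for s
    using sol T_pos that by (simp add: v_def solution_def)
  have vS: "v (Suc t) s = prods (E t) s" if "s < L" "t < T" for t s
  proof (cases "Suc t < T")
    case False
    then have "T = Suc t" using that(2) by simp
    then show ?thesis by (simp add: v_def)
  qed (use sol that in \<open>simp add: v_def solution_def\<close>)
  have vT: "v T s = (\<Sum>j<m. dg (F j) s)" if "s < L" for s
    using sol that by (simp add: v_def solution_def)
  have cong: "tokens f = tokens g" if fg: "\<And>s. s < L \<Longrightarrow> f s = g s" for f g
  proof
    fix x
    show "tokens f x = tokens g x" using fg[OF loc_row_less_L[of x]] by (simp add: tokens_def)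
  qed
  have "\<exists>\<sigma><SS. Inv \<sigma> (tokens (v t)) \<and> (\<forall>\<sigma>'<SS. v t (st_row \<sigma>') = of_bool (\<sigma>' = \<sigma>))" if "t \<le> T" for t
    using that
  proof (induction t)
    case 0
    then show ?case using I init cong[of "v 0"] by (intro exI[of _ "\<sigma>\<^sub>0"]) (simp add: v0 st_row_less_L)
  next
    case (Suc t)
    then obtain \<sigma> where \<sigma>: "\<sigma> < SS" "Inv \<sigma> (tokens (v t))" "\<forall>\<sigma>'<SS. v t (st_row \<sigma>') = of_bool (\<sigma>' = \<sigma>)" by auto
    have t: "t < T" using Suc.prems by simp
    then have "E t \<subseteq> spots" using sol by (simp add: solution_def)
    from layer_sound[OF this \<sigma>(1)] \<sigma>(3) t obtain A \<sigma>' B i where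
      tr: "(\<sigma>, A, \<sigma>', B) \<in> set trans" "i < N" "\<forall>\<sigma>''<SS. prods (E t) (st_row \<sigma>'') = of_bool (\<sigma>'' = \<sigma>')"
      "\<forall>b < N + 2. \<forall>k < KK. of_bool ((b, k) \<in> shift i A) \<le> cons (E t) (loc_row b k) \<and>
      prods (E t) (loc_row b k) \<le> cons (E t) (loc_row b k) - of_bool ((b, k) \<in> shift i A) + of_bool ((b, k) \<in> shift i B)"
      by (auto simp: v_def)
    have wf: "\<sigma>' < SS" "A \<subseteq> {..<3} \<times> {..<KK}" using wf_trans[OF tr(1)] by auto
    have "of_bool (x \<in> shift i A) \<le> tokens (v t) x" for x
      using tr(4) t shift_in_range[OF wf(2) tr(2), of x] by (cases x) (auto simp: tokens_def v_def in_range_def)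
    moreover have "tokens (v (Suc t)) x \<le> tokens (v t) x - of_bool (x \<in> shift i A) + of_bool (x \<in> shift i B)" for x
    proof (cases "in_range x")
      case True
      then show ?thesis using tr(4) t vS[OF loc_row_less_L[OF True] t]
        by (cases x) (auto simp: tokens_def v_def[of t] in_range_def)
    next
      case False
      then show ?thesis using shift_in_range[OF wf(2) tr(2), of x] by (auto simp: tokens_def)
    qed
    ultimately have "Inv \<sigma>' (tokens (v (Suc t)))" using step[OF \<sigma>(2) tr(1,2)] by blast
    moreover have "\<forall>\<sigma>''<SS. v (Suc t) (st_row \<sigma>'') = of_bool (\<sigma>'' = \<sigma>')"
      using tr(3) vS t st_row_less_L by simp
    ultimately show ?case using wf(1) by blast
  qed
  from this[of T] obtain \<sigma> where \<sigma>: "\<sigma> < SS" "Inv \<sigma> (tokens (v T))" "\<forall>\<sigma>'<SS. v T (st_row \<sigma>') = of_bool (\<sigma>' = \<sigma>)" by auto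
  then have "of_bool (\<sigma> = \<sigma>\<^sub>1) = (1 :: int)" using vT[OF st_row_less_L[OF \<sigma>(1)]] F(2) by auto
  then show ?thesis using \<sigma>(2) by auto
qed

text \<open>\<open>K\<close> is the set of tokens kept. All tokens not consumed by the transition
  must lie where a pass or discard tile can handle them, and kept tokens must differ from produced
  ones because a marking is a set here.\<close>

definition fire :: "nat \<times> (nat \<times> nat) set \<Rightarrow> nat \<times> (nat \<times> nat) set \<Rightarrow> bool" where
  "fire M M' \<longleftrightarrow> (\<exists>A B i K. (fst M, A, fst M', B) \<in> set trans \<and> i < N \<and> shift i A \<subseteq> snd M \<and>
     K \<subseteq> snd M - shift i A \<and> snd M - shift i A \<subseteq> {1..N} \<times> {..<KK} \<and>
     K \<inter> shift i B = {} \<and> snd M' = K \<union> shift i B)"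

lemma layer_complete:
  assumes "fire M M'"
  shows "\<exists>E \<subseteq> spots. (\<forall>\<sigma><SS. cons E (st_row \<sigma>) = of_bool (\<sigma> = fst M) \<and> prods E (st_row \<sigma>) = of_bool (\<sigma> = fst M')) \<and>
    (\<forall>b < N + 2. \<forall>k < KK. cons E (loc_row b k) = of_bool ((b, k) \<in> snd M) \<and>
      prods E (loc_row b k) = of_bool ((b, k) \<in> snd M'))"
proof -
  obtain \<sigma> U \<sigma>' U' where M: "M = (\<sigma>, U)" "M' = (\<sigma>', U')" by (cases M; cases M')
  with assms obtain A B i K where f: "(\<sigma>, A, \<sigma>', B) \<in> set trans" "i < N" "shift i A \<subseteq> U"
    "K \<subseteq> U - shift i A" "U - shift i A \<subseteq> {1..N} \<times> {..<KK}" "K \<inter> shift i B = {}" "U' = K \<union> shift i B"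
    by (auto simp: fire_def)
  obtain j where j: "j < length trans" "trans ! j = (\<sigma>, A, \<sigma>', B)" using f(1) by (metis in_set_conv_nth)
  define D where "D = U - shift i A - K"
  \<comment> \<open>A token at position \<open>b\<close> is the centre of the tile at
    \<open>b - 1\<close>. Kinds below \<open>KK\<close> pass a token on, the next \<open>KK\<close>
    discard one, and the transitions follow.\<close>
  define e where "e = (\<lambda>x. (fst x - 1, snd x)) ` K"
  define d where "d = (\<lambda>x. (fst x - 1, KK + snd x)) ` D"
  define p where "p = (i, 2 * KK + j)"
  have K: "K \<subseteq> {1..N} \<times> {..<KK}" and D: "D \<subseteq> {1..N} \<times> {..<KK}" using f(4,5) by (auto simp: D_def)
  then have fin: "finite K" "finite D" by (auto intro: finite_subset)
  define E where "E = insert p (e \<union> d)"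
  have inj: "inj_on (\<lambda>x. (fst x - 1, c + snd x)) X" if X: "X \<subseteq> {1..N} \<times> {..<KK}" for c X
  proof (rule inj_onI)
    fix x y assume "x \<in> X" "y \<in> X" and eq: "(fst x - 1, c + snd x) = (fst y - 1, c + snd y)"
    then have "1 \<le> fst x" "1 \<le> fst y" using X by auto
    then show "x = y" using eq by (auto simp: prod_eq_iff)
  qed
  have injK: "inj_on (\<lambda>x. (fst x - 1, snd x)) K" using inj[OF K, of 0] by simp
  have injD: "inj_on (\<lambda>x. (fst x - 1, KK + snd x)) D" using D by (rule inj)
  have disj: "p \<notin> e \<union> d" "e \<inter> d = {}"
    using K D by (force simp: p_def e_def d_def)+
  have E: "E \<subseteq> spots" using K D f(2) j(1) by (force simp: E_def p_def e_def d_def spots_def length_kinds)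
  have sum: "(\<Sum>q\<in>E. g q) = g p + (\<Sum>x\<in>K. g (fst x - 1, snd x)) + (\<Sum>x\<in>D. g (fst x - 1, KK + snd x))"
    for g :: "nat \<times> nat \<Rightarrow> int"
  proof -
    have "sum g e = (\<Sum>x\<in>K. g (fst x - 1, snd x))" "sum g d = (\<Sum>x\<in>D. g (fst x - 1, KK + snd x))"
      unfolding e_def d_def by (rule sum.reindex[OF injK, unfolded o_def] sum.reindex[OF injD, unfolded o_def])+
    moreover have "finite e" "finite d" using fin by (auto simp: e_def d_def)
    ultimately show ?thesis using disj unfolding E_def by (simp add: sum.union_disjoint)
  qed
  have p: "Cl p = shift i A" "Pl p = shift i B" "Cs p = {\<sigma>}" "Ps p = {\<sigma>'}"
    using j by (simp_all add: p_def Cl_def Pl_def Cs_def Ps_def kinds_trans)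
  have ek: "Cl (fst x - Suc 0, snd x) = {x}" "Pl (fst x - Suc 0, snd x) = {x}" "Cs (fst x - Suc 0, snd x) = {}" "Ps (fst x - Suc 0, snd x) = {}"
    if "x \<in> K" for x
    using K that by (auto simp: Cl_def Pl_def Cs_def Ps_def kinds_pass shift_def)
  have dk: "Cl (fst x - Suc 0, KK + snd x) = {x}" "Pl (fst x - Suc 0, KK + snd x) = {}"
    "Cs (fst x - Suc 0, KK + snd x) = {}" "Ps (fst x - Suc 0, KK + snd x) = {}"
    if "x \<in> D" for x
    using D that by (auto simp: Cl_def Pl_def Cs_def Ps_def kinds_discard shift_def)
  have one: "(\<Sum>x\<in>X. of_bool (y = x)) = (of_bool (y \<in> X) :: int)" if "finite X" for X :: "(nat \<times> nat) set" and y
    using that by (simp add: of_bool_def)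
  have st: "cons E (st_row s) = of_bool (s = \<sigma>)" "prods E (st_row s) = of_bool (s = \<sigma>')" if "s < SS" for s
    unfolding cons_st[OF E that] sum by (simp_all add: p ek dk)
  have lc: "cons E (loc_row b k) = of_bool ((b, k) \<in> U)" "prods E (loc_row b k) = of_bool ((b, k) \<in> U')"
    if "b < N + 2" "k < KK" for b k
  proof -
    have "cons E (loc_row b k) = of_bool ((b, k) \<in> shift i A) + of_bool ((b, k) \<in> K) + of_bool ((b, k) \<in> D)"
      unfolding cons_loc[OF E that] sum using one fin by (simp add: p ek dk)
    also have "\<dots> = of_bool ((b, k) \<in> U)" using f(3,4) by (auto simp: D_def)
    finally show "cons E (loc_row b k) = of_bool ((b, k) \<in> U)" .
    have "prods E (loc_row b k) = of_bool ((b, k) \<in> shift i B) + of_bool ((b, k) \<in> K)"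
      unfolding cons_loc[OF E that] sum using one fin by (simp add: p ek dk)
    also have "\<dots> = of_bool ((b, k) \<in> U')" using f(6,7) by auto
    finally show "prods E (loc_row b k) = of_bool ((b, k) \<in> U')" .
  qed
  have "\<forall>s<SS. cons E (st_row s) = of_bool (s = \<sigma>) \<and> prods E (st_row s) = of_bool (s = \<sigma>')"
    "\<forall>b < N + 2. \<forall>k < KK. cons E (loc_row b k) = of_bool ((b, k) \<in> U) \<and>
      prods E (loc_row b k) = of_bool ((b, k) \<in> U')"
    by (intro allI impI conjI st lc; assumption)+
  note all = this
  show ?thesis unfolding M fst_conv snd_conv
    by (rule exI[of _ E], rule conjI[OF E conjI[OF all]])
qed

lemma solution_complete:
  assumes "f 0 = (\<sigma>\<^sub>0, U\<^sub>0)" "f T = (\<sigma>\<^sub>1, U\<^sub>1)" "\<And>t. t < T \<Longrightarrow> fire (f t) (f (Suc t))"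
    and I: "\<forall>\<sigma><SS. (\<Sum>j<m. dg (I j) (st_row \<sigma>)) = of_bool (\<sigma> = \<sigma>\<^sub>0)"
      "\<forall>b < N + 2. \<forall>k < KK. (\<Sum>j<m. dg (I j) (loc_row b k)) = of_bool ((b, k) \<in> U\<^sub>0)"
    and F: "\<forall>\<sigma><SS. (\<Sum>j<m. dg (F j) (st_row \<sigma>)) = of_bool (\<sigma> = \<sigma>\<^sub>1)"
      "\<forall>b < N + 2. \<forall>k < KK. (\<Sum>j<m. dg (F j) (loc_row b k)) = of_bool ((b, k) \<in> U\<^sub>1)"
  shows "\<exists>E. solution m I F E"
proof -
  define v where "v M s = (if s < KK * (N + 2) then of_bool ((s div KK, s mod KK) \<in> snd M)
    else of_bool (s - KK * (N + 2) = fst M) :: int)" for M :: "nat \<times> (nat \<times> nat) set" and s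
  have v_loc: "v M (loc_row b k) = of_bool ((b, k) \<in> snd M)" if "b < N + 2" "k < KK" for M b k
    using row_less[OF that] that by (simp add: v_def) (simp add: loc_row_def)
  have v_st: "v M (st_row \<sigma>) = of_bool (\<sigma> = fst M)" for M \<sigma>
    by (simp add: v_def st_row_def)
  have rows: "g s = v M s" if "s < L" "\<forall>\<sigma><SS. g (st_row \<sigma>) = of_bool (\<sigma> = fst M)"
    "\<forall>b < N + 2. \<forall>k < KK. g (loc_row b k) = of_bool ((b, k) \<in> snd M)" for g M s
    using that(1) by (cases rule: row_cases) (use that(2,3) in \<open>simp_all add: v_loc v_st\<close>)
  have ex: "\<exists>E. E \<subseteq> spots \<and> (\<forall>s<L. cons E s = v (f t) s \<and> prods E s = v (f (Suc t)) s)" if tT: "t < T" for t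
  proof -
    obtain E where E: "E \<subseteq> spots" "\<forall>\<sigma><SS. cons E (st_row \<sigma>) = of_bool (\<sigma> = fst (f t)) \<and> prods E (st_row \<sigma>) = of_bool (\<sigma> = fst (f (Suc t)))"
      "\<forall>b < N + 2. \<forall>k < KK. cons E (loc_row b k) = of_bool ((b, k) \<in> snd (f t)) \<and>
      prods E (loc_row b k) = of_bool ((b, k) \<in> snd (f (Suc t)))"
      using layer_complete[OF assms(3)[OF tT]] by blast
    have "cons E s = v (f t) s" "prods E s = v (f (Suc t)) s" if "s < L" for s
      using that E(2,3) by (intro rows; simp)+
    then show ?thesis using E(1) by blast
  qed
  define E where "E t = (SOME E. E \<subseteq> spots \<and> (\<forall>s<L. cons E s = v (f t) s \<and> prods E s = v (f (Suc t)) s))" for t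
  have E: "E t \<subseteq> spots \<and> (\<forall>s<L. cons (E t) s = v (f t) s \<and> prods (E t) s = v (f (Suc t)) s)" if "t < T" for t
    unfolding E_def by (rule someI_ex[OF ex[OF that]])
  have IF: "(\<Sum>j<m. dg (I j) s) = v (f 0) s" "(\<Sum>j<m. dg (F j) s) = v (f T) s" if "s < L" for s
    using that I F by (intro rows; simp add: assms(1,2))+
  have "solution m I F E" unfolding solution_def
  proof (intro conjI allI impI)
    fix t assume "t < T"
    then show "E t \<subseteq> spots" using E by blast
  next
    fix s assume s: "s < L"
    show "cons (E 0) s = (\<Sum>j<m. dg (I j) s)" using E[OF T_pos] IF(1) s by simp
    show "prods (E (T - 1)) s = (\<Sum>j<m. dg (F j) s)" using E[of "T - 1"] T_pos IF(2) s by simp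
    fix t assume "t + 1 < T"
    then show "cons (E (t + 1)) s = prods (E t) s" using E[of t] E[of "t + 1"] s by simp
  qed
  then show ?thesis by blast
qed

end

section \<open>Simulating a verifier\<close>

text \<open>\<open>hK\<close> and \<open>cK\<close> are the kinds of head and cell tokens; the control waits for the next step (\<open>wt\<close>),
  acts on tape \<open>j\<close> (\<open>ac\<close>), or guesses the certificate (\<open>gs\<close>).\<close>

definition hK :: "nat \<Rightarrow> nat" where "hK j = prod_encode (j, 0)"
definition cK :: "nat \<Rightarrow> nat \<Rightarrow> nat" where "cK j a = prod_encode (j, Suc a)"

definition wt :: "nat \<Rightarrow> nat" where "wt q = prod_encode (0, q)"
definition ac :: "nat \<Rightarrow> nat \<Rightarrow> nat list \<Rightarrow> nat" where
  "ac j q ss = prod_encode (1, prod_encode (j, prod_encode (q, list_encode ss)))"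
definition gs :: "bool \<Rightarrow> nat" where "gs b = prod_encode (2, of_bool b)"

lemma kind_eq [simp]: "hK i = hK j \<longleftrightarrow> i = j" "cK i a = cK j b \<longleftrightarrow> i = j \<and> a = b" "hK i \<noteq> cK j b" "cK j b \<noteq> hK i"
  by (simp_all add: hK_def cK_def)

lemma ctl_eq [simp]:
  "wt q = wt q' \<longleftrightarrow> q = q'" "ac j q ss = ac j' q' ss' \<longleftrightarrow> j = j' \<and> q = q' \<and> ss = ss'" "gs b = gs b' \<longleftrightarrow> b = b'"
  "wt q \<noteq> ac j q' ss" "ac j q' ss \<noteq> wt q" "wt q \<noteq> gs b" "gs b \<noteq> wt q" "ac j q ss \<noteq> gs b" "gs b \<noteq> ac j q ss"
  by (auto simp: wt_def ac_def gs_def list_encode_eq)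

fun dm :: "direction \<Rightarrow> nat" where
  "dm Go_Left = 0" | "dm Stay = 1" | "dm Go_Right = 2"

lemma move_head_dm: "move_head m i = i + int (dm m) - 1"
  by (cases m) auto

text \<open>Reading requires the head token and the cell token at the same position, the centre; in
  \<open>rdB\<close> the offset of the head token encodes the move.\<close>

definition rdA :: "nat \<Rightarrow> nat \<Rightarrow> (nat \<times> nat) set" where
  "rdA j a = {(1, hK j), (1, cK j a)}"

definition rdB :: "nat \<Rightarrow> nat \<times> direction \<Rightarrow> (nat \<times> nat) set" where
  "rdB j act = {(dm (snd act), hK j), (1, cK j (fst act))}"

definition live :: "tm \<Rightarrow> nat set" where
  "live V = {q. q < tm_states V \<and> q \<noteq> tm_accept V \<and> q \<noteq> tm_reject V}"

definition words :: "tm \<Rightarrow> nat list set" where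
  "words V = {ss. length ss = tm_tapes V \<and> (\<forall>s \<in> set ss. s < tm_symbols V)}"

text \<open>The net guesses the certificate from right to left, starting with the head of tape 1 on cell
  \<open>m - 1\<close> and stopping at the extra symbol on cell \<open>-1\<close>; \<open>gs b\<close> remembers whether a bit has been
  written.  Then it simulates \<open>V\<close>, processing the tapes one at a time in each step and
  guessing the symbols read beforehand.\<close>

inductive_set TR :: "tm \<Rightarrow> (nat \<times> (nat \<times> nat) set \<times> nat \<times> (nat \<times> nat) set) set" for V where
  TR_start: "q \<in> live V \<Longrightarrow> ss \<in> words V \<Longrightarrow> (wt q, {}, ac 0 q ss, {}) \<in> TR V"
| TR_act: "q \<in> live V \<Longrightarrow> ss \<in> words V \<Longrightarrow> j < tm_tapes V \<Longrightarrow>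
    (ac j q ss, rdA j (ss ! j), ac (Suc j) q ss, rdB j (snd (tm_delta V q ss) ! j)) \<in> TR V"
| TR_end: "q \<in> live V \<Longrightarrow> ss \<in> words V \<Longrightarrow> (ac (tm_tapes V) q ss, {}, wt (fst (tm_delta V q ss)), {}) \<in> TR V"
| TR_acc: "(wt (tm_accept V), {}, wt (tm_accept V), {}) \<in> TR V"
| TR_blank: "(gs False, rdA 1 0, gs False, rdB 1 (0, Go_Left)) \<in> TR V"
| TR_bit: "(gs b, rdA 1 0, gs True, rdB 1 (if c then 2 else 1, Go_Left)) \<in> TR V"
| TR_guess_end: "(gs b, rdA 1 (tm_symbols V), wt (tm_start V), rdB 1 (0, Go_Right)) \<in> TR V"

text \<open>Finiteness allows the transitions to be listed and their control states to be
  bounded.\<close>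

lemma finite_TR: "finite (TR V)"
proof -
  have fw: "finite (words V)"
    unfolding words_def using finite_lists_length_eq[of "{..<tm_symbols V}" "tm_tapes V"]
    by (rule rev_finite_subset) auto
  have fl: "finite (live V)" by (simp add: live_def)
  let ?S = "(\<lambda>(q, ss). (wt q, {}, ac 0 q ss, {})) ` (live V \<times> words V) \<union>
    (\<lambda>(j, q, ss). (ac j q ss, rdA j (ss ! j), ac (Suc j) q ss, rdB j (snd (tm_delta V q ss) ! j))) `
      ({..<tm_tapes V} \<times> live V \<times> words V) \<union>
    (\<lambda>(q, ss). (ac (tm_tapes V) q ss, {}, wt (fst (tm_delta V q ss)), {})) ` (live V \<times> words V) \<union>
    {(wt (tm_accept V), {}, wt (tm_accept V), {}), (gs False, rdA 1 0, gs False, rdB 1 (0, Go_Left))} \<union>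
    (\<lambda>(b, c). (gs b, rdA 1 0, gs True, rdB 1 (if c then 2 else 1, Go_Left))) ` UNIV \<union>
    (\<lambda>b. (gs b, rdA 1 (tm_symbols V), wt (tm_start V), rdB 1 (0, Go_Right))) ` UNIV"
  have "TR V \<subseteq> ?S"
  proof
    fix y assume "y \<in> TR V"
    moreover obtain s A s' B where "y = (s, A, s', B)" by (cases y)
    ultimately have "(s, A, s', B) \<in> TR V" by simp
    then have "(s, A, s', B) \<in> ?S"
    proof (cases rule: TR.cases)
      case (TR_start q ss)
      then show ?thesis by (intro UnI1 image_eqI[of _ _ "(q, ss)"]) auto
    next
      case (TR_act q ss j)
      then show ?thesis by (intro UnI1 UnI2 image_eqI[of _ _ "(j, q, ss)"]) auto
    next
      case (TR_end q ss)
      then show ?thesis by (intro UnI1 UnI2 image_eqI[of _ _ "(q, ss)"]) auto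
    next
      case (TR_bit b c)
      then show ?thesis by (intro UnI1 UnI2 image_eqI[of _ _ "(b, c)"]) auto
    qed auto
    with \<open>y = (s, A, s', B)\<close> show "y \<in> ?S" by (simp only:)
  qed
  then show ?thesis by (rule finite_subset) (use fw fl in simp)
qed

text \<open>Cell \<open>c\<close> sits at position \<open>c + Z + 1\<close>, so the cells from
  \<open>-Z\<close> to \<open>Z\<close> occupy the positions 1 to \<open>2 * Z + 1\<close>.\<close>

definition tok :: "nat \<Rightarrow> tape list \<Rightarrow> (nat \<times> nat) set" where
  "tok Z tps = {(b, k). \<exists>j < length tps. (k = hK j \<and> int b = fst (tps ! j) + int Z + 1) \<or>
     k = cK j (snd (tps ! j) (int b - int Z - 1))}"

lemma tok_hK: "(b, hK j) \<in> tok Z tps \<longleftrightarrow> j < length tps \<and> int b = fst (tps ! j) + int Z + 1"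
  by (auto simp: tok_def)

lemma tok_cK: "(b, cK j a) \<in> tok Z tps \<longleftrightarrow> j < length tps \<and> a = snd (tps ! j) (int b - int Z - 1)"
  by (auto simp: tok_def)

lemma shift_rdA: "shift i (rdA j a) = {(i + 1, hK j), (i + 1, cK j a)}"
  by (auto simp: shift_def rdA_def)

lemma shift_rdB: "shift i (rdB j act) = {(i + dm (snd act), hK j), (i + 1, cK j (fst act))}"
  by (auto simp: shift_def rdB_def)

lemma act_tape_eq: "act_tape act tp = (fst tp + int (dm (snd act)) - 1, (snd tp)(fst tp := fst act))"
  by (cases act; cases tp) (simp add: move_head_dm)

lemma read_tape_eq: "read_tape tp = snd tp (fst tp)"
  by (cases tp) simp

text \<open>Each tape has one head token and each cell one symbol token, so replacing the two tokens
  read amounts to the action on the tape. The third claim provides the disjointness that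
  \<open>fire\<close> demands.\<close>

lemma tok_update:
  assumes "j < length tps" "fst (tps ! j) = int i - int Z" "a = snd (tps ! j) (int i - int Z)"
  shows "shift i (rdA j a) \<subseteq> tok Z tps"
    "tok Z (tps[j := act_tape act (tps ! j)]) = (tok Z tps - shift i (rdA j a)) \<union> shift i (rdB j act)"
    "(tok Z tps - shift i (rdA j a)) \<inter> shift i (rdB j act) = {}"
proof -
  show "shift i (rdA j a) \<subseteq> tok Z tps"
    using assms by (simp add: shift_rdA tok_hK tok_cK)
  show "(tok Z tps - shift i (rdA j a)) \<inter> shift i (rdB j act) = {}"
    using assms by (auto simp: shift_rdA shift_rdB tok_hK tok_cK)
  show "tok Z (tps[j := act_tape act (tps ! j)]) = (tok Z tps - shift i (rdA j a)) \<union> shift i (rdB j act)"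
  proof (rule set_eqI)
    fix y :: "nat \<times> nat"
    obtain b k where y: "y = (b, k)" by (cases y)
    consider j' where "k = hK j'" | j' a' where "k = cK j' a'" | "\<And>j. k \<noteq> hK j" "\<And>j a. k \<noteq> cK j a" by blast
    then show "y \<in> tok Z (tps[j := act_tape act (tps ! j)]) \<longleftrightarrow> y \<in> (tok Z tps - shift i (rdA j a)) \<union> shift i (rdB j act)"
    proof cases
      case (1 j')
      then show ?thesis using assms
        by (cases "j' = j") (auto simp: y tok_hK shift_rdA shift_rdB act_tape_eq)
    next
      case (2 j' a')
      have "int b - int Z - 1 = int i - int Z \<longleftrightarrow> b = i + 1" by auto
      then show ?thesis using assms 2
        by (cases "j' = j"; cases "b = i + 1") (auto simp: y tok_cK shift_rdA shift_rdB act_tape_eq)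
    next
      case 3
      then show ?thesis by (auto simp: y tok_def shift_rdA shift_rdB)
    qed
  qed
qed

text \<open>A marking below the true one can feed the transition only if the tokens read are truly
  there. Hence the head position and the symbol are the real ones, whatever has been lost
  before.\<close>

lemma tok_sound:
  fixes n n' :: "nat \<times> nat \<Rightarrow> int"
  assumes "j < length tps" "\<forall>y. n y \<le> of_bool (y \<in> tok Z tps)" "\<forall>y. of_bool (y \<in> shift i (rdA j a)) \<le> n y"
    "\<forall>y. n' y \<le> n y - of_bool (y \<in> shift i (rdA j a)) + of_bool (y \<in> shift i (rdB j act))"
  shows "fst (tps ! j) = int i - int Z" "a = read_tape (tps ! j)"
    "\<forall>y. n' y \<le> of_bool (y \<in> tok Z (tps[j := act_tape act (tps ! j)]))"
proof -
  have A: "y \<in> tok Z tps" if "y \<in> shift i (rdA j a)" for y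
  proof (rule ccontr)
    assume "y \<notin> tok Z tps"
    then have "n y \<le> 0" using assms(2)[rule_format, of y] by simp
    then show False using assms(3)[rule_format, of y] that by simp
  qed
  have "(i + 1, hK j) \<in> tok Z tps" "(i + 1, cK j a) \<in> tok Z tps"
    by (rule A, simp add: shift_rdA)+
  then have *: "fst (tps ! j) = int i - int Z" "a = snd (tps ! j) (int i - int Z)"
    by (auto simp: tok_hK tok_cK)
  then show "fst (tps ! j) = int i - int Z" "a = read_tape (tps ! j)"
    by (simp_all add: read_tape_eq)
  note up = tok_update(1)[OF assms(1) *] tok_update(2)[OF assms(1) *, of act] tok_update(3)[OF assms(1) *, of act]
  show "\<forall>y. n' y \<le> of_bool (y \<in> tok Z (tps[j := act_tape act (tps ! j)]))"
  proof
    fix y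
    have "n' y \<le> of_bool (y \<in> tok Z tps) - of_bool (y \<in> shift i (rdA j a)) + of_bool (y \<in> shift i (rdB j act))"
      using assms(2)[rule_format, of y] assms(4)[rule_format, of y] by linarith
    also have "\<dots> = of_bool (y \<in> (tok Z tps - shift i (rdA j a)) \<union> shift i (rdB j act))"
      using up(1,3) by (cases "y \<in> shift i (rdA j a)"; cases "y \<in> shift i (rdB j act)") auto
    finally show "n' y \<le> of_bool (y \<in> tok Z (tps[j := act_tape act (tps ! j)]))" unfolding up(2) .
  qed
qed

section \<open>Runs of the verifier\<close>

lemma run_Suc: "run_tm V ws (Suc t) = step_tm V (run_tm V ws t)"
  by (simp add: run_tm_def)

lemma wf_tmD:
  assumes "wf_tm V" "q < tm_states V" "ss \<in> words V"
  shows "fst (tm_delta V q ss) < tm_states V" "length (snd (tm_delta V q ss)) = tm_tapes V"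
    "l < tm_tapes V \<Longrightarrow> fst (snd (tm_delta V q ss) ! l) < tm_symbols V"
proof -
  have *: "fst (tm_delta V q ss) < tm_states V \<and> length (snd (tm_delta V q ss)) = tm_tapes V \<and>
        (\<forall>(s, m) \<in> set (snd (tm_delta V q ss)). s < tm_symbols V)"
    using assms unfolding wf_tm_def words_def by blast
  then show "fst (tm_delta V q ss) < tm_states V" "length (snd (tm_delta V q ss)) = tm_tapes V" by auto
  assume "l < tm_tapes V"
  then have "snd (tm_delta V q ss) ! l \<in> set (snd (tm_delta V q ss))" using * by (intro nth_mem) simp
  with * show "fst (snd (tm_delta V q ss) ! l) < tm_symbols V" by (cases "snd (tm_delta V q ss) ! l") fastforce
qed

text \<open>These bounds keep the run inside the window of cells and its symbols among the token
  kinds.\<close>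

definition good :: "tm \<Rightarrow> nat \<Rightarrow> config \<Rightarrow> bool" where
  "good V t c \<longleftrightarrow> fst c < tm_states V \<and> length (snd c) = tm_tapes V \<and>
     (\<forall>l < tm_tapes V. \<bar>fst (snd c ! l)\<bar> \<le> int t \<and> (\<forall>i. snd (snd c ! l) i < tm_symbols V))"

lemma read_in_words:
  assumes "good V t (q, tps)"
  shows "map read_tape tps \<in> words V"
proof -
  have "read_tape (tps ! l) < tm_symbols V" if "l < tm_tapes V" for l
    using assms that by (simp add: good_def read_tape_eq)
  then show ?thesis using assms by (simp add: words_def good_def all_set_conv_all_nth)
qed

lemma step_not_halted:
  "\<not> halted V (q, tps) \<Longrightarrow> step_tm V (q, tps) =
    (fst (tm_delta V q (map read_tape tps)), map2 act_tape (snd (tm_delta V q (map read_tape tps))) tps)"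
  by (simp add: step_tm_def split_beta)

lemma good_step:
  assumes "wf_tm V" "good V t c"
  shows "good V (Suc t) (step_tm V c)"
proof (cases "halted V c")
  case True
  then show ?thesis using assms(2) by (force simp: step_tm_def good_def)
next
  case False
  obtain q tps where c: "c = (q, tps)" by (cases c)
  let ?ss = "map read_tape tps"
  have q: "q < tm_states V" and len: "length tps = tm_tapes V" using assms(2) by (auto simp: good_def c)
  note d = wf_tmD[OF assms(1) q read_in_words[OF assms(2)[unfolded c]]]
  have step: "step_tm V c = (fst (tm_delta V q ?ss), map2 act_tape (snd (tm_delta V q ?ss)) tps)"
    unfolding c by (rule step_not_halted) (use False c in simp)
  have "map2 act_tape (snd (tm_delta V q ?ss)) tps ! l = act_tape (snd (tm_delta V q ?ss) ! l) (tps ! l)"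
    if "l < tm_tapes V" for l
    using that d(2) len by simp
  moreover have "\<bar>fst (act_tape act tp)\<bar> \<le> int (Suc t)" if "\<bar>fst tp\<bar> \<le> int t" for act tp
    using that by (cases "snd act") (auto simp: act_tape_eq)
  moreover have "snd (act_tape act tp) i < g" if "\<And>i. snd tp i < g" "fst act < g" for act tp i g
    using that by (auto simp: act_tape_eq)
  ultimately show ?thesis
    using assms(2) d len unfolding step by (simp add: good_def c)
qed

lemma good_run:
  assumes "wf_tm V"
  shows "good V t (run_tm V ws t)"
proof (induction t)
  case 0
  have "3 \<le> tm_symbols V" "tm_start V < tm_states V" using assms by (auto simp: wf_tm_def)
  moreover have "word_cells w i < 3" for w i by (simp add: word_cells_def)
  ultimately show ?case
    by (auto simp: run_tm_def good_def init_config_def intro: less_le_trans)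
next
  case (Suc t)
  then show ?case unfolding run_Suc by (rule good_step[OF assms])
qed

text \<open>The tapes in the middle of a step, when the first \<open>j\<close> of them have been
  processed.\<close>

definition acted :: "(nat \<times> direction) list \<Rightarrow> nat \<Rightarrow> tape list \<Rightarrow> tape list" where
  "acted acts j tps = map (\<lambda>l. if l < j then act_tape (acts ! l) (tps ! l) else tps ! l) [0..<length tps]"

lemma length_acted [simp]: "length (acted acts j tps) = length tps"
  by (simp add: acted_def)

lemma acted_nth: "l < length tps \<Longrightarrow> acted acts j tps ! l = (if l < j then act_tape (acts ! l) (tps ! l) else tps ! l)"
  by (simp add: acted_def)

lemma acted_0: "acted acts 0 tps = tps"
  by (rule nth_equalityI) (auto simp: acted_nth)

lemma acted_Suc:
  "j < length tps \<Longrightarrow> acted acts (Suc j) tps = (acted acts j tps)[j := act_tape (acts ! j) (acted acts j tps ! j)]"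
  by (rule nth_equalityI) (auto simp: acted_nth nth_list_update less_Suc_eq)

lemma acted_all: "length acts = length tps \<Longrightarrow> acted acts (length tps) tps = map2 act_tape acts tps"
  by (rule nth_equalityI) (auto simp: acted_nth)

text \<open>The second tape during the guessing: the head is at \<open>p\<close>, the part
  \<open>w\<close> guessed so far starts at \<open>p + 1\<close>, and \<open>tm_symbols V\<close>, a
  symbol outside the alphabet, marks cell -1.\<close>

definition gword :: "tm \<Rightarrow> int \<Rightarrow> bool list \<Rightarrow> int \<Rightarrow> nat" where
  "gword V p w i = (if i = -1 then tm_symbols V else if p < i then word_cells w (i - p - 1) else 0)"

definition gtapes :: "tm \<Rightarrow> bool list \<Rightarrow> int \<Rightarrow> bool list \<Rightarrow> tape list" where
  "gtapes V x p w = map (\<lambda>j. if j = 1 then (p, gword V p w) else (0, word_cells (if j = 0 then x else []))) [0..<tm_tapes V]"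

lemma length_gtapes [simp]: "length (gtapes V x p w) = tm_tapes V"
  by (simp add: gtapes_def)

lemma gtapes_nth:
  "j < tm_tapes V \<Longrightarrow> gtapes V x p w ! j = (if j = 1 then (p, gword V p w) else (0, word_cells (if j = 0 then x else [])))"
  by (simp add: gtapes_def)

lemma word_cells_Cons: "word_cells (c # w) i = (if i = 0 then (if c then 2 else 1) else word_cells w (i - 1))"
proof (cases "0 < i")
  case True
  then have "nat i = Suc (nat (i - 1))" by simp
  then show ?thesis using True by (simp add: word_cells_def)
qed (auto simp: word_cells_def)

lemma gtapes_bit:
  assumes "1 < tm_tapes V" "0 \<le> p"
  shows "(gtapes V x p w)[1 := act_tape (if c then 2 else 1, Go_Left) (gtapes V x p w ! 1)] = gtapes V x (p - 1) (c # w)"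
proof -
  have "(gword V p w)(p := if c then 2 else 1) = gword V (p - 1) (c # w)"
    using assms(2) by (rule_tac ext) (simp add: gword_def word_cells_Cons)
  then show ?thesis using assms(1)
    by (intro nth_equalityI) (auto simp: nth_list_update gtapes_nth act_tape_eq)
qed

lemma gtapes_blank:
  assumes "1 < tm_tapes V" "0 \<le> p"
  shows "(gtapes V x p [])[1 := act_tape (0, Go_Left) (gtapes V x p [] ! 1)] = gtapes V x (p - 1) []"
proof -
  have "(gword V p [])(p := 0) = gword V (p - 1) []"
    using assms(2) by (rule_tac ext) (simp add: gword_def word_cells_def)
  then show ?thesis using assms(1)
    by (intro nth_equalityI) (auto simp: nth_list_update gtapes_nth act_tape_eq)
qed

lemma gtapes_end:
  assumes "1 < tm_tapes V"
  shows "(gtapes V x (-1) w)[1 := act_tape (0, Go_Right) (gtapes V x (-1) w ! 1)] = snd (init_config V [x, w])"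
proof -
  have "(gword V (-1) w)(-1 := 0) = word_cells w"
    by (rule ext) (simp add: gword_def word_cells_def)
  then show ?thesis using assms
    by (intro nth_equalityI) (auto simp: nth_list_update gtapes_nth act_tape_eq init_config_def nth_Cons split: nat.splits)
qed

section \<open>Counter programs\<close>

text \<open>Heads \<open>0, \<dots>, K\<close> are counters: head 0 moves on the read-only input, each
  other head on a tape whose only non-blank cell is cell 0, so that a counter can be tested for
  zero by reading.\<close>

datatype cmd = Skip | Inc nat | Dec nat | Out bool | Seq cmd cmd (infixr \<open>;;\<close> 60)
  | While nat nat cmd | If nat nat cmd cmd

type_synonym mstate = "(nat \<Rightarrow> nat) \<times> bool list"

text \<open>The bit False is the symbol 1, so a counter head reads 1 if the counter is zero and 0
  otherwise.\<close>

definition tape_word :: "bool list \<Rightarrow> nat \<Rightarrow> bool list" where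
  "tape_word x r = (if r = 0 then x else [False])"

definition sym :: "bool list \<Rightarrow> (nat \<Rightarrow> nat) \<Rightarrow> nat \<Rightarrow> nat" where
  "sym x h r = word_cells (tape_word x r) (int (h r))"

text \<open>Time is counted in machine steps of the compiled code: the extra ones are the tests and
  the jumps after a loop body or a then-branch.\<close>

inductive big :: "bool list \<Rightarrow> cmd \<Rightarrow> mstate \<Rightarrow> nat \<Rightarrow> mstate \<Rightarrow> bool" for x where
  big_Skip: "big x Skip s 0 s"
| big_Inc: "big x (Inc r) (h, u) 1 (h(r := h r + 1), u)"
| big_Dec: "0 < h r \<Longrightarrow> big x (Dec r) (h, u) 1 (h(r := h r - 1), u)"
| big_Out: "big x (Out b) (h, u) 1 (h, u @ [b])"
| big_Seq: "big x c s t s' \<Longrightarrow> big x d s' t' s'' \<Longrightarrow> big x (c ;; d) s (t + t') s''"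
| big_While_stop: "sym x (fst s) r = v \<Longrightarrow> big x (While r v c) s 1 s"
| big_While_go: "sym x (fst s) r \<noteq> v \<Longrightarrow> big x c s t s' \<Longrightarrow> big x (While r v c) s' t' s'' \<Longrightarrow>
    big x (While r v c) s (1 + (t + (1 + t'))) s''"
| big_If_true: "sym x (fst s) r = v \<Longrightarrow> big x c s t s' \<Longrightarrow> big x (If r v c d) s (1 + (t + 1)) s'"
| big_If_false: "sym x (fst s) r \<noteq> v \<Longrightarrow> big x d s t s' \<Longrightarrow> big x (If r v c d) s (1 + t) s'"

fun csize :: "cmd \<Rightarrow> nat" where
  "csize Skip = 0"
| "csize (Seq c d) = csize c + csize d"
| "csize (While r v c) = csize c + 2"
| "csize (If r v c d) = csize c + csize d + 2"
| "csize _ = 1"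

fun uses_upto :: "nat \<Rightarrow> cmd \<Rightarrow> bool" where
  "uses_upto K (Inc r) \<longleftrightarrow> r \<le> K"
| "uses_upto K (Dec r) \<longleftrightarrow> r \<le> K"
| "uses_upto K (Seq c d) \<longleftrightarrow> uses_upto K c \<and> uses_upto K d"
| "uses_upto K (While r v c) \<longleftrightarrow> r \<le> K \<and> uses_upto K c"
| "uses_upto K (If r v c d) \<longleftrightarrow> r \<le> K \<and> uses_upto K c \<and> uses_upto K d"
| "uses_upto K _ \<longleftrightarrow> True"

lemma uses_upto_mono: "uses_upto K c \<Longrightarrow> K \<le> K' \<Longrightarrow> uses_upto K' c"
  by (induction c) auto

lemma ex_uses_upto: "\<exists>K. uses_upto K c"
proof (induction c)
  case (Seq c d)
  then show ?case by (metis uses_upto.simps(3) uses_upto_mono max.cobounded1 max.cobounded2)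
next
  case (While r v c)
  then show ?case by (metis uses_upto.simps(4) uses_upto_mono max.cobounded1 max.cobounded2)
next
  case (If r v c d)
  then obtain K K' where "uses_upto K c" "uses_upto K' d" by blast
  then show ?case by (intro exI[of _ "max r (max K K')"]) (auto elim: uses_upto_mono)
qed auto

section \<open>Compilation to a Turing machine\<close>

type_synonym instr = "nat list \<Rightarrow> nat \<times> (nat \<times> direction) list"

definition keep :: "nat list \<Rightarrow> (nat \<times> direction) list" where
  "keep ss = map (\<lambda>s. (s, Stay)) ss"

fun comp :: "cmd \<Rightarrow> nat \<Rightarrow> instr list" where
  "comp Skip a = []"
| "comp (Inc r) a = [\<lambda>ss. (a + 1, (keep ss)[r := (ss ! r, Go_Right)])]"
| "comp (Dec r) a = [\<lambda>ss. (a + 1, (keep ss)[r := (ss ! r, Go_Left)])]"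
| "comp (Out b) a = [\<lambda>ss. (a + 1, (keep ss)[length ss - 1 := (if b then 2 else 1, Go_Right)])]"
| "comp (Seq c d) a = comp c a @ comp d (a + csize c)"
| "comp (While r v c) a =
     (\<lambda>ss. (if ss ! r = v then a + csize c + 2 else a + 1, keep ss)) # comp c (a + 1) @ [\<lambda>ss. (a, keep ss)]"
| "comp (If r v c d) a =
     (\<lambda>ss. (if ss ! r = v then a + 1 else a + csize c + 2, keep ss)) # comp c (a + 1) @
     (\<lambda>ss. (a + csize c + csize d + 2, keep ss)) # comp d (a + csize c + 2)"

lemma length_comp [simp]: "length (comp c a) = csize c"
  by (induction c arbitrary: a) auto

text \<open>States are instruction addresses, and falling off the end of the program reaches the
  accepting state.\<close>

definition machine :: "instr list \<Rightarrow> nat \<Rightarrow> tm" where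
  "machine P K = \<lparr>tm_tapes = K + 2, tm_states = length P + 2, tm_symbols = 3, tm_start = 0,
     tm_accept = length P, tm_reject = length P + 1,
     tm_delta = (\<lambda>q ss. if q < length P then (P ! q) ss else (0, keep ss))\<rparr>"

lemma machine_simps [simp]:
  "tm_tapes (machine P K) = K + 2" "tm_states (machine P K) = length P + 2"
  "tm_symbols (machine P K) = 3" "tm_start (machine P K) = 0"
  "tm_accept (machine P K) = length P" "tm_reject (machine P K) = length P + 1"
  by (simp_all add: machine_def)

definition valid_instr :: "nat \<Rightarrow> nat \<Rightarrow> instr \<Rightarrow> bool" where
  "valid_instr q n f \<longleftrightarrow> (\<forall>ss. length ss = n \<and> (\<forall>s \<in> set ss. s < 3) \<longrightarrow>
     fst (f ss) \<le> q \<and> length (snd (f ss)) = n \<and> (\<forall>(s, m) \<in> set (snd (f ss)). s < 3))"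

lemma valid_instrD:
  "valid_instr q n f \<Longrightarrow> length ss = n \<Longrightarrow> \<forall>s \<in> set ss. s < 3 \<Longrightarrow>
    fst (f ss) \<le> q \<and> length (snd (f ss)) = n \<and> (\<forall>(s, m) \<in> set (snd (f ss)). s < 3)"
  by (simp add: valid_instr_def)

lemma valid_instr_mono:
  assumes "valid_instr q n f" "q \<le> q'"
  shows "valid_instr q' n f"
  unfolding valid_instr_def using valid_instrD[OF assms(1)] assms(2) order_trans[of _ q q'] by blast

lemma set_list_update_ball:
  "(\<forall>x \<in> set xs. Q x) \<Longrightarrow> Q y \<Longrightarrow> \<forall>x \<in> set (xs[i := y]). Q x"
  using set_update_subset_insert[of xs i y] by blast

lemma valid_keep_update:
  assumes "\<And>ss. length ss = n \<Longrightarrow> \<forall>s \<in> set ss. s < 3 \<Longrightarrow> fst (g ss) < 3" "a \<le> q"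
  shows "valid_instr q n (\<lambda>ss. (a, (keep ss)[i ss := g ss]))"
  unfolding valid_instr_def
proof (intro allI impI conjI)
  fix ss assume ss: "length ss = n \<and> (\<forall>s \<in> set ss. s < (3::nat))"
  show "\<forall>(s, m) \<in> set (snd (a, (keep ss)[i ss := g ss])). s < 3"
    using ss assms(1)[of ss] unfolding snd_conv
    by (intro set_list_update_ball) (auto simp: keep_def)
qed (use assms(2) in \<open>auto simp: keep_def\<close>)

lemma valid_keep:
  assumes "\<And>ss. a ss \<le> q"
  shows "valid_instr q n (\<lambda>ss. (a ss, keep ss))"
  using assms by (auto simp: valid_instr_def keep_def)

lemma valid_comp:
  assumes "uses_upto K c" "f \<in> set (comp c a)"
  shows "valid_instr (a + csize c) (K + 2) f"
  using assms
proof (induction c arbitrary: a)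
  case (Out b)
  then show ?case by (auto intro!: valid_keep_update)
next
  case (Inc r)
  then show ?case by (auto intro!: valid_keep_update)
next
  case (Dec r)
  then show ?case by (auto intro!: valid_keep_update)
next
  case (Seq c d)
  then consider "f \<in> set (comp c a)" | "f \<in> set (comp d (a + csize c))" by auto
  then show ?case
  proof cases
    case 1
    show ?thesis by (rule valid_instr_mono[OF Seq.IH(1)[OF _ 1]]) (use Seq.prems in simp_all)
  next
    case 2
    show ?thesis by (rule valid_instr_mono[OF Seq.IH(2)[OF _ 2]]) (use Seq.prems in simp_all)
  qed
next
  case (While r v c)
  then consider "f = (\<lambda>ss. (if ss ! r = v then a + csize c + 2 else a + 1, keep ss))"
    | "f = (\<lambda>ss. (a, keep ss))" | "f \<in> set (comp c (a + 1))" by auto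
  then show ?case
  proof cases
    case 3
    show ?thesis by (rule valid_instr_mono[OF While.IH[OF _ 3]]) (use While.prems in simp_all)
  qed (auto intro!: valid_keep)
next
  case (If r v c d)
  then consider "f = (\<lambda>ss. (if ss ! r = v then a + 1 else a + csize c + 2, keep ss))"
    | "f = (\<lambda>ss. (a + csize c + csize d + 2, keep ss))"
    | "f \<in> set (comp c (a + 1))" | "f \<in> set (comp d (a + csize c + 2))" by auto
  then show ?case
  proof cases
    case 3
    show ?thesis by (rule valid_instr_mono[OF If.IH(1)[OF _ 3]]) (use If.prems in simp_all)
  next
    case 4
    show ?thesis by (rule valid_instr_mono[OF If.IH(2)[OF _ 4]]) (use If.prems in simp_all)
  qed (auto intro!: valid_keep)
qed simp

text \<open>The output tape comes last; its head always stands on the first free cell.\<close>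

definition tapes :: "nat \<Rightarrow> bool list \<Rightarrow> mstate \<Rightarrow> tape list" where
  "tapes K x s = map (\<lambda>r. (int (fst s r), word_cells (tape_word x r))) [0..<K + 1] @
     [(int (length (snd s)), word_cells (snd s))]"

lemma length_tapes [simp]: "length (tapes K x s) = K + 2"
  by (simp add: tapes_def)

lemma tapes_nth: "r \<le> K \<Longrightarrow> tapes K x s ! r = (int (fst s r), word_cells (tape_word x r))"
  by (simp add: tapes_def nth_append del: upt_Suc)

lemma tapes_nth_last: "tapes K x s ! (K + 1) = (int (length (snd s)), word_cells (snd s))"
  by (simp add: tapes_def nth_append del: upt_Suc)

lemma act_keep: "map2 act_tape (keep (map read_tape tps)) tps = tps"
  by (induction tps) (auto simp: keep_def)

lemma act_keep_update:
  "map2 act_tape ((keep (map read_tape tps))[r := a]) tps = tps[r := act_tape a (tps ! r)]"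
proof -
  have "map2 act_tape (xs[r := a]) tps = (map2 act_tape xs tps)[r := act_tape a (tps ! r)]" for xs
    using zip_update[of xs r a tps "tps ! r"] by (simp add: map_update)
  then show ?thesis by (simp add: act_keep)
qed

lemma read_tapes_nth:
  assumes "r \<le> K"
  shows "read_tape (tapes K x s ! r) = sym x (fst s) r"
  using assms by (simp add: tapes_nth sym_def)

lemma tapes_update_move:
  assumes "r \<le> K"
  shows "(tapes K x (h, u))[r := (int n, word_cells (tape_word x r))] = tapes K x (h(r := n), u)"
  using assms by (intro nth_equalityI) (auto simp: tapes_def nth_append nth_list_update simp del: upt_Suc)

lemma word_cells_snoc: "(word_cells u)(int (length u) := if b then 2 else 1) = word_cells (u @ [b])"
  by (rule ext) (auto simp: word_cells_def nth_append)

lemma tapes_update_out: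
  "(tapes K x (h, u))[K + 1 := (int (length u) + 1, (word_cells u)(int (length u) := if b then 2 else 1))] =
    tapes K x (h, u @ [b])"
  by (simp only: word_cells_snoc) (simp add: tapes_def list_update_append)

definition code_at :: "instr list \<Rightarrow> nat \<Rightarrow> instr list \<Rightarrow> bool" where
  "code_at P a Q \<longleftrightarrow> (\<exists>pre post. P = pre @ Q @ post \<and> length pre = a)"

lemma code_at_append:
  assumes "code_at P a (Q @ Q')"
  shows "code_at P a Q \<and> code_at P (a + length Q) Q'"
proof -
  obtain pre post where "P = pre @ (Q @ Q') @ post" "length pre = a"
    using assms unfolding code_at_def by blast
  then have "P = pre @ Q @ (Q' @ post)" "P = (pre @ Q) @ Q' @ post" "length (pre @ Q) = a + length Q"
    by simp_all
  then show ?thesis using \<open>length pre = a\<close> unfolding code_at_def by blast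
qed

lemma code_at_Cons:
  assumes "code_at P a (f # Q)"
  shows "a < length P \<and> P ! a = f \<and> code_at P (a + 1) Q"
proof -
  obtain pre post where P: "P = pre @ (f # Q) @ post" "length pre = a"
    using assms unfolding code_at_def by blast
  then have "P = (pre @ [f]) @ Q @ post" "length (pre @ [f]) = a + 1" by simp_all
  then have "code_at P (a + 1) Q" unfolding code_at_def by blast
  then show ?thesis by (simp add: P(1) flip: P(2))
qed

lemma step_machine:
  assumes "q < length P" "(P ! q) (map read_tape tps) = (q', acts)"
  shows "step_tm (machine P K) (q, tps) = (q', map2 act_tape acts tps)"
  using assms by (simp add: step_tm_def halted_def machine_def)

lemma funpow_trans: "(f ^^ t) a = b \<Longrightarrow> (f ^^ t') b = c \<Longrightarrow> (f ^^ (t + t')) a = c"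
  by (metis add.commute comp_apply funpow_add)

lemma exec_comp:
  assumes "big x c s t s'" "uses_upto K c" "code_at P a (comp c a)"
  shows "(step_tm (machine P K) ^^ t) (a, tapes K x s) = (a + csize c, tapes K x s')"
  using assms
proof (induction arbitrary: a rule: big.induct)
  case (big_Inc r h u)
  then have P: "a < length P" "P ! a = (\<lambda>ss. (a + 1, (keep ss)[r := (ss ! r, Go_Right)]))"
    by (auto dest!: code_at_Cons)
  show ?case using big_Inc.prems(1) tapes_update_move[of r K x h u "h r + 1"]
    by (simp add: step_machine[OF P(1)] P(2) act_keep_update tapes_nth add.commute[of 1])
next
  case (big_Dec h r u)
  then have P: "a < length P" "P ! a = (\<lambda>ss. (a + 1, (keep ss)[r := (ss ! r, Go_Left)]))"
    by (auto dest!: code_at_Cons)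
  show ?case using big_Dec tapes_update_move[of r K x h u "h r - 1"]
    by (simp add: step_machine[OF P(1)] P(2) act_keep_update tapes_nth of_nat_diff)
next
  case (big_Out b h u)
  then have P: "a < length P"
    "P ! a = (\<lambda>ss. (a + 1, (keep ss)[length ss - 1 := (if b then 2 else 1, Go_Right)]))"
    by (auto dest!: code_at_Cons)
  have "step_tm (machine P K) (a, tapes K x (h, u)) =
    (a + 1, (tapes K x (h, u))[K + 1 := act_tape (if b then 2 else 1, Go_Right) (tapes K x (h, u) ! (K + 1))])"
    using act_keep_update[of "tapes K x (h, u)" "K + 1"]
    by (intro step_machine[OF P(1), THEN trans]) (auto simp: P(2))
  then show ?case using tapes_update_out[of K x h u b]
    by (simp add: tapes_nth_last[simplified])
next
  case (big_Seq c s t s' d t' s'')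
  then have "code_at P a (comp c a)" "code_at P (a + csize c) (comp d (a + csize c))"
    using code_at_append[of P a "comp c a" "comp d (a + csize c)"] by auto
  with big_Seq show ?case by (intro funpow_trans) (auto simp: add.assoc)
next
  case (big_While_stop s r v c)
  then have P: "a < length P" "P ! a = (\<lambda>ss. (if ss ! r = v then a + csize c + 2 else a + 1, keep ss))"
    by (auto dest!: code_at_Cons)
  show ?case using big_While_stop
    by (simp add: step_machine[OF P(1)] P(2) act_keep read_tapes_nth)
next
  case (big_While_go s r v c t s' t' s'')
  then have P: "a < length P" "P ! a = (\<lambda>ss. (if ss ! r = v then a + csize c + 2 else a + 1, keep ss))"
    and "code_at P (a + 1) (comp c (a + 1) @ [\<lambda>ss. (a, keep ss)])"
    by (auto dest!: code_at_Cons)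
  then have c: "code_at P (a + 1) (comp c (a + 1))" and Q: "a + 1 + csize c < length P"
    "P ! (a + 1 + csize c) = (\<lambda>ss. (a, keep ss))"
    using code_at_append[of P "a + 1" "comp c (a + 1)"] code_at_Cons[of P "a + 1 + csize c"] by auto
  have "(step_tm (machine P K) ^^ 1) (a, tapes K x s) = (a + 1, tapes K x s)"
    using big_While_go.hyps big_While_go.prems
    by (simp add: step_machine[OF P(1)] P(2) act_keep read_tapes_nth)
  moreover have "(step_tm (machine P K) ^^ t) (a + 1, tapes K x s) = (a + 1 + csize c, tapes K x s')"
    using big_While_go.prems c by (intro big_While_go.IH) auto
  moreover have "(step_tm (machine P K) ^^ 1) (a + 1 + csize c, tapes K x s') = (a, tapes K x s')"
    using step_machine[OF Q(1)] by (simp add: Q(2)[simplified] act_keep)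
  moreover have "(step_tm (machine P K) ^^ t') (a, tapes K x s') = (a + csize (While r v c), tapes K x s'')"
    using big_While_go.prems by (intro big_While_go.IH)
  ultimately show ?case by (intro funpow_trans)
next
  case (big_If_true s r v c t s' d)
  then have P: "a < length P" "P ! a = (\<lambda>ss. (if ss ! r = v then a + 1 else a + csize c + 2, keep ss))"
    and "code_at P (a + 1) (comp c (a + 1) @
       (\<lambda>ss. (a + csize c + csize d + 2, keep ss)) # comp d (a + csize c + 2))"
    by (auto dest!: code_at_Cons)
  then have c: "code_at P (a + 1) (comp c (a + 1))" and Q: "a + 1 + csize c < length P"
    "P ! (a + 1 + csize c) = (\<lambda>ss. (a + csize c + csize d + 2, keep ss))"
    using code_at_append[of P "a + 1" "comp c (a + 1)"] code_at_Cons[of P "a + 1 + csize c"] by auto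
  have "(step_tm (machine P K) ^^ 1) (a, tapes K x s) = (a + 1, tapes K x s)"
    using big_If_true.hyps big_If_true.prems
    by (simp add: step_machine[OF P(1)] P(2) act_keep read_tapes_nth)
  moreover have "(step_tm (machine P K) ^^ t) (a + 1, tapes K x s) = (a + 1 + csize c, tapes K x s')"
    using big_If_true.prems c by (intro big_If_true.IH) auto
  moreover have "(step_tm (machine P K) ^^ 1) (a + 1 + csize c, tapes K x s') =
      (a + csize (If r v c d), tapes K x s')"
    using step_machine[OF Q(1)] by (simp add: Q(2)[simplified] act_keep)
  ultimately show ?case by (intro funpow_trans)
next
  case (big_If_false s r v d t s' c)
  then have P: "a < length P" "P ! a = (\<lambda>ss. (if ss ! r = v then a + 1 else a + csize c + 2, keep ss))"
    and "code_at P (a + 1) (comp c (a + 1) @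
       (\<lambda>ss. (a + csize c + csize d + 2, keep ss)) # comp d (a + csize c + 2))"
    by (auto dest!: code_at_Cons)
  then have c: "code_at P (a + csize c + 2) (comp d (a + csize c + 2))"
    using code_at_append[of P "a + 1" "comp c (a + 1)"] code_at_Cons[of P "a + 1 + csize c"] by auto
  have "(step_tm (machine P K) ^^ 1) (a, tapes K x s) = (a + csize c + 2, tapes K x s)"
    using big_If_false.hyps big_If_false.prems
    by (simp add: step_machine[OF P(1)] P(2) act_keep read_tapes_nth)
  moreover have "(step_tm (machine P K) ^^ t) (a + csize c + 2, tapes K x s) = (a + csize c + 2 + csize d, tapes K x s')"
    using big_If_false.prems c by (intro big_If_false.IH) auto
  ultimately have "(step_tm (machine P K) ^^ (1 + t)) (a, tapes K x s) = (a + csize c + 2 + csize d, tapes K x s')"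
    by (rule funpow_trans)
  then show ?case by (simp add: algebra_simps)
qed auto

text \<open>All tapes but the input start out blank. This first step writes the symbol 1 to cell 0
  of every counter tape, which is why the program proper is compiled to address 1.\<close>

definition mark_zero :: "nat \<Rightarrow> instr" where
  "mark_zero K ss = (1, (ss ! 0, Stay) # replicate K (1, Stay) @ [(0, Stay)])"

lemma wf_machine:
  assumes "uses_upto K c"
  shows "wf_tm (machine (mark_zero K # comp c 1) K)"
proof -
  define P where "P = mark_zero K # comp c 1"
  have len: "length P = csize c + 1" by (simp add: P_def)
  have "valid_instr (length P) (K + 2) (P ! q)" if "q < length P" for q
  proof (cases q)
    case 0
    then show ?thesis by (auto simp: P_def valid_instr_def mark_zero_def nth_mem)
  next
    case (Suc q')
    then have "P ! q \<in> set (comp c 1)" using that by (auto simp: P_def)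
    from valid_comp[OF assms this] show ?thesis by (simp add: len)
  qed
  then have "fst (tm_delta (machine P K) q ss) < length P + 2 \<and>
      length (snd (tm_delta (machine P K) q ss)) = K + 2 \<and>
      (\<forall>(s, m) \<in> set (snd (tm_delta (machine P K) q ss)). s < 3)"
    if "length ss = K + 2" "\<forall>s \<in> set ss. s < 3" for q ss
    using valid_instrD[of "length P" "K + 2" "P ! q" ss] that
    by (cases "q < length P") (auto simp: machine_def keep_def)
  then show ?thesis
    unfolding P_def[symmetric] wf_tm_def by (simp; blast)
qed

lemma funpow_step_halted: "halted M c \<Longrightarrow> (step_tm M ^^ t) c = c"
  by (induction t) (auto simp: step_tm_def)

text \<open>The halting configuration is a fixed point, so the run can be padded to the exact
  polynomial length; the added 1 pays for the marking step.\<close>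

lemma polytime_computable_cmd:
  fixes p :: "nat poly"
  assumes "\<And>x. \<exists>t h. t \<le> poly p (length x) \<and> big x c (\<lambda>_. 0, []) t (h, f x)"
  shows "polytime_computable f"
proof -
  obtain K where K: "uses_upto K c" using ex_uses_upto by blast
  define P where "P = mark_zero K # comp c 1"
  define M where "M = machine P K"
  have "outputs_within M [x] (f x) (poly (p + 1) (length x))" for x
  proof -
    obtain t h where t: "t \<le> poly p (length x)" "big x c (\<lambda>_. 0, []) t (h, f x)"
      using assms by blast
    have "step_tm M (init_config M [x]) = (1, tapes K x (\<lambda>_. 0, []))"
    proof -
      define tps where "tps = snd (init_config M [x])"
      have len: "length tps = K + 2" by (simp add: tps_def init_config_def M_def machine_def)
      have tps: "tps ! r = (0, word_cells (if r = 0 then x else []))" if "r < K + 2" for r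
        using that by (auto simp: tps_def init_config_def M_def machine_def simp del: upt_Suc)
      have "init_config M [x] = (0, tps)" by (simp add: tps_def init_config_def M_def machine_def)
      moreover have "step_tm M (0, tps) = (1, map2 act_tape ((x_0, Stay) # replicate K (1, Stay) @ [(0, Stay)]) tps)"
        if "x_0 = read_tape (tps ! 0)" for x_0
        unfolding M_def using that len by (intro step_machine) (auto simp: P_def mark_zero_def)
      moreover have "map2 act_tape ((read_tape (tps ! 0), Stay) # replicate K (1, Stay) @ [(0, Stay)]) tps =
        tapes K x (\<lambda>_. 0, [])" (is "?l = ?r")
      proof (rule nth_equalityI)
        fix r assume "r < length ?l"
        then have r: "r < K + 2" by (simp add: len)
        then consider "r = 0" | "0 < r" "r \<le> K" | "r = K + 1" by linarith
        then show "?l ! r = ?r ! r"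
        proof cases
          case 1
          then show ?thesis using r tps[of 0] len by (simp add: tapes_nth tape_word_def)
        next
          case 2
          then have "((read_tape (tps ! 0), Stay) # replicate K (1, Stay) @ [(0, Stay)]) ! r = (1, Stay)"
            by (cases r) (auto simp: nth_append)
          moreover have "(word_cells [])(0 := 1) = word_cells [False]" by (auto simp: word_cells_def)
          ultimately show ?thesis using 2 tps[of r] len by (simp add: tapes_nth tape_word_def)
        next
          case 3
          then have "((read_tape (tps ! 0), Stay) # replicate K (1, Stay) @ [(0, Stay)]) ! r = (0, Stay)"
            by (auto simp: nth_append)
          moreover have "(word_cells [])(0 := 0) = word_cells []" by (auto simp: word_cells_def)
          ultimately show ?thesis using 3 tps[of r] len by (simp add: tapes_nth_last[simplified])
        qed
      qed (simp add: len)
      ultimately show ?thesis by simp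
    qed
    then have "(step_tm M ^^ 1) (init_config M [x]) = (1, tapes K x (\<lambda>_. 0, []))" by simp
    moreover have "(step_tm M ^^ t) (1, tapes K x (\<lambda>_. 0, [])) = (1 + csize c, tapes K x (h, f x))"
      unfolding M_def
    proof (rule exec_comp[OF t(2) K])
      show "code_at P 1 (comp c 1)"
        unfolding code_at_def P_def by (rule exI[of _ "[mark_zero K]"]) auto
    qed
    ultimately have run: "(step_tm M ^^ (1 + t)) (init_config M [x]) = (1 + csize c, tapes K x (h, f x))"
      by (rule funpow_trans)
    have hal: "halted M (1 + csize c, tapes K x (h, f x))"
      by (simp add: halted_def M_def P_def)
    have "(step_tm M ^^ ((1 + t) + (poly p (length x) - t))) (init_config M [x]) =
        (1 + csize c, tapes K x (h, f x))"
      by (rule funpow_trans[OF run funpow_step_halted[OF hal]])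
    then have "run_tm M [x] (poly (p + 1) (length x)) = (1 + csize c, tapes K x (h, f x))"
      using t(1) by (simp add: run_tm_def)
    then show ?thesis using hal by (simp add: outputs_within_def halts_within_def tapes_def)
  qed
  moreover have "wf_tm M" unfolding M_def P_def by (rule wf_machine[OF K])
  ultimately show ?thesis unfolding polytime_computable_def by blast
qed

section \<open>Solutions of the verifier net\<close>

lemma shift_empty [simp]: "shift i {} = {}"
  by (simp add: shift_def)

text \<open>The bound on the symbols in \<open>cK_less\<close> is not strict, as the marker used
  while guessing needs a token kind too.\<close>

locale sim = net KK SS "2 * Z + 1" T trans
  for KK SS Z T :: nat and trans +
  fixes V :: tm and x :: "bool list" and m :: nat
  assumes wf: "wf_tm V" and two_tapes: "2 \<le> tm_tapes V" and set_trans: "set trans = TR V"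
    and hK_less: "j < tm_tapes V \<Longrightarrow> hK j < KK"
    and cK_less: "j < tm_tapes V \<Longrightarrow> a \<le> tm_symbols V \<Longrightarrow> cK j a < KK"
begin

definition below :: "(nat \<times> nat \<Rightarrow> int) \<Rightarrow> tape list \<Rightarrow> bool" where
  "below n tps \<longleftrightarrow> (\<forall>y. n y \<le> of_bool (y \<in> tok Z tps))"

text \<open>While a step is in progress \<open>ss\<close> is only a guess, known to be right on the
  tapes already handled, and the actions applied are those for the guessed \<open>ss\<close>. In the
  guessing phase the head position and the length of \<open>w\<close> together keep the certificate
  within \<open>m\<close> bits.\<close>

definition Inv :: "nat \<Rightarrow> (nat \<times> nat \<Rightarrow> int) \<Rightarrow> bool" where
  "Inv \<sigma> n \<longleftrightarrow>
     (\<exists>b p w. \<sigma> = gs b \<and> -1 \<le> p \<and> p + 1 + int (length w) \<le> int m \<and> (\<not> b \<longrightarrow> w = []) \<and> below n (gtapes V x p w)) \<or>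
     (\<exists>u t q tps. \<sigma> = wt q \<and> length u \<le> m \<and> run_tm V [x, u] t = (q, tps) \<and> below n tps) \<or>
     (\<exists>u t q tps j ss. \<sigma> = ac j q ss \<and> length u \<le> m \<and> run_tm V [x, u] t = (q, tps) \<and>
        (\<forall>l<j. ss ! l = read_tape (tps ! l)) \<and> below n (acted (snd (tm_delta V q ss)) j tps))"

lemma Inv_gs: "-1 \<le> p \<Longrightarrow> p + 1 + int (length w) \<le> int m \<Longrightarrow> (\<not> b \<longrightarrow> w = []) \<Longrightarrow> below n (gtapes V x p w) \<Longrightarrow> Inv (gs b) n"
  unfolding Inv_def by blast

lemma Inv_wt: "length u \<le> m \<Longrightarrow> run_tm V [x, u] t = (q, tps) \<Longrightarrow> below n tps \<Longrightarrow> Inv (wt q) n"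
  unfolding Inv_def by blast

lemma Inv_ac: "length u \<le> m \<Longrightarrow> run_tm V [x, u] t = (q, tps) \<Longrightarrow> \<forall>l<j. ss ! l = read_tape (tps ! l) \<Longrightarrow>
    below n (acted (snd (tm_delta V q ss)) j tps) \<Longrightarrow> Inv (ac j q ss) n"
  unfolding Inv_def by blast

lemma Inv_gsE:
  assumes "Inv (gs b) n"
  obtains p w where "-1 \<le> p" "p + 1 + int (length w) \<le> int m" "\<not> b \<longrightarrow> w = []" "below n (gtapes V x p w)"
  using assms unfolding Inv_def by auto

lemma Inv_wtE:
  assumes "Inv (wt q) n"
  obtains u t tps where "length u \<le> m" "run_tm V [x, u] t = (q, tps)" "below n tps"
  using assms unfolding Inv_def by auto

lemma Inv_acE:
  assumes "Inv (ac j q ss) n"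
  obtains u t tps where "length u \<le> m" "run_tm V [x, u] t = (q, tps)" "\<forall>l<j. ss ! l = read_tape (tps ! l)"
    "below n (acted (snd (tm_delta V q ss)) j tps)"
  using assms unfolding Inv_def by auto

lemma below_mono: "below n tps \<Longrightarrow> \<forall>y. n' y \<le> n y \<Longrightarrow> below n' tps"
  unfolding below_def using order_trans by blast

lemma below_tok:
  assumes "below n tps" "j < length tps" "\<forall>y. of_bool (y \<in> shift i (rdA j a)) \<le> n y"
    "\<forall>y. n' y \<le> n y - of_bool (y \<in> shift i (rdA j a)) + of_bool (y \<in> shift i (rdB j act))"
  shows "a = read_tape (tps ! j)" "below n' (tps[j := act_tape act (tps ! j)])"
  using tok_sound[OF assms(2) assms(1)[unfolded below_def] assms(3,4)] unfolding below_def by blast+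

lemma length_run: "run_tm V ws t = (q, tps) \<Longrightarrow> length tps = tm_tapes V"
  using good_run[OF wf, of t ws] by (simp add: good_def)

lemma symbols_ge: "3 \<le> tm_symbols V"
  using wf by (simp add: wf_tm_def)

lemma read_gtapes: "read_tape (gtapes V x p w ! 1) = (if p = -1 then tm_symbols V else 0)"
  using two_tapes by (simp add: gtapes_nth gword_def)

text \<open>Acting on a tape verifies the guessed symbol there by \<open>below_tok\<close>. Once all
  tapes have been handled, \<open>ss\<close> is what the heads really read, so the closing
  transition completes a real step of \<open>V\<close>.\<close>

lemma Inv_step:
  assumes "Inv \<sigma> n" "(\<sigma>, A, \<sigma>', B) \<in> set trans" "\<forall>y. of_bool (y \<in> shift i A) \<le> n y"
    "\<forall>y. n' y \<le> n y - of_bool (y \<in> shift i A) + of_bool (y \<in> shift i B)"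
  shows "Inv \<sigma>' n'"
  using assms(2)[unfolded set_trans]
proof (cases rule: TR.cases)
  case (TR_start q ss)
  from assms(1)[unfolded TR_start(1)] obtain u t tps where *: "length u \<le> m" "run_tm V [x, u] t = (q, tps)" "below n tps"
    by (rule Inv_wtE)
  have "below n' tps" by (rule below_mono[OF *(3)]) (use assms(4)[unfolded TR_start(2,4)] in simp)
  then show ?thesis unfolding TR_start(3) using *(1,2) by (intro Inv_ac) (simp_all add: acted_0)
next
  case (TR_act q ss j)
  from assms(1)[unfolded TR_act(1)] obtain u t tps where *: "length u \<le> m" "run_tm V [x, u] t = (q, tps)"
    "\<forall>l<j. ss ! l = read_tape (tps ! l)" "below n (acted (snd (tm_delta V q ss)) j tps)"
    by (rule Inv_acE)
  have j: "j < length tps" using TR_act(7) length_run[OF *(2)] by simp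
  note tk = below_tok[OF *(4) _ assms(3)[unfolded TR_act(2)] assms(4)[unfolded TR_act(2,4)], simplified, OF j]
  have "ss ! j = read_tape (tps ! j)" using tk(1) j by (simp add: acted_nth)
  then have "\<forall>l<Suc j. ss ! l = read_tape (tps ! l)" using *(3) by (simp add: less_Suc_eq)
  moreover have "below n' (acted (snd (tm_delta V q ss)) (Suc j) tps)" using tk(2) by (simp add: acted_Suc[OF j])
  ultimately show ?thesis unfolding TR_act(3) using *(1,2) by (intro Inv_ac)
next
  case (TR_end q ss)
  from assms(1)[unfolded TR_end(1)] obtain u t tps where *: "length u \<le> m" "run_tm V [x, u] t = (q, tps)"
    "\<forall>l<tm_tapes V. ss ! l = read_tape (tps ! l)" "below n (acted (snd (tm_delta V q ss)) (tm_tapes V) tps)"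
    by (rule Inv_acE)
  have len: "length tps = tm_tapes V" using length_run[OF *(2)] .
  have "map read_tape tps = ss"
    using *(3) TR_end(6) len by (intro nth_equalityI) (simp_all add: words_def)
  moreover have "\<not> halted V (q, tps)" using TR_end(5) by (simp add: halted_def live_def)
  ultimately have "run_tm V [x, u] (Suc t) = (fst (tm_delta V q ss), map2 act_tape (snd (tm_delta V q ss)) tps)"
    unfolding run_Suc *(2) by (simp add: step_not_halted)
  moreover have "map2 act_tape (snd (tm_delta V q ss)) tps = acted (snd (tm_delta V q ss)) (tm_tapes V) tps"
    using acted_all[of "snd (tm_delta V q ss)" tps] wf_tmD(2)[OF wf _ TR_end(6)] TR_end(5) len by (simp add: live_def)
  moreover have "below n' (acted (snd (tm_delta V q ss)) (tm_tapes V) tps)"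
    by (rule below_mono[OF *(4)]) (use assms(4)[unfolded TR_end(2,4)] in simp)
  ultimately show ?thesis unfolding TR_end(3) using *(1) by (intro Inv_wt[of u "Suc t"]) simp_all
next
  case TR_acc
  from assms(1)[unfolded TR_acc(1)] obtain u t tps where *: "length u \<le> m" "run_tm V [x, u] t = (tm_accept V, tps)" "below n tps"
    by (rule Inv_wtE)
  have "below n' tps" by (rule below_mono[OF *(3)]) (use assms(4)[unfolded TR_acc(2,4)] in simp)
  then show ?thesis unfolding TR_acc(3) using *(1,2) by (intro Inv_wt)
next
  case TR_blank
  from assms(1)[unfolded TR_blank(1)] obtain p w where *: "-1 \<le> p" "p + 1 + int (length w) \<le> int m"
    "\<not> False \<longrightarrow> w = []" "below n (gtapes V x p w)"
    by (rule Inv_gsE)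
  have one: "1 < length (gtapes V x p w)" using two_tapes by simp
  note tk = below_tok[OF *(4) one assms(3)[unfolded TR_blank(2)] assms(4)[unfolded TR_blank(2,4)]]
  \<comment> \<open>Cell -1 carries the marker, which differs from the blank, so a head that reads 0
    has not arrived there yet.\<close>
  have p: "0 \<le> p" using tk(1) *(1) symbols_ge unfolding read_gtapes by (simp split: if_splits)
  have "below n' (gtapes V x (p - 1) [])"
    using tk(2) gtapes_blank[of V p x] p two_tapes *(3) by simp
  then show ?thesis unfolding TR_blank(3) using *(2,3) p by (intro Inv_gs[of "p - 1" "[]"]) simp_all
next
  case (TR_bit b c)
  from assms(1)[unfolded TR_bit(1)] obtain p w where *: "-1 \<le> p" "p + 1 + int (length w) \<le> int m"
    "\<not> b \<longrightarrow> w = []" "below n (gtapes V x p w)"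
    by (rule Inv_gsE)
  have one: "1 < length (gtapes V x p w)" using two_tapes by simp
  note tk = below_tok[OF *(4) one assms(3)[unfolded TR_bit(2)] assms(4)[unfolded TR_bit(2,4)]]
  have p: "0 \<le> p" using tk(1) *(1) symbols_ge unfolding read_gtapes by (simp split: if_splits)
  have "below n' (gtapes V x (p - 1) (c # w))"
    using tk(2) gtapes_bit[of V p x w c] p two_tapes by simp
  then show ?thesis unfolding TR_bit(3) using *(2) p by (intro Inv_gs[of "p - 1" "c # w"]) simp_all
next
  case (TR_guess_end b)
  from assms(1)[unfolded TR_guess_end(1)] obtain p w where *: "-1 \<le> p" "p + 1 + int (length w) \<le> int m"
    "\<not> b \<longrightarrow> w = []" "below n (gtapes V x p w)"
    by (rule Inv_gsE)
  have one: "1 < length (gtapes V x p w)" using two_tapes by simp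
  note tk = below_tok[OF *(4) one assms(3)[unfolded TR_guess_end(2)] assms(4)[unfolded TR_guess_end(2,4)]]
  have p: "p = -1" using tk(1) symbols_ge unfolding read_gtapes by (simp split: if_splits)
  have "below n' (snd (init_config V [x, w]))"
    using tk(2) gtapes_end[of V x w] p two_tapes by simp
  then show ?thesis unfolding TR_guess_end(3) using *(2) p
    by (intro Inv_wt[of w 0 _ "snd (init_config V [x, w])"]) (simp_all add: run_tm_def init_config_def)
qed

text \<open>Only the cells of the window have tokens; the runs considered are too short to visit any
  other cell.\<close>

definition W :: "tape list \<Rightarrow> (nat \<times> nat) set" where
  "W tps = tok Z tps \<inter> ({1..2 * Z + 1} \<times> UNIV)"

definition okt :: "tape list \<Rightarrow> bool" where
  "okt tps \<longleftrightarrow> length tps = tm_tapes V \<and> (\<forall>l < tm_tapes V. \<forall>i. snd (tps ! l) i \<le> tm_symbols V)"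

lemma W_subset: "okt tps \<Longrightarrow> W tps \<subseteq> {1..2 * Z + 1} \<times> {..<KK}"
  using hK_less cK_less by (auto simp: W_def okt_def tok_def)

lemma fire_null:
  assumes "(\<sigma>, {}, \<sigma>', {}) \<in> TR V" "okt tps"
  shows "fire (\<sigma>, W tps) (\<sigma>', W tps)"
  unfolding fire_def set_trans
  by (rule exI[of _ "{}"], rule exI[of _ "{}"], rule exI[of _ 0], rule exI[of _ "W tps"])
    (use assms W_subset in simp)

lemma fire_discard:
  assumes "(\<sigma>, {}, \<sigma>', {}) \<in> TR V" "okt tps"
  shows "fire (\<sigma>, W tps) (\<sigma>', {})"
  unfolding fire_def set_trans
  by (rule exI[of _ "{}"], rule exI[of _ "{}"], rule exI[of _ 0], rule exI[of _ "{}"])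
    (use assms W_subset in simp)

text \<open>The bounds on the head before and after the action keep its token at positions 1 to
  \<open>2 * Z + 1\<close>, where it can be passed on.\<close>

lemma fire_act:
  assumes tr: "(\<sigma>, rdA j (read_tape (tps ! j)), \<sigma>', rdB j act) \<in> TR V" and ok: "okt tps" and j: "j < tm_tapes V"
    and pos: "\<bar>fst (tps ! j)\<bar> \<le> int Z" "\<bar>fst (act_tape act (tps ! j))\<bar> \<le> int Z"
  shows "fire (\<sigma>, W tps) (\<sigma>', W (tps[j := act_tape act (tps ! j)]))"
proof -
  define i where "i = nat (fst (tps ! j) + int Z)"
  have i: "fst (tps ! j) = int i - int Z" "i < 2 * Z + 1" using pos(1) by (auto simp: i_def)
  have len: "j < length tps" using ok j by (simp add: okt_def)
  have rd: "read_tape (tps ! j) = snd (tps ! j) (int i - int Z)" by (simp add: read_tape_eq i(1))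
  let ?A = "shift i (rdA j (read_tape (tps ! j)))" and ?B = "shift i (rdB j act)"
  note up = tok_update[OF len i(1) rd]
  have "fst (act_tape act (tps ! j)) = int (i + dm (snd act)) - int Z - 1" by (simp add: act_tape_eq i(1))
  then have "1 \<le> i + dm (snd act)" "i + dm (snd act) \<le> 2 * Z + 1" using pos(2) by auto
  then have B: "?B \<subseteq> {1..2 * Z + 1} \<times> UNIV" using i(2) by (simp add: shift_rdB)
  have A: "?A \<subseteq> {1..2 * Z + 1} \<times> UNIV" using i(2) by (simp add: shift_rdA)
  have "?A \<subseteq> W tps" using A up(1) by (simp add: W_def)
  moreover have "W tps - ?A \<subseteq> {1..2 * Z + 1} \<times> {..<KK}" using W_subset[OF ok] by blast
  moreover have "(W tps - ?A) \<inter> ?B = {}" using up(3)[of act] unfolding W_def by blast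
  moreover have "W (tps[j := act_tape act (tps ! j)]) = (W tps - ?A) \<union> ?B"
    using B unfolding W_def up(2) by blast
  ultimately show ?thesis
    unfolding fire_def set_trans fst_conv snd_conv
    using tr i(2)
    by (intro exI[of _ "rdA j (read_tape (tps ! j))"] exI[of _ "rdB j act"] exI[of _ i]
        exI[of _ "W tps - ?A"] conjI) (simp_all only: order_refl)
qed

lemma okt_good: "good V t (q, tps) \<Longrightarrow> okt tps"
  by (auto simp: good_def okt_def less_imp_le)

lemma okt_acted:
  assumes "okt tps" "length acts = tm_tapes V" "\<forall>l < tm_tapes V. fst (acts ! l) < tm_symbols V"
  shows "okt (acted acts j tps)"
  using assms by (auto simp: okt_def acted_nth act_tape_eq less_imp_le)

lemma abs_act_tape: "\<bar>fst (act_tape act tp)\<bar> \<le> \<bar>fst tp\<bar> + 1"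
  by (cases "snd act") (auto simp: act_tape_eq)

text \<open>One round guesses the symbols read, one round acts on each tape, and one round switches
  the state.\<close>

lemma fire_step:
  assumes q: "q \<in> live V" and good: "good V t (q, tps)" and t: "t < Z" and step: "step_tm V (q, tps) = (q', tps')"
  shows "(fire ^^ (tm_tapes V + 2)) (wt q, W tps) (wt q', W tps')"
proof -
  define ss where "ss = map read_tape tps"
  define acts where "acts = snd (tm_delta V q ss)"
  have ss: "ss \<in> words V" using read_in_words[OF good] by (simp add: ss_def)
  have qs: "q < tm_states V" using q by (simp add: live_def)
  note d = wf_tmD[OF wf qs ss, folded acts_def]
  have ok: "okt tps" using okt_good[OF good] .
  have len: "length tps = tm_tapes V" using ok by (simp add: okt_def)
  have oka: "okt (acted acts j tps)" for j using ok d by (intro okt_acted) simp_all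
  have start: "fire (wt q, W tps) (ac 0 q ss, W tps)"
    using TR_start[OF q ss] ok by (rule fire_null)
  have mid: "(fire ^^ j) (ac 0 q ss, W tps) (ac j q ss, W (acted acts j tps))" if "j \<le> tm_tapes V" for j
    using that
  proof (induction j)
    case 0
    then show ?case by (simp add: acted_0)
  next
    case (Suc j)
    then have j: "j < length tps" using len by simp
    have eq: "acted acts j tps ! j = tps ! j" using j by (simp add: acted_nth)
    have rd: "ss ! j = read_tape (acted acts j tps ! j)" using j by (simp add: ss_def eq)
    have pos: "\<bar>fst (tps ! j)\<bar> \<le> int t" using good j len by (simp add: good_def)
    have "fire (ac j q ss, W (acted acts j tps)) (ac (Suc j) q ss, W ((acted acts j tps)[j := act_tape (acts ! j) (acted acts j tps ! j)]))"
    proof (rule fire_act)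
      show "(ac j q ss, rdA j (read_tape (acted acts j tps ! j)), ac (Suc j) q ss, rdB j (acts ! j)) \<in> TR V"
        using TR_act[OF q ss, of j] j len unfolding rd acts_def by simp
      show "\<bar>fst (acted acts j tps ! j)\<bar> \<le> int Z" using pos t by (simp add: eq)
      show "\<bar>fst (act_tape (acts ! j) (acted acts j tps ! j))\<bar> \<le> int Z"
        using abs_act_tape[of "acts ! j" "tps ! j"] pos t by (simp add: eq)
    qed (use oka j len in simp_all)
    then show ?case using Suc acted_Suc[OF j, of acts] by (auto intro: relpowp_Suc_I)
  qed
  have fin: "fire (ac (tm_tapes V) q ss, W (acted acts (tm_tapes V) tps)) (wt (fst (tm_delta V q ss)), W (acted acts (tm_tapes V) tps))"
    using TR_end[OF q ss] oka by (rule fire_null)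
  have "\<not> halted V (q, tps)" using q by (simp add: halted_def live_def)
  then have st: "q' = fst (tm_delta V q ss)" "tps' = acted acts (tm_tapes V) tps"
    using step acted_all[of acts tps] len d(2) by (simp_all add: step_not_halted ss_def acts_def)
  have "(fire ^^ Suc (tm_tapes V)) (wt q, W tps) (ac (tm_tapes V) q ss, W (acted acts (tm_tapes V) tps))"
    using start mid[OF order_refl] by (rule relpowp_Suc_I2)
  then have "(fire ^^ Suc (Suc (tm_tapes V))) (wt q, W tps) (wt q', W tps')"
    unfolding st using fin by (rule relpowp_Suc_I)
  then show ?thesis by simp
qed

lemma fire_run:
  assumes "\<And>s. s < t \<Longrightarrow> fst (run_tm V ws s) \<in> live V" "t \<le> Z"
  shows "(fire ^^ (t * (tm_tapes V + 2))) (wt (fst (run_tm V ws 0)), W (snd (run_tm V ws 0)))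
    (wt (fst (run_tm V ws t)), W (snd (run_tm V ws t)))"
  using assms
proof (induction t)
  case 0
  then show ?case by simp
next
  case (Suc t)
  have step: "(fire ^^ (tm_tapes V + 2)) (wt (fst (run_tm V ws t)), W (snd (run_tm V ws t)))
    (wt (fst (run_tm V ws (Suc t))), W (snd (run_tm V ws (Suc t))))"
    using Suc.prems good_run[OF wf, of t ws]
    by (intro fire_step[of _ t]) (simp_all add: run_Suc)
  have "(fire ^^ (t * (tm_tapes V + 2))) (wt (fst (run_tm V ws 0)), W (snd (run_tm V ws 0)))
    (wt (fst (run_tm V ws t)), W (snd (run_tm V ws t)))"
    using Suc by simp
  from relpowp_trans[OF this step] show ?case by (simp only: mult_Suc add.commute)
qed

lemma okt_gtapes: "okt (gtapes V x p w)"
  using symbols_ge by (auto simp: okt_def gtapes_nth gword_def word_cells_def)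

text \<open>After \<open>j\<close> rounds the cells from \<open>m - j\<close> on have been dealt
  with, and they hold the corresponding suffix of \<open>u\<close>. As long as this suffix is empty,
  blanks are written.\<close>

lemma fire_guess:
  assumes "length u \<le> m" "m \<le> Z" "j \<le> m"
  shows "(fire ^^ j) (gs False, W (gtapes V x (int m - 1) []))
    (gs (drop (m - j) u \<noteq> []), W (gtapes V x (int (m - j) - 1) (drop (m - j) u)))"
  using assms(3)
proof (induction j)
  case 0
  then show ?case using assms(1) by simp
next
  case (Suc j)
  define p where "p = m - Suc j"
  have mj: "m - j = Suc p" and ip: "int (m - j) - 1 = int p" using Suc.prems by (auto simp: p_def)
  have IH: "(fire ^^ j) (gs False, W (gtapes V x (int m - 1) [])) (gs (drop (Suc p) u \<noteq> []), W (gtapes V x (int p) (drop (Suc p) u)))"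
    using Suc by (simp add: mj ip)
  let ?g = "gtapes V x (int p) (drop (Suc p) u)"
  have one: "1 < tm_tapes V" using two_tapes by simp
  have rd: "read_tape (?g ! 1) = 0" using read_gtapes by simp
  have fst: "fst (?g ! 1) = int p" using one by (simp add: gtapes_nth)
  have pos: "\<bar>fst (?g ! 1)\<bar> \<le> int Z" "\<bar>fst (act_tape (a, Go_Left) (?g ! 1))\<bar> \<le> int Z" for a
    using assms(2) Suc.prems unfolding act_tape_eq fst by (auto simp: p_def)
  have "fire (gs (drop (Suc p) u \<noteq> []), W ?g) (gs (drop p u \<noteq> []), W (gtapes V x (int p - 1) (drop p u)))"
  proof (cases "p < length u")
    case True
    then have dr: "drop p u = u ! p # drop (Suc p) u" by (rule Cons_nth_drop_Suc[symmetric])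
    have "(gs (drop (Suc p) u \<noteq> []), rdA 1 (read_tape (?g ! 1)), gs True, rdB 1 (if u ! p then 2 else 1, Go_Left)) \<in> TR V"
      unfolding rd by (rule TR_bit)
    from fire_act[OF this okt_gtapes one pos] show ?thesis
      using gtapes_bit[OF one, of "int p" x "drop (Suc p) u" "u ! p"] by (simp add: dr)
  next
    case False
    then have dr: "drop p u = []" "drop (Suc p) u = []" by simp_all
    have "(gs False, rdA 1 (read_tape (?g ! 1)), gs False, rdB 1 (0, Go_Left)) \<in> TR V"
      unfolding rd by (rule TR_blank)
    from fire_act[OF this okt_gtapes one pos] show ?thesis
      using gtapes_blank[OF one, of "int p" x] by (simp add: dr)
  qed
  with IH have "(fire ^^ Suc j) (gs False, W (gtapes V x (int m - 1) [])) (gs (drop p u \<noteq> []), W (gtapes V x (int p - 1) (drop p u)))"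
    by (rule relpowp_Suc_I)
  then show ?case by (simp only: p_def)
qed

lemma fire_init:
  assumes "length u \<le> m" "m \<le> Z" "0 < Z"
  shows "(fire ^^ Suc m) (gs False, W (gtapes V x (int m - 1) [])) (wt (fst (run_tm V [x, u] 0)), W (snd (run_tm V [x, u] 0)))"
proof -
  have one: "1 < tm_tapes V" using two_tapes by simp
  have "(fire ^^ m) (gs False, W (gtapes V x (int m - 1) [])) (gs (u \<noteq> []), W (gtapes V x (-1) u))"
    using fire_guess[OF assms(1,2) order_refl] by simp
  moreover have "fire (gs (u \<noteq> []), W (gtapes V x (-1) u))
    (wt (tm_start V), W ((gtapes V x (-1) u)[1 := act_tape (0, Go_Right) (gtapes V x (-1) u ! 1)]))"
  proof (rule fire_act[OF _ okt_gtapes one])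
    show "(gs (u \<noteq> []), rdA 1 (read_tape (gtapes V x (-1) u ! 1)), wt (tm_start V), rdB 1 (0, Go_Right)) \<in> TR V"
      using TR_guess_end by (simp only: read_gtapes if_True refl)
  qed (use assms(3) one in \<open>simp_all add: gtapes_nth act_tape_eq\<close>)
  ultimately have "(fire ^^ Suc m) (gs False, W (gtapes V x (int m - 1) [])) (wt (tm_start V), W (snd (init_config V [x, u])))"
    unfolding gtapes_end[OF one] by (rule relpowp_Suc_I)
  then show ?thesis by (simp add: run_tm_def init_config_def)
qed

text \<open>Guessing takes \<open>m + 1\<close> rounds, each machine step
  \<open>tm_tapes V + 2\<close>, and the last round discards all tape tokens. Rounds left over are
  spent idling in the accepting state.\<close>

lemma fire_accept:
  assumes "length u \<le> m" "m \<le> Z" "0 < Z" "fst (run_tm V [x, u] t) = tm_accept V" "t \<le> Z"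
    "m + 2 + t * (tm_tapes V + 2) \<le> T"
  shows "(fire ^^ T) (gs False, W (gtapes V x (int m - 1) [])) (wt (tm_accept V), {})"
proof -
  define t\<^sub>0 where "t\<^sub>0 = (LEAST t. fst (run_tm V [x, u] t) = tm_accept V)"
  have t0: "fst (run_tm V [x, u] t\<^sub>0) = tm_accept V" "t\<^sub>0 \<le> t"
    using assms(4) unfolding t\<^sub>0_def by (auto intro: LeastI Least_le)
  \<comment> \<open>Before the first accepting configuration there is no rejecting one either, since
    that would be a fixed point.\<close>
  have "fst (run_tm V [x, u] s) \<in> live V" if s: "s < t\<^sub>0" for s
  proof -
    have "fst (run_tm V [x, u] s) \<noteq> tm_accept V" using s not_less_Least unfolding t\<^sub>0_def by blast
    moreover have "fst (run_tm V [x, u] s) \<noteq> tm_reject V"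
    proof
      assume rej: "fst (run_tm V [x, u] s) = tm_reject V"
      have "(step_tm V ^^ (s + (t\<^sub>0 - s))) (init_config V [x, u]) = run_tm V [x, u] s"
        by (rule funpow_trans[OF _ funpow_step_halted]) (simp_all add: run_tm_def rej[unfolded run_tm_def] halted_def)
      then have "run_tm V [x, u] t\<^sub>0 = run_tm V [x, u] s" using s by (simp add: run_tm_def)
      then show False using t0(1) rej wf by (simp add: wf_tm_def)
    qed
    moreover have "fst (run_tm V [x, u] s) < tm_states V" using good_run[OF wf] by (simp add: good_def)
    ultimately show ?thesis by (simp add: live_def)
  qed
  then have run: "(fire ^^ (t\<^sub>0 * (tm_tapes V + 2))) (wt (fst (run_tm V [x, u] 0)), W (snd (run_tm V [x, u] 0)))
    (wt (tm_accept V), W (snd (run_tm V [x, u] t\<^sub>0)))"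
    using fire_run[of t\<^sub>0 "[x, u]"] t0 assms(5) by simp
  have ok: "okt (snd (run_tm V [x, u] t\<^sub>0))"
    using okt_good[of t\<^sub>0 "fst (run_tm V [x, u] t\<^sub>0)" "snd (run_tm V [x, u] t\<^sub>0)"] good_run[OF wf] by simp
  define r where "r = T - (m + 2 + t\<^sub>0 * (tm_tapes V + 2))"
  have "t\<^sub>0 * (tm_tapes V + 2) \<le> t * (tm_tapes V + 2)" using t0(2) by (rule mult_le_mono1)
  then have T: "T = Suc m + t\<^sub>0 * (tm_tapes V + 2) + Suc r" using assms(6) by (simp add: r_def)
  have idle: "(fire ^^ j) (wt (tm_accept V), W (snd (run_tm V [x, u] t\<^sub>0))) (wt (tm_accept V), W (snd (run_tm V [x, u] t\<^sub>0)))" for j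
  proof (induction j)
    case (Suc j)
    then show ?case using fire_null[OF TR_acc ok] by (rule relpowp_Suc_I)
  qed simp
  have "(fire ^^ Suc r) (wt (tm_accept V), W (snd (run_tm V [x, u] t\<^sub>0))) (wt (tm_accept V), {})"
    using idle fire_discard[OF TR_acc ok] by (rule relpowp_Suc_I)
  then show ?thesis unfolding T
    by (intro relpowp_trans[OF relpowp_trans[OF fire_init[OF assms(1-3)] run]])
qed

theorem solution_iff:
  assumes size: "m \<le> Z" "0 < Z" "t \<le> Z" "m + 2 + t * (tm_tapes V + 2) \<le> T"
    and t: "\<And>u. length u \<le> m \<Longrightarrow> accepts V [x, u] \<Longrightarrow> fst (run_tm V [x, u] t) = tm_accept V"
    and I: "\<forall>\<sigma><SS. (\<Sum>j<nc. dg (I j) (st_row \<sigma>)) = of_bool (\<sigma> = gs False)"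
      "\<forall>b < 2 * Z + 1 + 2. \<forall>k < KK. (\<Sum>j<nc. dg (I j) (loc_row b k)) = of_bool ((b, k) \<in> W (gtapes V x (int m - 1) []))"
    and F: "\<forall>\<sigma><SS. (\<Sum>j<nc. dg (F j) (st_row \<sigma>)) = of_bool (\<sigma> = wt (tm_accept V))"
      "\<forall>b < 2 * Z + 1 + 2. \<forall>k < KK. (\<Sum>j<nc. dg (F j) (loc_row b k)) = 0"
  shows "(\<exists>E. solution nc I F E) \<longleftrightarrow> (\<exists>u. length u \<le> m \<and> accepts V [x, u])"
proof
  assume "\<exists>E. solution nc I F E"
  then obtain E where E: "solution nc I F E" by blast
  have g: "gs False < SS" and a: "wt (tm_accept V) < SS"
    using wf_trans[unfolded set_trans, OF TR_blank] wf_trans[unfolded set_trans, OF TR_acc] by auto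
  have init: "Inv (gs False) (tokens (\<lambda>s. \<Sum>j<nc. dg (I j) s))"
  proof (rule Inv_gs[of "int m - 1" "[]"])
    show "below (tokens (\<lambda>s. \<Sum>j<nc. dg (I j) s)) (gtapes V x (int m - 1) [])"
      unfolding below_def
    proof
      fix y :: "nat \<times> nat"
      show "tokens (\<lambda>s. \<Sum>j<nc. dg (I j) s) y \<le> of_bool (y \<in> tok Z (gtapes V x (int m - 1) []))"
      proof (cases "in_range y")
        case True
        then have "fst y < 2 * Z + 1 + 2" "snd y < KK" unfolding in_range_def by blast+
        then have "(\<Sum>j<nc. dg (I j) (loc_row (fst y) (snd y))) = of_bool (y \<in> W (gtapes V x (int m - 1) []))"
          using I(2)[rule_format, of "fst y" "snd y"] by (simp only: prod.collapse)
        then show ?thesis unfolding tokens_def using True by (simp add: W_def)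
      next
        case False
        then show ?thesis unfolding tokens_def by simp
      qed
    qed
  qed simp_all
  have "\<exists>n. Inv (wt (tm_accept V)) n"
  proof (rule solution_invariant[where Inv = Inv, OF E g I(1) a F(1) init])
    fix \<sigma> n A \<sigma>' B i n'
    assume "Inv \<sigma> n" "(\<sigma>, A, \<sigma>', B) \<in> set trans" "\<forall>y. of_bool (y \<in> shift i A) \<le> n y"
      "\<forall>y. n' y \<le> n y - of_bool (y \<in> shift i A) + of_bool (y \<in> shift i B)"
    then show "Inv \<sigma>' n'" by (rule Inv_step)
  qed
  then obtain n where "Inv (wt (tm_accept V)) n" by blast
  then obtain u t tps where "length u \<le> m" "run_tm V [x, u] t = (tm_accept V, tps)" by (rule Inv_wtE)
  then have "fst (run_tm V [x, u] t) = tm_accept V" by simp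
  then have "accepts V [x, u]" unfolding accepts_def by (rule exI)
  with \<open>length u \<le> m\<close> show "\<exists>u. length u \<le> m \<and> accepts V [x, u]" by blast
next
  assume "\<exists>u. length u \<le> m \<and> accepts V [x, u]"
  then obtain u where u: "length u \<le> m" "accepts V [x, u]" by blast
  have "(fire ^^ T) (gs False, W (gtapes V x (int m - 1) [])) (wt (tm_accept V), {})"
    using fire_accept[OF u(1) size(1,2) t[OF u] size(3,4)] .
  then obtain f where f: "f 0 = (gs False, W (gtapes V x (int m - 1) []))" "f T = (wt (tm_accept V), {})"
    "\<forall>i<T. fire (f i) (f (Suc i))"
    unfolding relpowp_fun_conv by blast
  show "\<exists>E. solution nc I F E"
  proof (rule solution_complete[OF f(1,2) _ I F(1)])
    show "fire (f t) (f (Suc t))" if "t < T" for t using f(3) that by blast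
    show "\<forall>b < 2 * Z + 1 + 2. \<forall>k < KK. (\<Sum>j<nc. dg (F j) (loc_row b k)) = of_bool ((b, k) \<in> {})"
      using F(2) by simp
  qed
qed

end

section \<open>Printing with nested loops\<close>

text \<open>A variable is an index into the environment, counted from the oldest binding.
  \<open>For v e\<close> runs \<open>e\<close> once for each \<open>i < N\<close>, where \<open>N\<close> is the value of \<open>v\<close>, and binds two
  variables: \<open>i\<close> and the number \<open>N - 1 - i\<close> of rounds to come.  \<open>Let e e'\<close> binds the
  length of the output of \<open>e\<close>.\<close>

datatype em = Emit bool | Nop | App em em (infixr \<open>\<oplus>\<close> 65) | For nat em | Let em em | IfX nat em em

fun den :: "bool list \<Rightarrow> em \<Rightarrow> nat list \<Rightarrow> bool list" where
  "den x (Emit b) env = [b]"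
| "den x Nop env = []"
| "den x (e \<oplus> e') env = den x e env @ den x e' env"
| "den x (For v e) env = concat (map (\<lambda>i. den x e (env @ [i, env ! v - 1 - i])) [0..<env ! v])"
| "den x (Let e e') env = den x e' (env @ [length (den x e env)])"
| "den x (IfX v e e') env = (if env ! v < length x \<and> x ! (env ! v) then den x e env else den x e' env)"

fun scoped :: "nat \<Rightarrow> em \<Rightarrow> bool" where
  "scoped k (Emit b) \<longleftrightarrow> True"
| "scoped k Nop \<longleftrightarrow> True"
| "scoped k (e \<oplus> e') \<longleftrightarrow> scoped k e \<and> scoped k e'"
| "scoped k (For v e) \<longleftrightarrow> v < k \<and> scoped (k + 2) e"
| "scoped k (Let e e') \<longleftrightarrow> scoped k e \<and> scoped (k + 1) e'"
| "scoped k (IfX v e e') \<longleftrightarrow> v < k \<and> scoped k e \<and> scoped k e'"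

text \<open>\<open>\<rho>\<close> maps variables to counters, counters from \<open>d\<close> on are free, and the output goes to
  the output tape or, counting symbols only, to a counter.\<close>

fun cm :: "em \<Rightarrow> nat list \<Rightarrow> nat \<Rightarrow> nat option \<Rightarrow> cmd" where
  "cm (Emit b) \<rho> d tgt = (case tgt of None \<Rightarrow> Out b | Some g \<Rightarrow> Inc g)"
| "cm Nop \<rho> d tgt = Skip"
| "cm (e \<oplus> e') \<rho> d tgt = cm e \<rho> d tgt ;; cm e' \<rho> d tgt"
| "cm (For v e) \<rho> d tgt =
     While (\<rho> ! v) 1 (Dec (\<rho> ! v) ;; Inc d ;; Inc (d + 1)) ;;
     While d 1 (Dec d ;; Inc (\<rho> ! v)) ;;
     While (d + 1) 1 (Dec (d + 1) ;; cm e (\<rho> @ [d, d + 1]) (d + 2) tgt ;; Inc d) ;;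
     While d 1 (Dec d)"
| "cm (Let e e') \<rho> d tgt =
     cm e \<rho> (d + 1) (Some d) ;; cm e' (\<rho> @ [d]) (d + 1) tgt ;; While d 1 (Dec d)"
| "cm (IfX v e e') \<rho> d tgt =
     While (\<rho> ! v) 1 (Dec (\<rho> ! v) ;; Inc d ;; Inc 0) ;;
     If 0 2 (While d 1 (Dec d ;; Dec 0 ;; Inc (\<rho> ! v)) ;; cm e \<rho> d tgt)
       (While d 1 (Dec d ;; Dec 0 ;; Inc (\<rho> ! v)) ;; cm e' \<rho> d tgt)"

section \<open>Correctness and running time of compiled printers\<close>

definition runs :: "bool list \<Rightarrow> cmd \<Rightarrow> mstate \<Rightarrow> nat \<Rightarrow> mstate \<Rightarrow> bool" where
  "runs x c s B s' \<longleftrightarrow> (\<exists>t \<le> B. big x c s t s')"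

lemma runs_weaken: "runs x c s B s' \<Longrightarrow> B \<le> B' \<Longrightarrow> runs x c s B' s'"
  unfolding runs_def using order_trans by blast

lemma runs_Seq: "runs x c s B s' \<Longrightarrow> runs x d s' B' s'' \<Longrightarrow> runs x (c ;; d) s (B + B') s''"
  unfolding runs_def by (meson add_mono big_Seq)

lemma runs_Skip: "runs x Skip s 0 s"
  unfolding runs_def using big_Skip by blast

lemma runs_Inc: "runs x (Inc r) (h, u) 1 (h(r := h r + 1), u)"
  unfolding runs_def using big_Inc by blast

lemma runs_Dec: "0 < h r \<Longrightarrow> runs x (Dec r) (h, u) 1 (h(r := h r - 1), u)"
  unfolding runs_def using big_Dec by blast

lemma runs_Out: "runs x (Out b) (h, u) 1 (h, u @ [b])"
  unfolding runs_def using big_Out by blast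

lemma runs_If:
  assumes "sym x (fst s) r = v \<Longrightarrow> runs x c s B s'" "sym x (fst s) r \<noteq> v \<Longrightarrow> runs x d s B s'"
  shows "runs x (If r v c d) s (B + 2) s'"
proof (cases "sym x (fst s) r = v")
  case True
  then obtain t where "t \<le> B" "big x c s t s'" using assms(1) by (auto simp: runs_def)
  then show ?thesis using big_If_true[OF True] unfolding runs_def
    by (intro exI[of _ "1 + (t + 1)"]) auto
next
  case False
  then obtain t where "t \<le> B" "big x d s t s'" using assms(2) by (auto simp: runs_def)
  then show ?thesis using big_If_false[OF False] unfolding runs_def
    by (intro exI[of _ "1 + t"]) auto
qed

lemma runs_While:
  assumes "\<And>i. i < N \<Longrightarrow> sym x (fst (S i)) r \<noteq> v" "sym x (fst (S N)) r = v"
    "\<And>i. i < N \<Longrightarrow> runs x c (S i) B (S (Suc i))"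
  shows "runs x (While r v c) (S 0) (N * (B + 2) + 1) (S N)"
proof -
  have "runs x (While r v c) (S (N - j)) (j * (B + 2) + 1) (S N)" if "j \<le> N" for j
    using that
  proof (induction j)
    case 0
    then show ?case using big_While_stop[of x "S N" r v c] assms(2) by (auto simp: runs_def)
  next
    case (Suc j)
    then have eq: "Suc (N - Suc j) = N - j" by simp
    obtain t where t: "t \<le> B" "big x c (S (N - Suc j)) t (S (N - j))"
      using assms(3)[of "N - Suc j"] Suc.prems unfolding eq runs_def by auto
    obtain t' where t': "t' \<le> j * (B + 2) + 1" "big x (While r v c) (S (N - j)) t' (S N)"
      using Suc unfolding runs_def by auto
    have "big x (While r v c) (S (N - Suc j)) (1 + (t + (1 + t'))) (S N)"
      using assms(1)[of "N - Suc j"] Suc.prems t(2) t'(2) by (intro big_While_go) auto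
    moreover have "1 + (t + (1 + t')) \<le> Suc j * (B + 2) + 1" using t(1) t'(1) by simp
    ultimately show ?case unfolding runs_def by blast
  qed
  from this[of N] show ?thesis by simp
qed

lemma sym_counter: "0 < r \<Longrightarrow> sym x h r = 1 \<longleftrightarrow> h r = 0"
  by (simp add: sym_def tape_word_def word_cells_def)

lemma runs_While_counter:
  assumes "0 < r" "\<And>i. i \<le> N \<Longrightarrow> fst (S i) r = N - i"
    "\<And>i. i < N \<Longrightarrow> runs x c (S i) B (S (Suc i))" "s = S 0" "s' = S N"
  shows "runs x (While r 1 c) s (N * (B + 2) + 1) s'"
  unfolding assms(4,5) using assms(1-3) sym_counter[OF assms(1)]
  by (intro runs_While) (auto simp del: One_nat_def)

fun upd :: "nat option \<Rightarrow> bool list \<Rightarrow> mstate \<Rightarrow> mstate" where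
  "upd None w (h, u) = (h, u @ w)"
| "upd (Some g) w (h, u) = (h(g := h g + length w), u)"

lemma upd_Nil [simp]: "upd tgt [] s = s"
  by (cases tgt; cases s) auto

lemma upd_upd: "upd tgt w' (upd tgt w s) = upd tgt (w @ w') s"
  by (cases tgt; cases s) auto

lemma upd_fun_upd:
  "tgt \<noteq> Some r \<Longrightarrow> upd tgt w (h(r := n), u) = ((fst (upd tgt w (h, u)))(r := n), snd (upd tgt w (h, u)))"
  by (cases tgt) (auto simp: fun_upd_twist)

lemma fst_upd: "tgt \<noteq> Some r \<Longrightarrow> fst (upd tgt w (h, u)) r = h r"
  by (cases tgt) auto

text \<open>Free counters are zero and head 0 is back on cell 0. The target counter is none of the
  variables, so counting output changes no binding.\<close>

definition ready :: "nat list \<Rightarrow> nat \<Rightarrow> nat option \<Rightarrow> (nat \<Rightarrow> nat) \<Rightarrow> bool" where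
  "ready \<rho> d tgt h \<longleftrightarrow> (\<forall>r \<ge> d. h r = 0) \<and> h 0 = 0 \<and> 1 \<le> d \<and> set \<rho> \<subseteq> {1..<d} \<and>
     (\<forall>g. tgt = Some g \<longrightarrow> 1 \<le> g \<and> g < d \<and> g \<notin> set \<rho>)"

lemma ready_tgt: "ready \<rho> d tgt h \<Longrightarrow> tgt \<noteq> Some 0 \<and> (\<forall>r \<ge> d. tgt \<noteq> Some r)"
  by (auto simp: ready_def)

lemma ready_upd: "ready \<rho> d tgt h \<Longrightarrow> ready \<rho> d tgt (fst (upd tgt w (h, u)))"
  by (cases tgt) (auto simp: ready_def)

lemma map_upd: "ready \<rho> d tgt h \<Longrightarrow> map (fst (upd tgt w (h, u))) \<rho> = map h \<rho>"
  by (cases tgt) (auto simp: ready_def)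

lemma poly_nat_mono: "a \<le> b \<Longrightarrow> poly p a \<le> poly (p :: nat poly) b"
  by (induction p) (auto intro!: add_mono mult_mono)

text \<open>One polynomial in a bound on the variables limits both time and output length. The
  length is included because \<open>Let\<close> turns it into the value of a variable.\<close>

definition bounded_by :: "em \<Rightarrow> nat poly \<Rightarrow> bool" where
  "bounded_by e p \<longleftrightarrow> (\<forall>x \<rho> d tgt h u M. scoped (length \<rho>) e \<longrightarrow> ready \<rho> d tgt h \<longrightarrow>
     (\<forall>r \<in> set \<rho>. h r \<le> M) \<longrightarrow> length (den x e (map h \<rho>)) \<le> poly p M \<and>
     runs x (cm e \<rho> d tgt) (h, u) (poly p M) (upd tgt (den x e (map h \<rho>)) (h, u)))"

lemma bounded_byD:
  assumes "bounded_by e p" "scoped (length \<rho>) e" "ready \<rho> d tgt h" "\<forall>r \<in> set \<rho>. h r \<le> M"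
  shows "length (den x e (map h \<rho>)) \<le> poly p M"
    "runs x (cm e \<rho> d tgt) (h, u) (poly p M) (upd tgt (den x e (map h \<rho>)) (h, u))"
  using assms unfolding bounded_by_def by blast+

lemma bounded_by_Emit: "bounded_by (Emit b) 1"
  unfolding bounded_by_def
proof (intro allI impI conjI)
  fix x \<rho> d tgt h u M
  show "runs x (cm (Emit b) \<rho> d tgt) (h, u) (poly 1 M) (upd tgt (den x (Emit b) (map h \<rho>)) (h, u))"
    using runs_Out[of x b h u] runs_Inc[of x _ h u] by (cases tgt) simp_all
qed simp

lemma bounded_by_Nop: "bounded_by Nop 1"
  unfolding bounded_by_def using runs_weaken[OF runs_Skip, of 1] by simp

lemma bounded_by_App:
  assumes "bounded_by e p" "bounded_by e' p'"
  shows "bounded_by (e \<oplus> e') (p + p')"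
  unfolding bounded_by_def
proof (intro allI impI conjI)
  fix x \<rho> d tgt h u M
  assume *: "scoped (length \<rho>) (e \<oplus> e')" "ready \<rho> d tgt h" "\<forall>r \<in> set \<rho>. h r \<le> M"
  note 1 = bounded_byD[OF assms(1) _ *(2), of M x]
  define s where "s = upd tgt (den x e (map h \<rho>)) (h, u)"
  have env: "map (fst s) \<rho> = map h \<rho>" unfolding s_def by (rule map_upd[OF *(2)])
  then have "\<forall>r \<in> set \<rho>. fst s r \<le> M" using *(3) by (metis map_eq_conv)
  moreover have "ready \<rho> d tgt (fst s)" unfolding s_def by (rule ready_upd[OF *(2)])
  ultimately have 2: "length (den x e' (map h \<rho>)) \<le> poly p' M"
    "runs x (cm e' \<rho> d tgt) s (poly p' M) (upd tgt (den x e' (map h \<rho>)) s)"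
    using bounded_byD(1)[OF assms(2), of \<rho> d tgt "fst s" M x]
      bounded_byD(2)[OF assms(2), of \<rho> d tgt "fst s" M x "snd s"] *(1) by (simp_all add: env)
  show "length (den x (e \<oplus> e') (map h \<rho>)) \<le> poly (p + p') M"
    using 1(1) 2(1) * by simp
  show "runs x (cm (e \<oplus> e') \<rho> d tgt) (h, u) (poly (p + p') M) (upd tgt (den x (e \<oplus> e') (map h \<rho>)) (h, u))"
    using runs_Seq[OF 1(2) 2(2)[unfolded s_def upd_upd]] * by simp
qed

lemma bounded_by_For:
  assumes "bounded_by e p"
  shows "bounded_by (For v e) ([:4, 16:] + [:0, 1:] * p)"
  unfolding bounded_by_def
proof (intro allI impI)
  fix x \<rho> d tgt h u M
  assume *: "scoped (length \<rho>) (For v e)" "ready \<rho> d tgt h" "\<forall>r \<in> set \<rho>. h r \<le> M"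
  define r where "r = \<rho> ! v"
  define N where "N = h r"
  have r: "r \<in> set \<rho>" using *(1) by (simp add: r_def)
  then have rd: "0 < r" "r < d" and N: "N \<le> M" and hd: "h d = 0" "h (Suc d) = 0"
    using *(2,3) by (auto simp: ready_def N_def)
  have tgt: "tgt \<noteq> Some d" "tgt \<noteq> Some (Suc d)" using ready_tgt[OF *(2)] by auto
  have dr: "d \<notin> set \<rho>" "Suc d \<notin> set \<rho>" using *(2) by (auto simp: ready_def)
  define w where "w i = den x e (map h \<rho> @ [i, N - 1 - i])" for i
  define W where "W i = concat (map w [0..<i])" for i
  have W: "den x (For v e) (map h \<rho>) = W N" using *(1) by (simp add: W_def w_def[abs_def] N_def r_def)
  \<comment> \<open>The counter \<open>Suc d\<close> is decremented before the body runs, so the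
    body sees the number of rounds still to come.\<close>
  define hi where "hi i = h(d := i, Suc d := N - 1 - i)" for i
  have hi: "ready (\<rho> @ [d, Suc d]) (d + 2) tgt (hi i)" "map (hi i) (\<rho> @ [d, Suc d]) = map h \<rho> @ [i, N - 1 - i]" for i
    using *(2) dr by (auto simp: ready_def hi_def)
  have body: "length (w i) \<le> poly p M"
    "runs x (cm e (\<rho> @ [d, Suc d]) (d + 2) tgt) (upd tgt (W i) (hi i, u)) (poly p M) (upd tgt (W (Suc i)) (hi i, u))"
    if "i < N" for i
  proof -
    define s where "s = upd tgt (W i) (hi i, u)"
    have env: "map (fst s) (\<rho> @ [d, Suc d]) = map h \<rho> @ [i, N - 1 - i]"
      unfolding s_def using map_upd[OF hi(1)] hi(2) by simp
    then have "map (fst s) \<rho> = map h \<rho>" "fst s d = i" "fst s (Suc d) = N - 1 - i" by auto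
    then have "\<forall>r \<in> set (\<rho> @ [d, Suc d]). fst s r \<le> M"
      using *(3) that N by (auto simp: map_eq_conv)
    moreover have "ready (\<rho> @ [d, Suc d]) (d + 2) tgt (fst s)"
      unfolding s_def by (rule ready_upd[OF hi(1)])
    moreover have "scoped (length (\<rho> @ [d, Suc d])) e" using *(1) by simp
    ultimately show "length (w i) \<le> poly p M"
      "runs x (cm e (\<rho> @ [d, Suc d]) (d + 2) tgt) (upd tgt (W i) (hi i, u)) (poly p M) (upd tgt (W (Suc i)) (hi i, u))"
      using bounded_byD(1)[OF assms, of "\<rho> @ [d, Suc d]" "d + 2" tgt "fst s" M x]
        bounded_byD(2)[OF assms, of "\<rho> @ [d, Suc d]" "d + 2" tgt "fst s" M x "snd s"]
      unfolding env s_def[symmetric] by (simp_all add: w_def s_def upd_upd W_def)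
  qed
  have "length (W N) \<le> N * poly p M"
  proof -
    have "length (W i) \<le> i * poly p M" if "i \<le> N" for i
      using that
    proof (induction i)
      case (Suc i)
      have "length (W (Suc i)) = length (W i) + length (w i)" by (simp add: W_def)
      then show ?case using Suc body(1)[of i] by simp
    qed (simp add: W_def)
    then show ?thesis by simp
  qed
  then have len: "length (W N) \<le> M * poly p M" using N by (meson le_trans mult_le_mono1)
  \<comment> \<open>The bound is moved to both \<open>d\<close> and \<open>Suc d\<close>: the next
    loop gives it back from \<open>d\<close>, while \<open>Suc d\<close> keeps it for counting the
    rounds.\<close>
  have loop1: "runs x (While r 1 (Dec r ;; Inc d ;; Inc (d + 1))) (h, u) (N * 5 + 1) (h(r := 0, d := N, Suc d := N), u)"
  proof -
    define S where "S i = (h(r := N - i, d := i, Suc d := i), u)" for i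
    have "runs x (Dec r ;; Inc d ;; Inc (d + 1)) (S i) 3 (S (Suc i))" if "i < N" for i
    proof -
      have "runs x (Dec r) (S i) 1 (h(r := N - Suc i, d := i, Suc d := i), u)"
        using runs_Dec[of "fst (S i)" r x u] that rd by (simp add: S_def fun_upd_twist)
      moreover have "runs x (Inc d) (h(r := N - Suc i, d := i, Suc d := i), u) 1
        (h(r := N - Suc i, d := Suc i, Suc d := i), u)"
        using runs_Inc[of x d "h(r := N - Suc i, d := i, Suc d := i)" u] by (simp add: fun_upd_twist)
      moreover have "runs x (Inc (d + 1)) (h(r := N - Suc i, d := Suc i, Suc d := i), u) 1 (S (Suc i))"
        using runs_Inc[of x "Suc d" "h(r := N - Suc i, d := Suc i, Suc d := i)" u] by (simp add: S_def)
      ultimately have "runs x (Dec r ;; Inc d ;; Inc (d + 1)) (S i) (1 + (1 + 1)) (S (Suc i))"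
        by (intro runs_Seq)
      then show ?thesis by (simp add: numeral_3_eq_3)
    qed
    from runs_While_counter[where S = S and N = N and r = r, OF _ _ this] rd hd
    show ?thesis by (auto simp: S_def N_def fun_upd_idem)
  qed
  have loop2: "runs x (While d 1 (Dec d ;; Inc r)) (h(r := 0, d := N, Suc d := N), u) (N * 4 + 1) (h(Suc d := N), u)"
  proof -
    define S where "S i = (h(r := i, d := N - i, Suc d := N), u)" for i
    have "runs x (Dec d ;; Inc r) (S i) 2 (S (Suc i))" if "i < N" for i
    proof -
      have "runs x (Dec d) (S i) 1 (h(r := i, d := N - Suc i, Suc d := N), u)"
        using runs_Dec[of "fst (S i)" d x u] that rd by (simp add: S_def fun_upd_twist)
      moreover have "runs x (Inc r) (h(r := i, d := N - Suc i, Suc d := N), u) 1 (S (Suc i))"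
        using runs_Inc[of x r "h(r := i, d := N - Suc i, Suc d := N)" u] rd by (simp add: S_def fun_upd_twist)
      ultimately have "runs x (Dec d ;; Inc r) (S i) (1 + 1) (S (Suc i))"
        by (intro runs_Seq)
      then show ?thesis by (simp add: numeral_2_eq_2)
    qed
    from runs_While_counter[where S = S and N = N and r = d, OF _ _ this] rd hd
    show ?thesis by (auto simp: S_def N_def fun_upd_idem)
  qed
  have loop3: "runs x (While (d + 1) 1 (Dec (d + 1) ;; cm e (\<rho> @ [d, d + 1]) (d + 2) tgt ;; Inc d))
    (h(Suc d := N), u) (N * (poly p M + 4) + 1) (upd tgt (W N) (h(d := N), u))"
  proof -
    define S where "S i = upd tgt (W i) (h(d := i, Suc d := N - i), u)" for i
    have "runs x (Dec (d + 1) ;; cm e (\<rho> @ [d, d + 1]) (d + 2) tgt ;; Inc d) (S i) (poly p M + 2) (S (Suc i))"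
      if "i < N" for i
    proof -
      have "runs x (Dec (d + 1)) (S i) 1 (upd tgt (W i) (hi i, u))"
        using runs_Dec[of "fst (S i)" "Suc d" x "snd (S i)"] that tgt
        by (simp add: S_def hi_def fst_upd upd_fun_upd)
      moreover note body(2)[OF that]
      moreover have "runs x (Inc d) (upd tgt (W (Suc i)) (hi i, u)) 1 (S (Suc i))"
        using runs_Inc[of x d "fst (upd tgt (W (Suc i)) (hi i, u))" "snd (upd tgt (W (Suc i)) (hi i, u))"] tgt
        by (simp add: S_def hi_def fst_upd upd_fun_upd fun_upd_twist)
      ultimately have "runs x (Dec (d + 1) ;; cm e (\<rho> @ [d, Suc d]) (d + 2) tgt ;; Inc d) (S i)
          (1 + (poly p M + 1)) (S (Suc i))"
        by (intro runs_Seq)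
      then show ?thesis by simp
    qed
    note body = this
    have eq: "poly p M + 4 = poly p M + 2 + 2" by simp
    show ?thesis unfolding eq
      by (rule runs_While_counter[where S = S and N = N, OF _ _ body])
        (use hd tgt in \<open>auto simp: S_def fst_upd W_def fun_upd_idem\<close>)
  qed
  have loop4: "runs x (While d 1 (Dec d)) (upd tgt (W N) (h(d := N), u)) (N * 3 + 1) (upd tgt (W N) (h, u))"
  proof -
    define S where "S i = upd tgt (W N) (h(d := N - i), u)" for i
    have "runs x (Dec d) (S i) 1 (S (Suc i))" if "i < N" for i
      using runs_Dec[of "fst (S i)" d x "snd (S i)"] that tgt
      by (simp add: S_def fst_upd upd_fun_upd)
    from runs_While_counter[where S = S and N = N and r = d, OF _ _ this] rd hd tgt
    show ?thesis by (auto simp: S_def fst_upd fun_upd_idem numeral_3_eq_3)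
  qed
  have "runs x (cm (For v e) \<rho> d tgt) (h, u)
      ((N * 5 + 1) + ((N * 4 + 1) + ((N * (poly p M + 4) + 1) + (N * 3 + 1)))) (upd tgt (W N) (h, u))"
    unfolding cm.simps r_def[symmetric] by (rule runs_Seq[OF loop1 runs_Seq[OF loop2 runs_Seq[OF loop3 loop4]]])
  then have run: "runs x (cm (For v e) \<rho> d tgt) (h, u) (M * poly p M + M * 16 + 4) (upd tgt (W N) (h, u))"
  proof (rule runs_weaken)
    have "N * poly p M + N * 16 + 4 \<le> M * poly p M + M * 16 + 4"
      using N by (intro add_mono mult_right_mono) auto
    then show "(N * 5 + 1) + ((N * 4 + 1) + ((N * (poly p M + 4) + 1) + (N * 3 + 1))) \<le> M * poly p M + M * 16 + 4"
      by (simp add: algebra_simps)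
  qed
  \<comment> \<open>The four loops cost 5 + 4 + 4 + 3 = 16 steps per round besides the body, and one
    final test each.\<close>
  have eq: "poly ([:4, 16:] + [:0, 1:] * p) M = M * poly p M + M * 16 + 4" by (simp add: algebra_simps)
  show "length (den x (For v e) (map h \<rho>)) \<le> poly ([:4, 16:] + [:0, 1:] * p) M \<and>
      runs x (cm (For v e) \<rho> d tgt) (h, u) (poly ([:4, 16:] + [:0, 1:] * p) M)
        (upd tgt (den x (For v e) (map h \<rho>)) (h, u))"
    unfolding eq W using len run by simp
qed

text \<open>The new variable is at most \<open>poly p M\<close>, so the body is bounded at
  \<open>M + poly p M\<close>. Clearing its counter takes three steps per unit, which together with
  the run of \<open>e\<close> explains the factor 4.\<close>

lemma bounded_by_Let:
  assumes "bounded_by e p" "bounded_by e' p'"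
  shows "bounded_by (Let e e') (4 * p + 1 + p' \<circ>\<^sub>p ([:0, 1:] + p))"
  unfolding bounded_by_def
proof (intro allI impI)
  fix x \<rho> d tgt h u M
  assume *: "scoped (length \<rho>) (Let e e')" "ready \<rho> d tgt h" "\<forall>r \<in> set \<rho>. h r \<le> M"
  define L where "L = length (den x e (map h \<rho>))"
  define w where "w = den x e' (map h \<rho> @ [L])"
  have w: "den x (Let e e') (map h \<rho>) = w" by (simp add: w_def L_def)
  have d: "h d = 0" "0 < d" "d \<notin> set \<rho>" using *(2) by (auto simp: ready_def)
  have tgt: "tgt \<noteq> Some d" using ready_tgt[OF *(2)] by auto
  have "ready \<rho> (d + 1) (Some d) h" using *(2) by (auto simp: ready_def)
  from bounded_byD(1)[OF assms(1) _ this, of M x] bounded_byD(2)[OF assms(1) _ this, of M x u] *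
  have 1: "L \<le> poly p M" "runs x (cm e \<rho> (d + 1) (Some d)) (h, u) (poly p M) (h(d := L), u)"
    by (auto simp: L_def d)
  have rdy: "ready (\<rho> @ [d]) (d + 1) tgt (h(d := L))" using *(2) by (auto simp: ready_def)
  have bnd: "\<forall>r \<in> set (\<rho> @ [d]). (h(d := L)) r \<le> M + poly p M"
    using *(3) 1(1) by (auto simp: trans_le_add1)
  have env: "map (h(d := L)) (\<rho> @ [d]) = map h \<rho> @ [L]" using d by simp
  have "scoped (length (\<rho> @ [d])) e'" using *(1) by simp
  note sc = this
  have 2: "length w \<le> poly p' (M + poly p M)"
    "runs x (cm e' (\<rho> @ [d]) (d + 1) tgt) (h(d := L), u) (poly p' (M + poly p M)) (upd tgt w (h(d := L), u))"
    unfolding w_def env[symmetric] by (rule bounded_byD[OF assms(2) sc rdy bnd])+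
  have 3: "runs x (While d 1 (Dec d)) (upd tgt w (h(d := L), u)) (L * 3 + 1) (upd tgt w (h, u))"
  proof -
    define S where "S i = upd tgt w (h(d := L - i), u)" for i
    have "runs x (Dec d) (S i) 1 (S (Suc i))" if "i < L" for i
      using runs_Dec[of "fst (S i)" d x "snd (S i)"] that tgt
      by (simp add: S_def fst_upd upd_fun_upd)
    from runs_While_counter[where S = S and N = L and r = d, OF _ _ this] d tgt
    show ?thesis by (auto simp: S_def fst_upd fun_upd_idem numeral_3_eq_3)
  qed
  have "runs x (cm (Let e e') \<rho> d tgt) (h, u) (poly p M + (poly p' (M + poly p M) + (L * 3 + 1))) (upd tgt w (h, u))"
    unfolding cm.simps by (rule runs_Seq[OF 1(2) runs_Seq[OF 2(2) 3]])
  then have "runs x (cm (Let e e') \<rho> d tgt) (h, u) (4 * poly p M + 1 + poly p' (M + poly p M)) (upd tgt w (h, u))"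
    by (rule runs_weaken) (use 1(1) in simp)
  then show "length (den x (Let e e') (map h \<rho>)) \<le> poly (4 * p + 1 + p' \<circ>\<^sub>p ([:0, 1:] + p)) M \<and>
      runs x (cm (Let e e') \<rho> d tgt) (h, u) (poly (4 * p + 1 + p' \<circ>\<^sub>p ([:0, 1:] + p)) M)
        (upd tgt (den x (Let e e') (map h \<rho>)) (h, u))"
    using 2(1) unfolding w by (simp add: poly_pcompose)
qed

lemma sym_input: "sym x h 0 = 2 \<longleftrightarrow> h 0 < length x \<and> x ! h 0"
  by (simp add: sym_def tape_word_def word_cells_def)

text \<open>The variable is moved onto head 0, with \<open>d\<close> as a backup. The symbol must be
  tested before the head returns, so both branches begin by moving everything back; each of the two
  moves costs 5 steps per unit.\<close>

lemma bounded_by_IfX: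
  assumes "bounded_by e p" "bounded_by e' p'"
  shows "bounded_by (IfX v e e') ([:4, 10:] + p + p')"
  unfolding bounded_by_def
proof (intro allI impI)
  fix x \<rho> d tgt h u M
  assume *: "scoped (length \<rho>) (IfX v e e')" "ready \<rho> d tgt h" "\<forall>r \<in> set \<rho>. h r \<le> M"
  define r where "r = \<rho> ! v"
  define N where "N = h r"
  have r: "r \<in> set \<rho>" using *(1) by (simp add: r_def)
  then have rd: "0 < r" "r < d" and N: "N \<le> M" and hd: "h d = 0" "h 0 = 0"
    using *(2,3) by (auto simp: ready_def N_def)
  note 1 = bounded_byD[OF assms(1) _ *(2), of M x] and 2 = bounded_byD[OF assms(2) _ *(2), of M x]
  define w where "w = den x (IfX v e e') (map h \<rho>)"
  have w: "w = (if N < length x \<and> x ! N then den x e (map h \<rho>) else den x e' (map h \<rho>))"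
    using *(1) by (simp add: w_def N_def r_def)
  let ?h = "h(r := 0, d := N, 0 := N)"
  have loop1: "runs x (While r 1 (Dec r ;; Inc d ;; Inc 0)) (h, u) (N * 5 + 1) (?h, u)"
  proof -
    define S where "S i = (h(r := N - i, d := i, 0 := i), u)" for i
    have "runs x (Dec r ;; Inc d ;; Inc 0) (S i) 3 (S (Suc i))" if "i < N" for i
    proof -
      have "runs x (Dec r) (S i) 1 (h(r := N - Suc i, d := i, 0 := i), u)"
        using runs_Dec[of "fst (S i)" r x u] that rd by (simp add: S_def fun_upd_twist)
      moreover have "runs x (Inc d) (h(r := N - Suc i, d := i, 0 := i), u) 1
        (h(r := N - Suc i, d := Suc i, 0 := i), u)"
        using runs_Inc[of x d "h(r := N - Suc i, d := i, 0 := i)" u] rd by (simp add: fun_upd_twist)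
      moreover have "runs x (Inc 0) (h(r := N - Suc i, d := Suc i, 0 := i), u) 1 (S (Suc i))"
        using runs_Inc[of x 0 "h(r := N - Suc i, d := Suc i, 0 := i)" u] by (simp add: S_def)
      ultimately have "runs x (Dec r ;; Inc d ;; Inc 0) (S i) (1 + (1 + 1)) (S (Suc i))"
        by (intro runs_Seq)
      then show ?thesis by (simp add: numeral_3_eq_3)
    qed
    from runs_While_counter[where S = S and N = N and r = r, OF _ _ this] rd hd
    show ?thesis by (auto simp: S_def N_def fun_upd_idem)
  qed
  have loop2: "runs x (While d 1 (Dec d ;; Dec 0 ;; Inc r)) (?h, u) (N * 5 + 1) (h, u)"
  proof -
    define S where "S i = (h(r := i, d := N - i, 0 := N - i), u)" for i
    have "runs x (Dec d ;; Dec 0 ;; Inc r) (S i) 3 (S (Suc i))" if "i < N" for i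
    proof -
      have "runs x (Dec d) (S i) 1 (h(r := i, d := N - Suc i, 0 := N - i), u)"
        using runs_Dec[of "fst (S i)" d x u] that rd by (simp add: S_def fun_upd_twist)
      moreover have "runs x (Dec 0) (h(r := i, d := N - Suc i, 0 := N - i), u) 1
        (h(r := i, d := N - Suc i, 0 := N - Suc i), u)"
        using runs_Dec[of "h(r := i, d := N - Suc i, 0 := N - i)" 0 x u] that by simp
      moreover have "runs x (Inc r) (h(r := i, d := N - Suc i, 0 := N - Suc i), u) 1 (S (Suc i))"
        using runs_Inc[of x r "h(r := i, d := N - Suc i, 0 := N - Suc i)" u] rd by (simp add: S_def fun_upd_twist)
      ultimately have "runs x (Dec d ;; Dec 0 ;; Inc r) (S i) (1 + (1 + 1)) (S (Suc i))"
        by (intro runs_Seq)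
      then show ?thesis by (simp add: numeral_3_eq_3)
    qed
    from runs_While_counter[where S = S and N = N and r = d, OF _ _ this] rd hd
    show ?thesis by (auto simp: S_def N_def fun_upd_idem)
  qed
  have branches: "runs x (If 0 2 (While d 1 (Dec d ;; Dec 0 ;; Inc r) ;; cm e \<rho> d tgt)
      (While d 1 (Dec d ;; Dec 0 ;; Inc r) ;; cm e' \<rho> d tgt)) (?h, u)
      ((N * 5 + 1) + (poly p M + poly p' M) + 2) (upd tgt w (h, u))"
  proof (rule runs_If)
    assume "sym x (fst (?h, u)) 0 = 2"
    then have "w = den x e (map h \<rho>)" using w by (simp add: sym_input)
    with 1(2) * have "runs x (cm e \<rho> d tgt) (h, u) (poly p M) (upd tgt w (h, u))" by simp
    then have "runs x (cm e \<rho> d tgt) (h, u) (poly p M + poly p' M) (upd tgt w (h, u))"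
      by (rule runs_weaken) simp
    with loop2 show "runs x (While d 1 (Dec d ;; Dec 0 ;; Inc r) ;; cm e \<rho> d tgt) (?h, u)
      ((N * 5 + 1) + (poly p M + poly p' M)) (upd tgt w (h, u))" by (rule runs_Seq)
  next
    assume "sym x (fst (?h, u)) 0 \<noteq> 2"
    then have "w = den x e' (map h \<rho>)" using w by (auto simp: sym_input)
    with 2(2) * have "runs x (cm e' \<rho> d tgt) (h, u) (poly p' M) (upd tgt w (h, u))" by simp
    then have "runs x (cm e' \<rho> d tgt) (h, u) (poly p M + poly p' M) (upd tgt w (h, u))"
      by (rule runs_weaken) simp
    with loop2 show "runs x (While d 1 (Dec d ;; Dec 0 ;; Inc r) ;; cm e' \<rho> d tgt) (?h, u)
      ((N * 5 + 1) + (poly p M + poly p' M)) (upd tgt w (h, u))" by (rule runs_Seq)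
  qed
  have "runs x (cm (IfX v e e') \<rho> d tgt) (h, u)
      ((N * 5 + 1) + ((N * 5 + 1) + (poly p M + poly p' M) + 2)) (upd tgt w (h, u))"
    unfolding cm.simps r_def[symmetric] by (rule runs_Seq[OF loop1 branches])
  then have "runs x (cm (IfX v e e') \<rho> d tgt) (h, u) (4 + M * 10 + poly p M + poly p' M) (upd tgt w (h, u))"
    by (rule runs_weaken) (use N in simp)
  moreover have "length w \<le> poly p M + poly p' M"
    using 1(1) 2(1) * w by auto
  ultimately show "length (den x (IfX v e e') (map h \<rho>)) \<le> poly ([:4, 10:] + p + p') M \<and>
      runs x (cm (IfX v e e') \<rho> d tgt) (h, u) (poly ([:4, 10:] + p + p') M)
        (upd tgt (den x (IfX v e e') (map h \<rho>)) (h, u))"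
    unfolding w_def[symmetric] by (simp add: algebra_simps)
qed

lemma ex_bounded_by: "\<exists>p. bounded_by e p"
proof (induction e)
  case (Emit b)
  show ?case using bounded_by_Emit by (rule exI)
next
  case Nop
  show ?case using bounded_by_Nop by (rule exI)
next
  case (App e e')
  then show ?case using bounded_by_App by (elim exE) (rule exI)
next
  case (For v e)
  then show ?case using bounded_by_For by (elim exE) (rule exI)
next
  case (Let e e')
  then show ?case using bounded_by_Let by (elim exE) (rule exI)
next
  case (IfX v e e')
  then show ?case using bounded_by_IfX by (elim exE) (rule exI)
qed

text \<open>A prologue measures the input: head 0 runs to the first blank while counters 1 and 2
  count along, then counter 2 brings it back. Counter 1 remains as variable 0. The two loops take 5
  and 4 steps per symbol.\<close>

theorem polytime_computable_den:
  assumes "scoped 1 e"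
  shows "polytime_computable (\<lambda>x. den x e [length x])"
proof -
  obtain p where p: "bounded_by e p" using ex_bounded_by by blast
  let ?c = "While 0 0 (Inc 0 ;; Inc 1 ;; Inc 2) ;; While 2 1 (Dec 2 ;; Dec 0) ;; cm e [1] 2 None"
  have "\<exists>t h. t \<le> poly ([:2, 9:] + p) (length x) \<and> big x ?c (\<lambda>_. 0, []) t (h, den x e [length x])" for x
  proof -
    define n where "n = length x"
    define h :: "nat \<Rightarrow> nat" where "h = (\<lambda>_. 0)(1 := n)"
    have 1: "runs x (While 0 0 (Inc 0 ;; Inc 1 ;; Inc 2)) (\<lambda>_. 0, []) (n * (3 + 2) + 1) (h(0 := n, 2 := n), [])"
    proof -
      define S :: "nat \<Rightarrow> mstate" where "S i = ((\<lambda>_. 0)(0 := i, 1 := i, 2 := i), [])" for i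
      have "runs x (Inc 0 ;; Inc 1 ;; Inc 2) (S i) 3 (S (Suc i))" for i
      proof -
        have "runs x (Inc 0) (S i) 1 ((\<lambda>_. 0)(0 := Suc i, 1 := i, 2 := i), [])"
          using runs_Inc[of x 0 "fst (S i)" "[]"] by (simp add: S_def fun_upd_twist)
        moreover have "runs x (Inc 1) ((\<lambda>_. 0)(0 := Suc i, 1 := i, 2 := i), []) 1 ((\<lambda>_. 0)(0 := Suc i, 1 := Suc i, 2 := i), [])"
          using runs_Inc[of x 1 "(\<lambda>_. 0)(0 := Suc i, 1 := i, 2 := i)" "[]"] by (simp add: fun_upd_twist)
        moreover have "runs x (Inc 2) ((\<lambda>_. 0)(0 := Suc i, 1 := Suc i, 2 := i), []) 1 (S (Suc i))"
          using runs_Inc[of x 2 "(\<lambda>_. 0)(0 := Suc i, 1 := Suc i, 2 := i)" "[]"] by (simp add: S_def)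
        ultimately have "runs x (Inc 0 ;; Inc 1 ;; Inc 2) (S i) (1 + (1 + 1)) (S (Suc i))"
          by (intro runs_Seq)
        then show ?thesis by (simp add: numeral_3_eq_3)
      qed
      then have "runs x (While 0 0 (Inc 0 ;; Inc 1 ;; Inc 2)) (S 0) (n * (3 + 2) + 1) (S n)"
        by (intro runs_While) (auto simp: S_def sym_def tape_word_def word_cells_def n_def)
      moreover have "S 0 = (\<lambda>_. 0, [])" "S n = (h(0 := n, 2 := n), [])"
        by (auto simp: S_def h_def fun_eq_iff)
      ultimately show ?thesis by simp
    qed
    have 2: "runs x (While 2 1 (Dec 2 ;; Dec 0)) (h(0 := n, 2 := n), []) (n * (2 + 2) + 1) (h, [])"
    proof -
      define S :: "nat \<Rightarrow> mstate" where "S i = (h(0 := n - i, 2 := n - i), [])" for i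
      have "runs x (Dec 2 ;; Dec 0) (S i) 2 (S (Suc i))" if "i < n" for i
      proof -
        have "runs x (Dec 2) (S i) 1 (h(0 := n - i, 2 := n - Suc i), [])"
          using runs_Dec[of "fst (S i)" 2 x "[]"] that by (simp add: S_def)
        moreover have "runs x (Dec 0) (h(0 := n - i, 2 := n - Suc i), []) 1 (S (Suc i))"
          using runs_Dec[of "h(0 := n - i, 2 := n - Suc i)" 0 x "[]"] that by (simp add: S_def fun_upd_twist)
        ultimately have "runs x (Dec 2 ;; Dec 0) (S i) (1 + 1) (S (Suc i))"
          by (intro runs_Seq)
        then show ?thesis by (simp add: numeral_2_eq_2)
      qed
      moreover have "S 0 = (h(0 := n, 2 := n), [])" "S n = (h, [])"
        by (auto simp: S_def h_def fun_eq_iff)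
      ultimately show ?thesis
        by (intro runs_While_counter[where S = S]) (auto simp: S_def)
    qed
    have "ready [1] 2 None h" by (auto simp: ready_def h_def)
    from bounded_byD(2)[OF p _ this, of n x "[]"] assms
    have 3: "runs x (cm e [1] 2 None) (h, []) (poly p n) (h, den x e [n])"
      by (simp add: h_def)
    have "runs x ?c (\<lambda>_. 0, []) ((n * (3 + 2) + 1) + ((n * (2 + 2) + 1) + poly p n)) (h, den x e [n])"
      by (rule runs_Seq[OF 1 runs_Seq[OF 2 3]])
    then have "runs x ?c (\<lambda>_. 0, []) (poly ([:2, 9:] + p) n) (h, den x e [n])"
      by (rule runs_weaken) simp
    then show ?thesis unfolding runs_def n_def by blast
  qed
  then show ?thesis by (rule polytime_computable_cmd)
qed

section \<open>Printing the instance\<close>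

text \<open>The part of \<open>nums\<close> for a stretch of items that is followed by
  \<open>off\<close> further items. Cutting the chain into such blocks lets each loop print its
  own.\<close>

fun blk :: "nat \<Rightarrow> ('l \<Rightarrow> bool) \<Rightarrow> ('l \<Rightarrow> bool list) \<Rightarrow> ('l \<Rightarrow> bool list) \<Rightarrow> nat \<Rightarrow> 'l list \<Rightarrow> bool list list" where
  "blk R fr P C off [] = []"
| "blk R fr P C off (l # ls) = item R (fr l) (P l) (C l) (off + length ls) @ blk R fr P C off ls"

lemma nums_blk: "nums R fr P C ls = blk R fr P C 0 ls @ [replicate R False @ [True]]"
  by (induction ls) auto

lemma blk_append: "blk R fr P C off (xs @ ys) = blk R fr P C (off + length ys) xs @ blk R fr P C off ys"
  by (induction xs) (auto simp: ac_simps)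

text \<open>Behind round \<open>i\<close> there are \<open>n - 1 - i\<close> rounds of
  \<open>l\<close> items each; this offset is the reason why \<open>For\<close> binds the number of
  rounds to come.\<close>

lemma blk_concat:
  assumes "\<And>i. length (g i) = l"
  shows "blk R fr P C off (concat (map g [0..<n])) = concat (map (\<lambda>i. blk R fr P C (off + (n - 1 - i) * l) (g i)) [0..<n])"
proof (induction n arbitrary: off)
  case (Suc n)
  have "off + l + (n - 1 - i) * l = off + (Suc n - 1 - i) * l" if "i < n" for i
  proof -
    from that obtain j where "n = Suc (i + j)" using less_imp_Suc_add by blast
    then show ?thesis by (simp add: algebra_simps)
  qed
  then have E: "map (\<lambda>i. blk R fr P C (off + l + (n - 1 - i) * l) (g i)) [0..<n] =
      map (\<lambda>i. blk R fr P C (off + (Suc n - 1 - i) * l) (g i)) [0..<n]"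
    by (intro map_cong refl) (simp only: set_upt atLeastLessThan_iff)
  have "blk R fr P C off (concat (map g [0..<Suc n])) = blk R fr P C (off + l) (concat (map g [0..<n])) @ blk R fr P C off (g n)"
    by (simp add: blk_append assms)
  also have "\<dots> = concat (map (\<lambda>i. blk R fr P C (off + (Suc n - 1 - i) * l) (g i)) [0..<n]) @ blk R fr P C off (g n)"
    unfolding Suc[of "off + l"] E by (rule refl)
  finally show ?case by simp
qed simp

lemma blk_map:
  "blk R fr P C off (map f [0..<n]) =
    concat (map (\<lambda>i. item R (fr (f i)) (P (f i)) (C (f i)) (off + (n - 1 - i))) [0..<n])"
  using blk_concat[of "\<lambda>i. [f i]" 1 R fr P C off n] by simp

definition out :: "nat \<Rightarrow> bool list list \<Rightarrow> bool list" where
  "out w xss = concat (map (\<lambda>xs. expand w xs @ [False]) xss)"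

lemma out_simps [simp]: "out w [] = []" "out w (xs # xss) = expand w xs @ False # out w xss"
  "out w (xss @ yss) = out w xss @ out w yss"
  by (auto simp: out_def)

lemma out_concat: "out w (concat xsss) = concat (map (out w) xsss)"
  by (induction xsss) auto

lemma encode_vals:
  assumes "\<And>xs. xs \<in> set xss \<Longrightarrow> xs \<noteq> [] \<and> last xs"
  shows "encode_seq (map (val w) xss) = out w xss"
  using assms by (induction xss) (auto simp: encode_seq_def encode_nat_val)

text \<open>Variables 0 to 5 are the length of the input, the bound on the certificate, slack,
  the number \<open>T\<close> of rounds, the number \<open>N\<close> of positions, and the padding of the digits.\<close>

definition dgt :: "bool \<Rightarrow> em" where
  "dgt b = For 5 (Emit True \<oplus> Emit False) \<oplus> Emit True \<oplus> Emit b"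

fun bits :: "bool list \<Rightarrow> em" where
  "bits [] = Nop"
| "bits (b # bs) = dgt b \<oplus> bits bs"

abbreviation "zeros a \<equiv> bits (replicate a False)"

text \<open>Being insensitive to later bindings \<open>ext\<close> lets an emitter be placed inside
  further loops.\<close>

definition prints :: "bool list \<Rightarrow> em \<Rightarrow> nat list \<Rightarrow> bool list \<Rightarrow> bool" where
  "prints x e env bs \<longleftrightarrow> 5 < length env \<and> (\<forall>ext. den x e (env @ ext) = expand (env ! 5) bs)"

lemma prints_den: "prints x e env bs \<Longrightarrow> den x e env = expand (env ! 5) bs"
  unfolding prints_def by (elim conjE, drule spec[of _ "[]"]) simp

lemma prints_Nop: "5 < length env \<Longrightarrow> prints x Nop env []"
  by (simp add: prints_def)

lemma prints_App: "prints x e env bs \<Longrightarrow> prints x e' env bs' \<Longrightarrow> prints x (e \<oplus> e') env (bs @ bs')"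
  by (simp add: prints_def)

lemma prints_dgt: "5 < length env \<Longrightarrow> prints x (dgt b) env [b]"
  by (simp add: prints_def dgt_def nth_append map_replicate_const)

lemma prints_bits: "5 < length env \<Longrightarrow> prints x (bits bs) env bs"
proof (induction bs)
  case (Cons b bs)
  then show ?case using prints_App[OF prints_dgt[of env x b], of "bits bs" bs] by simp
qed (simp add: prints_Nop)

lemma expand_replicate: "expand w (concat (replicate n bs)) = concat (replicate n (expand w bs))"
  by (induction n) auto

lemma prints_For:
  assumes "prints x e env bs" "v < length env"
  shows "prints x (For v e) env (concat (replicate (env ! v) bs))"
  using assms by (simp add: prints_def nth_append map_replicate_const expand_replicate)

lemma concat_replicate_replicate: "concat (replicate n (replicate a y)) = replicate (n * a) y"
  by (induction n) (auto simp: replicate_add)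

lemma prints_For_zeros:
  "prints x e env (replicate a False) \<Longrightarrow> v < length env \<Longrightarrow> prints x (For v e) env (replicate (env ! v * a) False)"
  using prints_For[of x e env "replicate a False" v] by (simp add: concat_replicate_replicate)

lemma prints_App_zeros:
  "prints x e env (replicate a False) \<Longrightarrow> prints x e' env (replicate b False) \<Longrightarrow>
    prints x (e \<oplus> e') env (replicate (a + b) False)"
  using prints_App[of x e env "replicate a False" e' "replicate b False"] by (simp add: replicate_add)

definition number :: "em \<Rightarrow> em" where
  "number e = e \<oplus> Emit False"

text \<open>The version for one exact environment. It is meant for the emitter of the input cells,
  which addresses its loop variable by the length of the environment and would change its meaning
  under further bindings.\<close>

definition prints0 :: "bool list \<Rightarrow> em \<Rightarrow> nat list \<Rightarrow> bool list \<Rightarrow> bool" where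
  "prints0 x e env bs \<longleftrightarrow> 5 < length env \<and> den x e env = expand (env ! 5) bs"

lemma prints0I: "prints x e env bs \<Longrightarrow> prints0 x e env bs"
  by (simp add: prints0_def prints_den) (simp add: prints_def)

lemma prints0_App: "prints0 x e env bs \<Longrightarrow> prints0 x e' env bs' \<Longrightarrow> prints0 x (e \<oplus> e') env (bs @ bs')"
  by (simp add: prints0_def)

lemma den_number: "prints0 x e env bs \<Longrightarrow> den x (number e) env = out (env ! 5) [bs]"
  by (simp add: number_def prints0_def)

fun seq :: "em list \<Rightarrow> em" where
  "seq [] = Nop"
| "seq (e # es) = e \<oplus> seq es"

lemma den_seq: "den x (seq es) env = concat (map (\<lambda>e. den x e env) es)"
  by (induction es) auto

text \<open>The verifier fixes \<open>KK\<close> and \<open>SS\<close>, so these are written out;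
  only \<open>N\<close> depends on the input and becomes a loop.\<close>

definition layer :: "nat \<Rightarrow> nat \<Rightarrow> em" where
  "layer KK SS = For 4 (zeros KK) \<oplus> zeros (2 * KK + SS)"

definition rows :: "nat \<Rightarrow> nat \<Rightarrow> em" where
  "rows KK SS = For 3 (layer KK SS) \<oplus> layer KK SS"

definition lvec_em :: "nat \<Rightarrow> nat \<Rightarrow> side \<Rightarrow> em" where
  "lvec_em KK SS X = For 8 (zeros KK) \<oplus> bits (net.pat KK (fst X)) \<oplus> For 9 (zeros KK) \<oplus> bits (net.spat SS (snd X))"

definition item_em :: "em \<Rightarrow> bool \<Rightarrow> em \<Rightarrow> em \<Rightarrow> em \<Rightarrow> em" where
  "item_em r free P C z = (if free then
     number (P \<oplus> z \<oplus> bits [False, False, False, True, True]) \<oplus> number (C \<oplus> z \<oplus> bits [True, False, False, True]) \<oplus>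
     number (P \<oplus> z \<oplus> bits [False, True, True]) \<oplus> number (r \<oplus> z \<oplus> bits [False, False, True]) \<oplus>
     number (C \<oplus> z \<oplus> bits [False, True])
   else
     number (P \<oplus> z \<oplus> bits [False, False, False, True, True]) \<oplus> number (C \<oplus> z \<oplus> bits [False, False, True, True]) \<oplus>
     number (P \<oplus> z \<oplus> bits [False, True, True]) \<oplus> number (C \<oplus> z \<oplus> bits [True, True]))"

lemma den_item_em:
  assumes "prints0 x r env (replicate R False)" "prints0 x eP env P" "prints0 x eC env C" "prints0 x z env (replicate (4 * k) False)"
  shows "den x (item_em r free eP eC z) env = out (env ! 5) (item R free P C k)"
proof -
  have len: "5 < length env" using assms(1) by (simp add: prints0_def)
  have *: "den x (number (e \<oplus> z \<oplus> bits bs)) env = expand (env ! 5) (xs @ replicate (4 * k) False @ bs) @ [False]"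
    if "prints0 x e env xs" for e xs bs
    using den_number[OF prints0_App[OF that prints0_App[OF assms(4) prints0I[OF prints_bits[OF len]]]]] by (simp only: out_simps append_Nil2)
  have P: "den x (number (eP \<oplus> z \<oplus> bits bs)) env = expand (env ! 5) (P @ replicate (4 * k) False @ bs) @ [False]"
    and C: "den x (number (eC \<oplus> z \<oplus> bits bs)) env = expand (env ! 5) (C @ replicate (4 * k) False @ bs) @ [False]"
    and r: "den x (number (r \<oplus> z \<oplus> bits bs)) env = expand (env ! 5) (replicate R False @ replicate (4 * k) False @ bs) @ [False]"
    for bs
    using *[OF assms(2)] *[OF assms(3)] *[OF assms(1)] .
  show ?thesis
  proof (cases free)
    case True
    then have fr: "free = True" by simp
    show ?thesis unfolding item_em_def item_def Let_def fr if_True den.simps P C r out_def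
      by (simp only: list.map concat.simps append_assoc append_Nil append_Nil2)
  next
    case False
    then have fr: "free = False" by simp
    show ?thesis unfolding item_em_def item_def Let_def fr if_False den.simps P C out_def
      by (simp only: list.map concat.simps append_assoc append_Nil append_Nil2)
  qed
qed

text \<open>Variables 6 to 9 are the round, the rounds to come, the position and the positions to
  come. The zeros below the tags amount to four rows for each item behind this one: later rounds,
  later positions, later kinds, and the constants.\<close>

definition tile_em :: "nat \<Rightarrow> nat \<Rightarrow> (nat \<times> (nat \<times> nat) set \<times> nat \<times> (nat \<times> nat) set) list \<Rightarrow> nat \<Rightarrow> nat \<Rightarrow> em" where
  "tile_em KK SS tr nc c = (let mk = length (net.kinds KK tr) in
     item_em (rows KK SS) True
       ((For 6 (layer KK SS) \<oplus> layer KK SS) \<oplus> lvec_em KK SS (snd (net.kinds KK tr ! c)) \<oplus> For 7 (layer KK SS))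
       (For 6 (layer KK SS) \<oplus> lvec_em KK SS (fst (net.kinds KK tr ! c)) \<oplus> For 7 (layer KK SS) \<oplus> layer KK SS)
       (For 7 (For 4 (zeros (4 * mk))) \<oplus> For 9 (zeros (4 * mk)) \<oplus> zeros (4 * (mk - 1 - c) + 4 * nc)))"

definition const_em :: "nat \<Rightarrow> nat \<Rightarrow> nat \<Rightarrow> (nat \<Rightarrow> em) \<Rightarrow> (nat \<Rightarrow> em) \<Rightarrow> nat \<Rightarrow> em" where
  "const_em KK SS nc ip fp j =
     item_em (rows KK SS) False (ip j \<oplus> For 3 (layer KK SS)) (For 3 (layer KK SS) \<oplus> fp j) (zeros (4 * (nc - 1 - j)))"

definition all_em :: "nat \<Rightarrow> nat \<Rightarrow> (nat \<times> (nat \<times> nat) set \<times> nat \<times> (nat \<times> nat) set) list \<Rightarrow> nat \<Rightarrow>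
    (nat \<Rightarrow> em) \<Rightarrow> (nat \<Rightarrow> em) \<Rightarrow> em" where
  "all_em KK SS tr nc ip fp = (let mk = length (net.kinds KK tr);
       z = rows KK SS \<oplus> For 3 (For 4 (zeros (4 * mk))) \<oplus> zeros (4 * nc) in
     number (z \<oplus> bits [True, True]) \<oplus> number (z \<oplus> bits [False, True]) \<oplus>
     For 3 (For 4 (seq (map (tile_em KK SS tr nc) [0..<mk]))) \<oplus>
     seq (map (const_em KK SS nc ip fp) [0..<nc]) \<oplus>
     number (rows KK SS \<oplus> bits [True]))"

context net
begin

lemma length_labs: "length (labs nc) = T * (N * length kinds) + nc"
proof -
  have 1: "length (concat (map (\<lambda>i. map (Tile t i) [0..<length kinds]) [0..<j])) = j * length kinds" for t j
    by (induction j) auto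
  have "length (concat (map (\<lambda>t. concat (map (\<lambda>i. map (Tile t i) [0..<length kinds]) [0..<N])) [0..<j])) = j * (N * length kinds)" for j
    by (induction j) (simp_all add: 1)
  then show ?thesis by (simp add: labs_def)
qed

lemma prints_layer:
  assumes "5 < length env" "env ! 4 = N"
  shows "prints x (layer KK SS) env (replicate L False)"
proof -
  have eq: "L = env ! 4 * KK + (2 * KK + SS)" unfolding L_def assms(2) by (simp add: algebra_simps)
  have v: "4 < length env" using assms(1) by simp
  show ?thesis unfolding layer_def eq
    by (rule prints_App_zeros[OF prints_For_zeros[OF prints_bits[OF assms(1)] v] prints_bits[OF assms(1)]])
qed

lemma prints_rows:
  assumes "5 < length env" "env ! 4 = N" "env ! 3 = T"
  shows "prints x (rows KK SS) env (replicate ((T + 1) * L) False)"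
proof -
  have eq: "(T + 1) * L = env ! 3 * L + L" unfolding assms(3) by simp
  have v: "3 < length env" using assms(1) by simp
  show ?thesis unfolding rows_def eq
    by (rule prints_App_zeros[OF prints_For_zeros[OF prints_layer[OF assms(1,2)] v] prints_layer[OF assms(1,2)]])
qed

lemma prints_lvec:
  assumes "9 < length env" "env ! 8 = i" "env ! 9 = N - 1 - i"
  shows "prints x (lvec_em KK SS X) env (lvec i X)"
proof -
  have len: "5 < length env" "8 < length env" using assms(1) by simp_all
  note z = prints_For_zeros[OF prints_bits[OF len(1)], where a = KK]
  show ?thesis unfolding lvec_em_def lvec_def
    by (intro prints_App prints_bits[OF len(1)])
      (use z[OF len(2)] z[OF assms(1)] in \<open>simp_all add: assms(2,3) mult.commute\<close>)
qed

definition env6 :: "nat \<Rightarrow> nat \<Rightarrow> nat \<Rightarrow> nat \<Rightarrow> nat list" where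
  "env6 n m z w = [n, m, z, T, N, w]"

lemma den_tile_em:
  assumes "t < T" "i < N" "c < length kinds"
  shows "den x (tile_em KK SS trans nc c) (env6 n m z w @ [t, T - 1 - t, i, N - 1 - i]) =
    out w (item ((T + 1) * L) True (tile_P I (Tile t i c)) (tile_C F (Tile t i c))
      (nc + (T - 1 - t) * (N * length kinds) + (N - 1 - i) * length kinds + (length kinds - 1 - c)))"
proof -
  define env where "env = env6 n m z w @ [t, T - 1 - t, i, N - 1 - i]"
  have env: "length env = 10" "env ! 3 = T" "env ! 4 = N" "env ! 5 = w" "env ! 6 = t" "env ! 7 = T - 1 - t"
    "env ! 8 = i" "env ! 9 = N - 1 - i"
    by (simp_all add: env_def env6_def)
  have len: "5 < length env" "6 < length env" "7 < length env" "9 < length env" "4 < length env" by (simp_all add: env)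
  note lay = prints_layer[OF len(1) env(3)]
  note l6 = prints_For_zeros[OF lay len(2), unfolded env] and l7 = prints_For_zeros[OF lay len(3), unfolded env]
  note lv = prints_lvec[OF len(4) env(7,8)]
  have P: "prints x ((For 6 (layer KK SS) \<oplus> layer KK SS) \<oplus> lvec_em KK SS (snd (kinds ! c)) \<oplus> For 7 (layer KK SS)) env
      (tile_P I (Tile t i c))"
  proof -
    have "t * L + L = (t + 1) * L" "T - 1 - t = T - (t + 1)" by simp_all
    then show ?thesis using prints_App[OF prints_App_zeros[OF l6 lay] prints_App[OF lv l7]]
      by (simp only: tile_P_def lab.case cvec_def)
  qed
  have C: "prints x (For 6 (layer KK SS) \<oplus> lvec_em KK SS (fst (kinds ! c)) \<oplus> For 7 (layer KK SS) \<oplus> layer KK SS) env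
      (tile_C F (Tile t i c))"
  proof -
    have "(T - t) = Suc (T - 1 - t)" using assms(1) by simp
    then have "(T - 1 - t) * L + L = (T - t) * L" by (simp only: mult_Suc add.commute)
    then show ?thesis using prints_App[OF l6 prints_App[OF lv prints_App_zeros[OF l7 lay]]]
      by (simp only: tile_C_def lab.case cvec_def)
  qed
  let ?mk = "length kinds"
  have Z: "prints x (For 7 (For 4 (zeros (4 * ?mk))) \<oplus> For 9 (zeros (4 * ?mk)) \<oplus> zeros (4 * (?mk - 1 - c) + 4 * nc)) env
    (replicate (4 * (nc + (T - 1 - t) * (N * ?mk) + (N - 1 - i) * ?mk + (?mk - 1 - c))) False)"
  proof -
    note b = prints_bits[OF len(1), of x "replicate a False" for a]
    have "prints x (For 7 (For 4 (zeros (4 * ?mk))) \<oplus> For 9 (zeros (4 * ?mk)) \<oplus> zeros (4 * (?mk - 1 - c) + 4 * nc)) env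
      (replicate ((T - 1 - t) * (N * (4 * ?mk)) + ((N - 1 - i) * (4 * ?mk) + (4 * (?mk - 1 - c) + 4 * nc))) False)"
      using prints_App_zeros[OF prints_For_zeros[OF prints_For_zeros[OF b len(5)] len(3)]
          prints_App_zeros[OF prints_For_zeros[OF b len(4)] b]] by (simp only: env)
    moreover have "(T - 1 - t) * (N * (4 * ?mk)) + ((N - 1 - i) * (4 * ?mk) + (4 * (?mk - 1 - c) + 4 * nc)) =
      4 * (nc + (T - 1 - t) * (N * ?mk) + (N - 1 - i) * ?mk + (?mk - 1 - c))"
      by (simp only: add_mult_distrib2 mult.assoc mult.left_commute[of 4] ac_simps)
    ultimately show ?thesis by (simp only:)
  qed
  show ?thesis
    unfolding tile_em_def Let_def env_def[symmetric]
    using den_item_em[OF prints0I[OF prints_rows[OF len(1) env(3,2)]] prints0I[OF P] prints0I[OF C] prints0I[OF Z]] by (simp only: env)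
qed

lemma den_const_em:
  assumes "prints0 x (ip j) (env6 n m z w) (I j)" "prints0 x (fp j) (env6 n m z w) (F j)"
  shows "den x (const_em KK SS nc ip fp j) (env6 n m z w) =
    out w (item ((T + 1) * L) False (tile_P I (Const j)) (tile_C F (Const j)) (nc - 1 - j))"
proof -
  define env where "env = env6 n m z w"
  have env: "length env = 6" "env ! 3 = T" "env ! 4 = N" "env ! 5 = w" by (simp_all add: env_def env6_def)
  have len: "5 < length env" "3 < length env" by (simp_all add: env)
  note lay = prints_layer[OF len(1) env(3)]
  note l3 = prints_For_zeros[OF lay len(2), unfolded env]
  have P: "prints0 x (ip j \<oplus> For 3 (layer KK SS)) env (tile_P I (Const j))"
    using prints0_App[OF assms(1)[folded env_def] prints0I[OF l3]] by (simp add: tile_P_def cvec_def)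
  have C: "prints0 x (For 3 (layer KK SS) \<oplus> fp j) env (tile_C F (Const j))"
    using prints0_App[OF prints0I[OF l3] assms(2)[folded env_def]] by (simp add: tile_C_def cvec_def)
  show ?thesis
    unfolding const_em_def env_def[symmetric]
    using den_item_em[OF prints0I[OF prints_rows[OF len(1) env(3,2)]] P C prints0I[OF prints_bits[OF len(1)]]] by (simp only: env)
qed

text \<open>The loops visit the tiles in the order of \<open>labs\<close>; cutting the list into
  blocks turns the number of items behind a tile into an expression in the loop variables.\<close>

lemma den_all_em:
  assumes "\<And>j. j < nc \<Longrightarrow> prints0 x (ip j) (env6 n m z w) (I j) \<and> prints0 x (fp j) (env6 n m z w) (F j)"
    and "\<forall>j<nc. length (I j) = L \<and> length (F j) = L"
  shows "den x (all_em KK SS trans nc ip fp) (env6 n m z w) =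
    encode_seq (map (val w) (all_nums ((T + 1) * L) free (tile_P I) (tile_C F) (labs nc)))"
proof -
  define env where "env = env6 n m z w"
  define R where "R = (T + 1) * L"
  let ?mk = "length kinds"
  let ?it = "\<lambda>l. item R (free l) (tile_P I l) (tile_C F l)"
  have env: "length env = 6" "env ! 3 = T" "env ! 4 = N" "env ! 5 = w" by (simp_all add: env_def env6_def)
  have len: "5 < length env" "3 < length env" "4 < length env" by (simp_all add: env)
  note rw = prints_rows[OF len(1) env(3,2), folded R_def]
  note b = prints_bits[OF len(1)]
  have z: "prints x (rows KK SS \<oplus> For 3 (For 4 (zeros (4 * ?mk))) \<oplus> zeros (4 * nc)) env
      (replicate (R + 4 * length (labs nc)) False)"
  proof -
    have "prints x (rows KK SS \<oplus> For 3 (For 4 (zeros (4 * ?mk))) \<oplus> zeros (4 * nc)) env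
      (replicate (R + (T * (N * (4 * ?mk)) + 4 * nc)) False)"
      using prints_App_zeros[OF rw prints_App_zeros[OF prints_For_zeros[OF prints_For_zeros[OF b len(3)] len(2)] b]]
      by (simp only: env)
    moreover have "R + (T * (N * (4 * ?mk)) + 4 * nc) = R + 4 * length (labs nc)"
      unfolding length_labs by (simp add: algebra_simps)
    ultimately show ?thesis by (simp only:)
  qed
  have tiles: "den x (For 3 (For 4 (seq (map (tile_em KK SS trans nc) [0..<?mk])))) env =
    out w (blk R free (tile_P I) (tile_C F) nc (concat (map (\<lambda>t. concat (map (\<lambda>i. map (Tile t i) [0..<?mk]) [0..<N])) [0..<T])))"
  proof -
    have "length (concat (map (\<lambda>i. map (Tile t i) [0..<?mk]) [0..<j])) = j * ?mk" for t j
      by (induction j) auto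
    then have "blk R free (tile_P I) (tile_C F) nc (concat (map (\<lambda>t. concat (map (\<lambda>i. map (Tile t i) [0..<?mk]) [0..<N])) [0..<T])) =
      concat (map (\<lambda>t. concat (map (\<lambda>i. concat (map (\<lambda>c. ?it (Tile t i c) (nc + (T - 1 - t) * (N * ?mk) + (N - 1 - i) * ?mk + (?mk - 1 - c)))
        [0..<?mk])) [0..<N])) [0..<T])"
      by (simp only: blk_concat[where l = "N * ?mk"] blk_concat[where l = ?mk] blk_map length_map length_upt diff_zero)
    moreover have "den x (For 3 (For 4 (seq (map (tile_em KK SS trans nc) [0..<?mk])))) env =
      concat (map (\<lambda>t. concat (map (\<lambda>i. concat (map (\<lambda>c. out w (?it (Tile t i c) (nc + (T - 1 - t) * (N * ?mk) + (N - 1 - i) * ?mk + (?mk - 1 - c))))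
        [0..<?mk])) [0..<N])) [0..<T])"
    proof -
      have n4: "(env @ [t, r]) ! 4 = N" for t r using env by (simp add: nth_append)
      have "den x (tile_em KK SS trans nc c) ((env @ [t, T - 1 - t]) @ [i, N - 1 - i]) =
        out w (?it (Tile t i c) (nc + (T - 1 - t) * (N * ?mk) + (N - 1 - i) * ?mk + (?mk - 1 - c)))"
        if "t < T" "i < N" "c < ?mk" for t i c
        using den_tile_em[OF that] by (simp add: env_def R_def free_def)
      then show ?thesis
        by (auto simp: n4 env den_seq o_def intro!: arg_cong[where f = concat] map_cong)
    qed
    ultimately show ?thesis by (simp add: out_concat o_def)
  qed
  have cst: "den x (seq (map (const_em KK SS nc ip fp) [0..<nc])) env =
    out w (blk R free (tile_P I) (tile_C F) 0 (map Const [0..<nc]))"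
  proof -
    have "den x (const_em KK SS nc ip fp j) env = out w (?it (Const j) (nc - 1 - j))" if "j < nc" for j
      using den_const_em[where ip = ip and fp = fp and I = I and F = F] assms(1)[OF that] by (simp add: env_def R_def free_def)
    then show ?thesis unfolding blk_map out_concat den_seq
      by (auto simp: o_def intro!: arg_cong[where f = concat] map_cong)
  qed
  have "encode_seq (map (val w) (all_nums R free (tile_P I) (tile_C F) (labs nc))) =
    out w (all_nums R free (tile_P I) (tile_C F) (labs nc))"
    using last_all_nums[OF contents_labs[OF assms(2)]] by (intro encode_vals) (simp add: R_def)
  also have "\<dots> = den x (all_em KK SS trans nc ip fp) env"
    unfolding all_nums_def nums_blk Let_def all_em_def den.simps(3) tiles cst
      den_number[OF prints0I[OF prints_App[OF z b]]] den_number[OF prints0I[OF prints_App[OF rw b]]] env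
    by (simp add: labs_def blk_append)
  finally show ?thesis by (simp only: env_def R_def)
qed

end

lemma scoped_mono: "scoped k e \<Longrightarrow> k \<le> k' \<Longrightarrow> scoped k' e"
  by (induction e arbitrary: k k') auto

lemma scoped_bits: "5 < k \<Longrightarrow> scoped k (bits bs)"
  by (induction bs) (auto simp: dgt_def)

lemma scoped_seq: "scoped k (seq es) \<longleftrightarrow> (\<forall>e \<in> set es. scoped k e)"
  by (induction es) auto

lemma scoped_number: "scoped k (number e) \<longleftrightarrow> scoped k e"
  by (simp add: number_def)

lemma scoped_layer: "5 < k \<Longrightarrow> scoped k (layer KK SS)"
  by (simp add: layer_def scoped_bits)

lemma scoped_item_em:
  "5 < k \<Longrightarrow> scoped k r \<Longrightarrow> scoped k P \<Longrightarrow> scoped k C \<Longrightarrow> scoped k z \<Longrightarrow> scoped k (item_em r free P C z)"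
  by (simp add: item_em_def scoped_bits scoped_number del: bits.simps)

lemma scoped_tile_em: "scoped 10 (tile_em KK SS tr nc c)"
  unfolding tile_em_def Let_def
  by (intro scoped_item_em) (simp_all add: rows_def lvec_em_def scoped_layer scoped_bits)

lemma scoped_all_em:
  assumes "\<And>j. j < nc \<Longrightarrow> scoped 6 (ip j)" "\<And>j. j < nc \<Longrightarrow> scoped 6 (fp j)"
  shows "scoped 6 (all_em KK SS tr nc ip fp)"
proof -
  have "scoped 6 (const_em KK SS nc ip fp j)" if "j < nc" for j
    unfolding const_em_def using assms that
    by (intro scoped_item_em) (simp_all add: rows_def scoped_layer scoped_bits)
  then show ?thesis
    by (simp add: all_em_def Let_def scoped_number scoped_bits scoped_layer rows_def scoped_seq scoped_tile_em del: bits.simps)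
qed

section \<open>Evaluating polynomials in unary\<close>

fun ones :: "nat \<Rightarrow> em" where
  "ones 0 = Nop"
| "ones (Suc a) = Emit True \<oplus> ones a"

lemma length_ones [simp]: "length (den x (ones a) env) = a"
  by (induction a) auto

lemma scoped_ones [simp]: "scoped k (ones a)"
  by (induction a) auto

lemma length_concat_const: "(\<And>i. length (f i) = a) \<Longrightarrow> length (concat (map f [0..<n])) = n * a"
  by (induction n) auto

lemma length_den_For: "(\<And>i. length (den x e (env @ [i, env ! v - 1 - i])) = a) \<Longrightarrow> length (den x (For v e) env) = env ! v * a"
  by (simp only: den.simps length_concat_const)

text \<open>Horner's scheme with output lengths: \<open>a\<close> symbols, then \<open>n\<close>
  repetitions of the output for the remaining polynomial.\<close>

lemma ex_poly_em:
  fixes p :: "nat poly"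
  shows "\<exists>e. scoped 1 e \<and> (\<forall>x n env. length (den x e (n # env)) = poly p n)"
proof (induction p)
  case 0
  show ?case by (intro exI[of _ Nop]) simp
next
  case (pCons a p)
  then obtain e where e: "scoped 1 e" "\<forall>x n env. length (den x e (n # env)) = poly p n" by blast
  have "length (den x (For 0 e) (n # env)) = n * poly p n" for x n env
    using e(2) by (subst length_den_For[where a = "poly p n"]) simp_all
  then have "length (den x (ones a \<oplus> For 0 e) (n # env)) = poly (pCons a p) n" for x n env
    by (simp del: den.simps(4))
  moreover have "scoped 1 (ones a \<oplus> For 0 e)" using scoped_mono[OF e(1)] by simp
  ultimately show ?case by blast
qed

section \<open>Initial and final markings\<close>

definition kbits :: "nat \<Rightarrow> nat set \<Rightarrow> bool list" where
  "kbits KK S = map (\<lambda>k. k \<in> S) [0..<KK]"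

lemma kbits_empty: "kbits KK {} = replicate KK False"
  by (simp add: kbits_def map_replicate_const)

context net
begin

definition bvec :: "(nat \<Rightarrow> nat set) \<Rightarrow> nat set \<Rightarrow> bool list" where
  "bvec S Q = concat (map (\<lambda>b. kbits KK (S b)) [0..<N + 2]) @ spat Q"

lemma length_kvec: "length (concat (map (\<lambda>b. kbits KK (S b)) [0..<n])) = n * KK"
  by (rule length_concat_const) (simp add: kbits_def)

lemma length_bvec: "length (bvec S Q) = L"
  unfolding bvec_def length_append length_kvec by (simp add: L_def spat_def mult.commute)

lemma dg_bvec_st: "\<sigma> < SS \<Longrightarrow> dg (bvec S Q) (st_row \<sigma>) = of_bool (\<sigma> \<in> Q)"
proof -
  assume "\<sigma> < SS"
  have "st_row \<sigma> = length (concat (map (\<lambda>b. kbits KK (S b)) [0..<N + 2])) + \<sigma>"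
    unfolding length_kvec by (simp add: st_row_def)
  then have "dg (bvec S Q) (st_row \<sigma>) = dg (spat Q) \<sigma>"
    unfolding bvec_def dg_append by simp
  then show ?thesis using \<open>\<sigma> < SS\<close> by (simp add: dg_def spat_def)
qed

lemma dg_bvec_loc:
  assumes "b < N + 2" "k < KK"
  shows "dg (bvec S Q) (loc_row b k) = of_bool (k \<in> S b)"
proof -
  have "dg (concat (map (\<lambda>b. kbits KK (S b)) [0..<n]) @ ys) (KK * b + k) = of_bool (k \<in> S b)" if "b < n" for n ys
    using that
  proof (induction n arbitrary: ys)
    case (Suc n)
    show ?case
    proof (cases "b < n")
      case True
      then show ?thesis using Suc.IH[of "kbits KK (S n) @ ys"] by simp
    next
      case False
      then have b: "b = n" using Suc.prems by simp
      have "KK * b + k = length (concat (map (\<lambda>b. kbits KK (S b)) [0..<n])) + k"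
        unfolding length_kvec b by simp
      then show ?thesis using assms(2) unfolding b
        by (simp add: dg_append) (simp add: dg_def kbits_def)
    qed
  qed simp
  from this[OF assms(1)] show ?thesis by (simp only: bvec_def loc_row_def)
qed

end

lemma mem_if_empty: "k \<in> (if c then X else {}) \<longleftrightarrow> c \<and> k \<in> X"
  by simp

lemma concat_map_const: "(\<And>i. i < n \<Longrightarrow> f i = ys) \<Longrightarrow> concat (map f [0..<n]) = concat (replicate n ys)"
  by (induction n) (auto simp: replicate_append_same[symmetric] simp del: replicate_append_same)

lemma prints0_For_IfX:
  assumes "prints x e1 env b1" "prints x e2 env b2" "v = length env" "0 < length env"
  shows "prints0 x (For 0 (IfX v e1 e2)) env (concat (map (\<lambda>i. if i < length x \<and> x ! i then b1 else b2) [0..<env ! 0]))"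
proof -
  have "den x e1 (env @ ext) = expand (env ! 5) b1" "den x e2 (env @ ext) = expand (env ! 5) b2" "5 < length env" for ext
    using assms(1,2) by (simp_all add: prints_def)
  then show ?thesis
    by (simp add: prints0_def assms(3) nth_append expand_concat o_def if_distrib[of "expand (env ! 5)"] cong: if_cong)
qed

lemma map_upt_split: "map f [0..<a + b] = map f [0..<a] @ map (\<lambda>i. f (a + i)) [0..<b]"
  by (induction b) auto

definition blank_set :: "tm \<Rightarrow> nat set" where
  "blank_set V = (\<lambda>j. cK j 0) ` {..<tm_tapes V}"

text \<open>The kinds at cell -1, where the second tape carries the marker that ends the
  guessing.\<close>

definition hash_set :: "tm \<Rightarrow> nat set" where
  "hash_set V = (\<lambda>j. cK j (if j = 1 then tm_symbols V else 0)) ` {..<tm_tapes V}"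

definition input_set :: "tm \<Rightarrow> nat \<Rightarrow> nat set" where
  "input_set V a = (\<lambda>j. cK j (if j = 0 then a else 0)) ` {..<tm_tapes V}"

text \<open>The cells are printed from left to right: the empty position 0, the blank cells
  \<open>-Z\<close> to -2, the marker cell, the input, \<open>m + slack + 2\<close> blank cells, and
  the empty position \<open>2 * Z + 2\<close>. The heads come in two separate vectors, because the
  order of their positions \<open>Z + 1\<close> and \<open>Z + m\<close> depends on
  \<open>m\<close>.\<close>

definition init_em :: "nat \<Rightarrow> nat \<Rightarrow> tm \<Rightarrow> nat \<Rightarrow> em" where
  "init_em KK SS V j =
     (if j = 0 then
       zeros KK \<oplus> For 3 (bits (kbits KK (blank_set V))) \<oplus> bits (kbits KK (hash_set V)) \<oplus>
       For 0 (IfX 6 (bits (kbits KK (input_set V 2))) (bits (kbits KK (input_set V 1)))) \<oplus>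
       For 1 (bits (kbits KK (blank_set V))) \<oplus> For 2 (bits (kbits KK (blank_set V))) \<oplus>
       bits (kbits KK (blank_set V)) \<oplus> bits (kbits KK (blank_set V)) \<oplus>
       zeros KK \<oplus> bits (net.spat SS {gs False})
     else if j = 1 then
       (zeros (2 * KK) \<oplus> For 3 (zeros KK)) \<oplus> bits (kbits KK (hK ` ({..<tm_tapes V} - {1}))) \<oplus>
       (For 3 (zeros KK) \<oplus> zeros (2 * KK + SS))
     else
       (zeros KK \<oplus> For 3 (zeros KK) \<oplus> For 1 (zeros KK)) \<oplus> bits (kbits KK {hK 1}) \<oplus>
       (For 0 (zeros KK) \<oplus> For 2 (zeros KK) \<oplus> zeros (3 * KK + SS)))"

definition final_em :: "nat \<Rightarrow> nat \<Rightarrow> tm \<Rightarrow> nat \<Rightarrow> em" where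
  "final_em KK SS V j =
     (if j = 0 then (For 4 (zeros KK) \<oplus> zeros (2 * KK)) \<oplus> bits (net.spat SS {wt (tm_accept V)}) else layer KK SS)"

text \<open>With \<open>T\<close> chosen as this sum and \<open>Z = T + 1\<close>, every stretch of
  the window has a length that is a sum of loop bounds and constants, so no subtraction has to be
  programmed.\<close>

locale encoded = sim KK SS Z T trans V x m
  for KK SS Z T :: nat and trans V x m +
  fixes slack :: nat
  assumes T_eq: "T = length x + m + slack" and Z_eq: "Z = T + 1"
begin

definition cells :: "nat \<Rightarrow> nat set" where
  "cells b = (\<lambda>l. cK l (snd (gtapes V x (int m - 1) [] ! l) (int b - int Z - 1))) ` {..<tm_tapes V}"

text \<open>The head of tape 1 starts on cell \<open>m - 1\<close>, which is position
  \<open>Z + m\<close>; all other heads start on cell 0, which is position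
  \<open>Z + 1\<close>.\<close>

definition init_vec :: "nat \<Rightarrow> bool list" where
  "init_vec j = (if j = 0 then bvec (\<lambda>b. if 1 \<le> b \<and> b \<le> 2 * Z + 1 then cells b else {}) {gs False}
     else if j = 1 then bvec (\<lambda>b. if b = Z + 1 then hK ` ({..<tm_tapes V} - {1}) else {}) {}
     else bvec (\<lambda>b. if b = Z + m then {hK 1} else {}) {})"

definition final_vec :: "nat \<Rightarrow> bool list" where
  "final_vec j = (if j = 0 then bvec (\<lambda>b. {}) {wt (tm_accept V)} else bvec (\<lambda>b. {}) {})"

lemma length_vecs: "length (init_vec j) = L \<and> length (final_vec j) = L"
  unfolding init_vec_def final_vec_def by (simp only: length_bvec if_cancel if_distrib[of length] simp_thms)

lemma sum3: "(\<Sum>j<3. f j) = f 0 + f 1 + f 2" for f :: "nat \<Rightarrow> int"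
  by (simp add: numeral_3_eq_3 numeral_2_eq_2)

lemma vecs_012:
  "init_vec 0 = bvec (\<lambda>b. if 1 \<le> b \<and> b \<le> 2 * Z + 1 then cells b else {}) {gs False}"
  "init_vec 1 = bvec (\<lambda>b. if b = Z + 1 then hK ` ({..<tm_tapes V} - {1}) else {}) {}"
  "init_vec 2 = bvec (\<lambda>b. if b = Z + m then {hK 1} else {}) {}"
  "final_vec 0 = bvec (\<lambda>b. {}) {wt (tm_accept V)}"
  "final_vec 1 = bvec (\<lambda>b. {}) {}" "final_vec 2 = bvec (\<lambda>b. {}) {}"
  unfolding init_vec_def final_vec_def
  by (rule if_P trans[OF if_not_P if_P] trans[OF if_not_P if_not_P] if_not_P, simp_all only: refl one_neq_zero zero_neq_numeral numeral_neq_zero num.distinct one_eq_numeral_iff numeral_eq_one_iff not_False_eq_True)+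

lemma final_sums:
  "\<forall>\<sigma><SS. (\<Sum>j<3. dg (final_vec j) (st_row \<sigma>)) = of_bool (\<sigma> = wt (tm_accept V))"
  "\<forall>b < 2 * Z + 1 + 2. \<forall>k < KK. (\<Sum>j<3. dg (final_vec j) (loc_row b k)) = 0"
proof -
  show "\<forall>\<sigma><SS. (\<Sum>j<3. dg (final_vec j) (st_row \<sigma>)) = of_bool (\<sigma> = wt (tm_accept V))"
    unfolding sum3 vecs_012 by (intro allI impI, subst (1 2 3) dg_bvec_st) simp_all
  show "\<forall>b < 2 * Z + 1 + 2. \<forall>k < KK. (\<Sum>j<3. dg (final_vec j) (loc_row b k)) = 0"
    unfolding sum3 vecs_012 by (intro allI impI, subst (1 2 3) dg_bvec_loc) simp_all
qed

lemma init_sums: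
  "\<forall>\<sigma><SS. (\<Sum>j<3. dg (init_vec j) (st_row \<sigma>)) = of_bool (\<sigma> = gs False)"
  "\<forall>b < 2 * Z + 1 + 2. \<forall>k < KK. (\<Sum>j<3. dg (init_vec j) (loc_row b k)) = of_bool ((b, k) \<in> W (gtapes V x (int m - 1) []))"
proof -
  show "\<forall>\<sigma><SS. (\<Sum>j<3. dg (init_vec j) (st_row \<sigma>)) = of_bool (\<sigma> = gs False)"
    unfolding sum3 vecs_012 by (intro allI impI, subst (1 2 3) dg_bvec_st) simp_all
  show "\<forall>b < 2 * Z + 1 + 2. \<forall>k < KK. (\<Sum>j<3. dg (init_vec j) (loc_row b k)) = of_bool ((b, k) \<in> W (gtapes V x (int m - 1) []))"
  proof (intro allI impI)
    fix b k assume bk: "b < 2 * Z + 1 + 2" "k < KK"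
    let ?g = "gtapes V x (int m - 1) []"
    have mZ: "m \<le> Z" using T_eq Z_eq by simp
    have fstg: "fst (?g ! l) = (if l = 1 then int m - 1 else 0)" if "l < tm_tapes V" for l
      using that by (simp add: gtapes_nth)
    have sum: "(\<Sum>j<3. dg (init_vec j) (loc_row b k)) =
      of_bool (1 \<le> b \<and> b \<le> 2 * Z + 1 \<and> k \<in> cells b) +
      of_bool (b = Z + 1 \<and> k \<in> hK ` ({..<tm_tapes V} - {1})) + of_bool (b = Z + m \<and> k = hK 1)"
      unfolding sum3 vecs_012 dg_bvec_loc[OF bk] by (simp only: mem_if_empty conj_assoc singleton_iff)
    consider l where "k = hK l" | l a where "k = cK l a" | "\<And>l. k \<noteq> hK l" "\<And>l a. k \<noteq> cK l a" by blast
    then show "(\<Sum>j<3. dg (init_vec j) (loc_row b k)) = of_bool ((b, k) \<in> W ?g)"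
    proof cases
      case (1 l)
      have "(b, k) \<in> W ?g \<longleftrightarrow> 1 \<le> b \<and> b \<le> 2 * Z + 1 \<and> l < tm_tapes V \<and> int b = fst (?g ! l) + int Z + 1"
        unfolding W_def 1 by (auto simp: tok_hK)
      also have "\<dots> \<longleftrightarrow> l < tm_tapes V \<and> b = (if l = 1 then Z + m else Z + 1)"
        using mZ Z_eq by (auto simp: fstg)
      finally have B: "(b, k) \<in> W ?g \<longleftrightarrow> l < tm_tapes V \<and> b = (if l = 1 then Z + m else Z + 1)" .
      show ?thesis unfolding sum B cells_def unfolding 1 using two_tapes by auto
    next
      case (2 l a)
      have B: "(b, k) \<in> W ?g \<longleftrightarrow> 1 \<le> b \<and> b \<le> 2 * Z + 1 \<and> l < tm_tapes V \<and> a = snd (?g ! l) (int b - int Z - 1)"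
        unfolding W_def 2 by (auto simp: tok_cK)
      show ?thesis unfolding sum B cells_def unfolding 2 by auto
    next
      case 3
      have "(b, k) \<notin> W ?g" unfolding W_def tok_def using 3 by auto
      moreover have "k \<notin> hK ` X" "k \<notin> (\<lambda>l. cK l (f l)) ` Y" for X Y f using 3 by auto
      ultimately show ?thesis unfolding sum cells_def using 3 by auto
    qed
  qed
qed

abbreviation "env w \<equiv> env6 (length x) m slack w"

lemma init_cells:
  assumes "1 \<le> b" "b \<le> 2 * Z + 1"
  shows "cells b =
    (if b = Z then hash_set V else if Z + 1 \<le> b \<and> b < Z + 1 + length x then input_set V (if x ! (b - Z - 1) then 2 else 1)
     else blank_set V)"
proof -
  have "snd (gtapes V x (int m - 1) [] ! l) (int b - int Z - 1) =
     (if l = 1 then (if b = Z then tm_symbols V else 0) else if l = 0 then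
       (if Z + 1 \<le> b \<and> b < Z + 1 + length x then (if x ! (b - Z - 1) then 2 else 1) else 0) else 0)"
    if "l < tm_tapes V" for l
  proof -
    have "nat (int b - int Z - 1) = b - Z - 1" by simp
    then show ?thesis using that by (auto simp: gtapes_nth gword_def word_cells_def)
  qed
  then show ?thesis
    unfolding cells_def hash_set_def input_set_def blank_set_def by (auto intro!: image_cong)
qed

lemma prints_init: "prints0 x (init_em KK SS V j) (env w) (init_vec j)"
proof -
  define e where "e = env w"
  have env: "length e = 6" "e ! 0 = length x" "e ! 1 = m" "e ! 2 = slack" "e ! 3 = T" unfolding e_def env6_def by simp_all
  have len: "5 < length e" by (simp add: env)
  note b = prints_bits[OF len]
  have F: "prints x (For v (bits bs)) e (concat (replicate (e ! v) bs))" if "v < 6" for v bs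
    using prints_For[OF b] that by (simp add: env)
  have FZ: "prints x (For v (zeros a)) e (replicate (e ! v * a) False)" if "v < 6" for v a
    using prints_For_zeros[OF b] that by (simp add: env)
  \<comment> \<open>The positions of a layer, cut into the stretches that the emitter
    prints.\<close>
  have N2: "2 * Z + 1 + 2 = 1 + (T + (1 + (length x + ((m + (slack + 2)) + 1))))"
    using T_eq Z_eq by simp
  consider "j = 0" | "j = 1" | "j \<noteq> 0" "j \<noteq> 1" by blast
  then have "prints0 x (init_em KK SS V j) e (init_vec j)"
  proof cases
    case 1
    define S where "S b = (if 1 \<le> b \<and> b \<le> 2 * Z + 1 then cells b else {})" for b
    define f where "f b = kbits KK (S b)" for b
    have f0: "f 0 = replicate KK False" by (simp add: f_def S_def kbits_empty)
    have f1: "f (1 + i) = kbits KK (blank_set V)" if "i < T" for i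
    proof -
      have "1 + i \<le> 2 * Z + 1" "1 + i \<noteq> Z" "\<not> Z + 1 \<le> 1 + i" using that Z_eq by simp_all
      then show ?thesis by (simp add: f_def S_def init_cells)
    qed
    have f2: "f (1 + (T + 0)) = kbits KK (hash_set V)"
    proof -
      have "1 + (T + 0) = Z" "1 \<le> Z" using Z_eq by simp_all
      then show ?thesis by (simp only: \<open>1 + (T + 0) = Z\<close>) (simp add: f_def S_def init_cells)
    qed
    have f3: "f (1 + (T + (1 + i))) = (if i < length x \<and> x ! i then kbits KK (input_set V 2) else kbits KK (input_set V 1))"
      if "i < length x" for i
    proof -
      have "1 + (T + (1 + i)) = Z + 1 + i" "i \<le> Z" using Z_eq T_eq that by simp_all
      then show ?thesis using that by (simp only: \<open>1 + (T + (1 + i)) = Z + 1 + i\<close>) (simp add: f_def S_def init_cells)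
    qed
    have f4: "f (1 + (T + (1 + (length x + i)))) = kbits KK (blank_set V)" if "i < m + (slack + 2)" for i
    proof -
      have eq: "1 + (T + (1 + (length x + i))) = Z + 1 + length x + i" and le: "length x + i \<le> Z" using Z_eq T_eq that by simp_all
      show ?thesis using le by (simp only: eq) (simp add: f_def S_def init_cells)
    qed
    have f5: "f (1 + (T + (1 + (length x + ((m + (slack + 2)) + 0))))) = replicate KK False"
    proof -
      have eq: "1 + (T + (1 + (length x + ((m + (slack + 2)) + 0)))) = 2 * Z + 2" using Z_eq T_eq by simp
      show ?thesis by (simp only: eq) (simp add: f_def S_def kbits_empty)
    qed
    have "concat (map f [0..<2 * Z + 1 + 2]) = replicate KK False @ concat (replicate T (kbits KK (blank_set V))) @
      kbits KK (hash_set V) @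
      concat (map (\<lambda>i. if i < length x \<and> x ! i then kbits KK (input_set V 2) else kbits KK (input_set V 1)) [0..<length x]) @
      concat (replicate m (kbits KK (blank_set V))) @ concat (replicate slack (kbits KK (blank_set V))) @
      kbits KK (blank_set V) @ kbits KK (blank_set V) @ replicate KK False"
    proof -
      have one: "map g [0..<1] = [g 0]" for g :: "nat \<Rightarrow> bool list" by simp
      have s1: "concat (map (\<lambda>i. f (1 + i)) [0..<T]) = concat (replicate T (kbits KK (blank_set V)))"
        using f1 by (rule concat_map_const)
      have s3: "map (\<lambda>i. f (1 + (T + (1 + i)))) [0..<length x] =
        map (\<lambda>i. if i < length x \<and> x ! i then kbits KK (input_set V 2) else kbits KK (input_set V 1)) [0..<length x]"
        using f3 by (intro map_cong refl) (simp only: set_upt atLeastLessThan_iff)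
      have s4: "concat (map (\<lambda>i. f (1 + (T + (1 + (length x + i))))) [0..<m + (slack + 2)]) =
        concat (replicate (m + (slack + 2)) (kbits KK (blank_set V)))"
        using f4 by (rule concat_map_const)
      have r: "concat (replicate (m + (slack + 2)) ys) = concat (replicate m ys) @ concat (replicate slack ys) @ ys @ ys"
        for ys :: "bool list"
        unfolding replicate_add concat_append by (simp add: numeral_2_eq_2)
      show ?thesis
        unfolding N2 map_upt_split concat_append one f0 s1 f2 s3 s4[unfolded map_upt_split concat_append] f5
        by (simp only: r concat.simps append_Nil2 append_assoc)
    qed
    then have iv: "init_vec j = replicate KK False @ concat (replicate T (kbits KK (blank_set V))) @
      kbits KK (hash_set V) @
      concat (map (\<lambda>i. if i < length x \<and> x ! i then kbits KK (input_set V 2) else kbits KK (input_set V 1)) [0..<length x]) @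
      concat (replicate m (kbits KK (blank_set V))) @ concat (replicate slack (kbits KK (blank_set V))) @
      kbits KK (blank_set V) @ kbits KK (blank_set V) @ replicate KK False @ spat {gs False}"
      unfolding init_vec_def bvec_def using 1 by (simp add: f_def[abs_def] S_def[abs_def])
    have "prints0 x (For 0 (IfX 6 (bits (kbits KK (input_set V 2))) (bits (kbits KK (input_set V 1))))) e
      (concat (map (\<lambda>i. if i < length x \<and> x ! i then kbits KK (input_set V 2) else kbits KK (input_set V 1)) [0..<e ! 0]))"
      by (rule prints0_For_IfX[OF b b]) (simp_all add: env)
    note x = this[unfolded env(2)]
    have fb: "prints0 x (For 3 (bits bs)) e (concat (replicate T bs))" "prints0 x (For 1 (bits bs)) e (concat (replicate m bs))"
      "prints0 x (For 2 (bits bs)) e (concat (replicate slack bs))" for bs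
      using prints0I[OF F[of 3 bs]] prints0I[OF F[of 1 bs]] prints0I[OF F[of 2 bs]] unfolding env by simp_all
    show ?thesis unfolding iv init_em_def if_P[OF 1]
      by (intro prints0_App x fb prints0I[OF b])
  next
    case 2
    have "concat (map (\<lambda>b. kbits KK (if b = Z + 1 then S else {})) [0..<2 * Z + 1 + 2]) =
      replicate ((Z + 1) * KK) False @ kbits KK S @ replicate ((Z + 1) * KK) False" for S
    proof -
      have N: "2 * Z + 1 + 2 = (Z + 1) + (1 + (Z + 1))" by simp
      have one: "map g [0..<1] = [g 0]" for g :: "nat \<Rightarrow> bool list" by simp
      have "concat (map (\<lambda>b. kbits KK (if b = Z + 1 then S else {})) [0..<Z + 1]) = concat (replicate (Z + 1) (replicate KK False))"
        by (intro concat_map_const) (simp add: kbits_empty)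
      moreover have "concat (map (\<lambda>i. kbits KK (if (Z + 1) + (1 + i) = Z + 1 then S else {})) [0..<Z + 1]) = concat (replicate (Z + 1) (replicate KK False))"
        by (intro concat_map_const) (simp add: kbits_empty)
      ultimately show ?thesis unfolding N map_upt_split concat_append one concat_replicate_replicate by simp
    qed
    then have iv: "init_vec j = replicate (2 * KK + T * KK) False @ kbits KK (hK ` ({..<tm_tapes V} - {1})) @
        replicate (T * KK + (2 * KK + SS)) False"
      unfolding init_vec_def bvec_def spat_def using 2 Z_eq
      by (simp add: map_replicate_const replicate_add[symmetric] algebra_simps)
    have z: "prints x (zeros (2 * KK) \<oplus> For 3 (zeros KK)) e (replicate (2 * KK + T * KK) False)"
      "prints x (For 3 (zeros KK) \<oplus> zeros (2 * KK + SS)) e (replicate (T * KK + (2 * KK + SS)) False)"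
      using prints_App_zeros[OF b FZ[of 3]] prints_App_zeros[OF FZ[of 3] b] by (simp_all only: env)
    have "init_em KK SS V j = (zeros (2 * KK) \<oplus> For 3 (zeros KK)) \<oplus> bits (kbits KK (hK ` ({..<tm_tapes V} - {1}))) \<oplus>
       (For 3 (zeros KK) \<oplus> zeros (2 * KK + SS))"
      unfolding init_em_def using 2 by simp
    then show ?thesis unfolding iv by (simp only:) (intro prints0I prints_App z b)
  next
    case 3
    have "concat (map (\<lambda>b. kbits KK (if b = Z + m then S else {})) [0..<2 * Z + 1 + 2]) =
      replicate ((Z + m) * KK) False @ kbits KK S @ replicate ((length x + slack + 3) * KK) False" for S
    proof -
      have N: "2 * Z + 1 + 2 = (Z + m) + (1 + (length x + slack + 3))" using Z_eq T_eq by simp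
      have one: "map g [0..<1] = [g 0]" for g :: "nat \<Rightarrow> bool list" by simp
      have "concat (map (\<lambda>b. kbits KK (if b = Z + m then S else {})) [0..<Z + m]) = concat (replicate (Z + m) (replicate KK False))"
        by (intro concat_map_const) (simp add: kbits_empty)
      moreover have "concat (map (\<lambda>i. kbits KK (if (Z + m) + (1 + i) = Z + m then S else {})) [0..<length x + slack + 3]) =
          concat (replicate (length x + slack + 3) (replicate KK False))"
        by (intro concat_map_const) (simp add: kbits_empty)
      ultimately show ?thesis unfolding N map_upt_split concat_append one concat_replicate_replicate by simp
    qed
    then have iv: "init_vec j = replicate (KK + (T * KK + m * KK)) False @ kbits KK {hK 1} @
        replicate (length x * KK + (slack * KK + (3 * KK + SS))) False"
      unfolding init_vec_def bvec_def spat_def using 3 Z_eq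
      by (simp add: map_replicate_const replicate_add[symmetric] algebra_simps)
    have z: "prints x (zeros KK \<oplus> For 3 (zeros KK) \<oplus> For 1 (zeros KK)) e (replicate (KK + (T * KK + m * KK)) False)"
      "prints x (For 0 (zeros KK) \<oplus> For 2 (zeros KK) \<oplus> zeros (3 * KK + SS)) e
        (replicate (length x * KK + (slack * KK + (3 * KK + SS))) False)"
      using prints_App_zeros[OF b prints_App_zeros[OF FZ[of 3] FZ[of 1]]] prints_App_zeros[OF FZ[of 0] prints_App_zeros[OF FZ[of 2] b]]
      by (simp_all only: env)
    have "init_em KK SS V j = (zeros KK \<oplus> For 3 (zeros KK) \<oplus> For 1 (zeros KK)) \<oplus> bits (kbits KK {hK 1}) \<oplus>
       (For 0 (zeros KK) \<oplus> For 2 (zeros KK) \<oplus> zeros (3 * KK + SS))"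
      unfolding init_em_def using 3 by simp
    then show ?thesis unfolding iv by (simp only:) (intro prints0I prints_App z b)
  qed
  then show ?thesis unfolding e_def .
qed

end

context encoded
begin

lemma bvec_empty: "bvec (\<lambda>b. {}) Q = replicate ((2 * Z + 1) * KK + 2 * KK) False @ spat Q"
proof -
  have "concat (map (\<lambda>b. kbits KK {}) [0..<n]) = replicate (n * KK) False" for n
    by (simp add: kbits_empty map_replicate_const concat_replicate_replicate)
  moreover have "(2 * Z + 1 + 2) * KK = (2 * Z + 1) * KK + 2 * KK" by (rule add_mult_distrib)
  ultimately show ?thesis unfolding bvec_def by (simp only:)
qed

lemma prints_final: "prints0 x (final_em KK SS V j) (env w) (final_vec j)"
proof -
  define e where "e = env w"
  have env: "length e = 6" "e ! 4 = 2 * Z + 1" unfolding e_def env6_def by simp_all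
  have len: "5 < length e" "4 < length e" by (simp_all add: env)
  note b = prints_bits[OF len(1)]
  have "prints0 x (final_em KK SS V j) e (final_vec j)"
  proof (cases "j = 0")
    case True
    have "prints x (For 4 (zeros KK) \<oplus> zeros (2 * KK)) e (replicate ((2 * Z + 1) * KK + 2 * KK) False)"
      using prints_App_zeros[OF prints_For_zeros[OF b len(2)] b] by (simp only: env)
    then show ?thesis unfolding final_em_def final_vec_def if_P[OF True] bvec_empty
      by (intro prints0I prints_App b)
  next
    case False
    have "bvec (\<lambda>b. {}) {} = replicate L False"
      unfolding bvec_empty L_def spat_def by (simp add: map_replicate_const replicate_add[symmetric] algebra_simps)
    then show ?thesis unfolding final_em_def final_vec_def if_not_P[OF False]
      using prints0I[OF prints_layer[OF len(1) env(2)]] by (simp only:)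
  qed
  then show ?thesis unfolding e_def .
qed

definition degs :: "nat \<Rightarrow> nat list" where
  "degs w = map (val w) (all_nums ((T + 1) * L) free (tile_P init_vec) (tile_C final_vec) (labs 3))"

lemma den_degs: "den x (all_em KK SS trans 3 (init_em KK SS V) (final_em KK SS V)) (env w) = encode_seq (degs w)"
  unfolding degs_def by (rule den_all_em) (simp_all only: prints_init prints_final length_vecs simp_thms)

lemma contents_vecs: "contents ((T + 1) * L) (tile_P init_vec) (tile_C final_vec) (set (labs 3))"
  by (rule contents_labs) (simp only: length_vecs simp_thms)

lemma degree_sequence_degs: "0 < w \<Longrightarrow> degree_sequence (degs w)"
  unfolding degs_def by (rule degree_sequence_vals_all_nums[OF contents_vecs])

text \<open>The padding \<open>w\<close> equals \<open>5 * length (labs 3) + 3\<close>, a bound on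
  the number of summands; the three constants contribute 15 of the 18. As
  \<open>w < 2 ^ Suc w\<close>, the base exceeds the number of summands.\<close>

lemma realizable_degs_iff:
  assumes w: "w = T * ((2 * Z + 1) * (5 * length kinds)) + 18"
    and t: "t \<le> Z" "m + 2 + t * (tm_tapes V + 2) \<le> T"
      "\<And>u. length u \<le> m \<Longrightarrow> accepts V [x, u] \<Longrightarrow> fst (run_tm V [x, u] t) = tm_accept V"
  shows "bipartite_multigraph_realizable (degs w) \<longleftrightarrow> (\<exists>u. length u \<le> m \<and> accepts V [x, u])"
proof -
  have "length (all_nums ((T + 1) * L) free (tile_P init_vec) (tile_C final_vec) (labs 3)) \<le> 5 * length (labs 3) + 3"
    by (rule length_all_nums)
  also have "\<dots> = w" unfolding length_labs w by (simp add: algebra_simps)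
  also have "w < 2 ^ Suc w" by (rule less_trans[OF less_exp]) simp
  finally have size: "length (all_nums ((T + 1) * L) free (tile_P init_vec) (tile_C final_vec) (labs 3)) < 2 ^ Suc w" .
  have Z: "m \<le> Z" "0 < Z" using T_eq Z_eq by simp_all
  have len: "\<forall>j<3. length (init_vec j) = L \<and> length (final_vec j) = L" by (simp only: length_vecs simp_thms)
  show ?thesis
    unfolding degs_def realizable_vals_all_nums_iff[OF distinct_labs contents_vecs size] ex_solution_iff[OF len]
    using t(3) by (rule solution_iff[OF Z t(1,2) _ init_sums final_sums])
qed

end

section \<open>Assembling the reduction\<close>

lemma TR_bounds:
  assumes "wf_tm V" "2 \<le> tm_tapes V" "\<And>j. j < tm_tapes V \<Longrightarrow> hK j < KK"
    "\<And>j a. j < tm_tapes V \<Longrightarrow> a \<le> tm_symbols V \<Longrightarrow> cK j a < KK" "(\<sigma>, A, \<sigma>', B) \<in> TR V"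
  shows "A \<subseteq> {..<3} \<times> {..<KK}" "B \<subseteq> {..<3} \<times> {..<KK}"
proof -
  have dm: "dm d < 3" for d by (cases d) auto
  have rd: "rdA j a \<subseteq> {..<3} \<times> {..<KK}" if "j < tm_tapes V" "a \<le> tm_symbols V" for j a
    using that assms(3,4) by (simp add: rdA_def)
  have wr: "rdB j act \<subseteq> {..<3} \<times> {..<KK}" if "j < tm_tapes V" "fst act \<le> tm_symbols V" for j act
    using that assms(3,4) dm by (simp add: rdB_def)
  have G: "3 \<le> tm_symbols V" using assms(1) by (simp add: wf_tm_def)
  have "A \<subseteq> {..<3} \<times> {..<KK} \<and> B \<subseteq> {..<3} \<times> {..<KK}"
    using assms(5)
  proof (cases rule: TR.cases)
    case (TR_act q ss j)
    have "ss ! j \<in> set ss" using TR_act(6,7) by (simp add: words_def)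
    then have "ss ! j \<le> tm_symbols V" using TR_act(6) by (simp add: words_def less_imp_le)
    moreover have "fst (snd (tm_delta V q ss) ! j) \<le> tm_symbols V"
      using wf_tmD(3)[OF assms(1) _ TR_act(6,7)] TR_act(5) by (simp add: live_def less_imp_le)
    ultimately show ?thesis unfolding TR_act(2,4) using rd wr TR_act(7) by blast
  next
    case TR_blank
    show ?thesis unfolding TR_blank(2,4) using rd[of 1 0] wr[of 1 "(0, Go_Left)"] assms(2) by simp
  next
    case (TR_bit b c)
    show ?thesis unfolding TR_bit(2,4) using rd[of 1 0] wr[of 1 "(if c then 2 else 1, Go_Left)"] assms(2) G by simp
  next
    case (TR_guess_end b)
    show ?thesis unfolding TR_guess_end(2,4)
      using rd[of 1 "tm_symbols V"] wr[of 1 "(0, Go_Right)"] assms(2) by simp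
  qed simp_all
  then show "A \<subseteq> {..<3} \<times> {..<KK}" "B \<subseteq> {..<3} \<times> {..<KK}" by simp_all
qed

lemma ex_bound_kinds:
  "\<exists>KK. (\<forall>j < tm_tapes V. hK j < KK) \<and> (\<forall>j < tm_tapes V. \<forall>a \<le> tm_symbols V. cK j a < KK)"
proof -
  have "finite (hK ` {..<tm_tapes V} \<union> (\<lambda>(j, a). cK j a) ` ({..<tm_tapes V} \<times> {..tm_symbols V}))" by simp
  then obtain KK where KK: "\<forall>k \<in> hK ` {..<tm_tapes V} \<union> (\<lambda>(j, a). cK j a) ` ({..<tm_tapes V} \<times> {..tm_symbols V}). k < KK"
    unfolding finite_nat_set_iff_bounded by blast
  have "hK j < KK" if "j < tm_tapes V" for j using KK that by simp
  moreover have "cK j a < KK" if "j < tm_tapes V" "a \<le> tm_symbols V" for j a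
    using KK[rule_format, of "cK j a"] that by (auto intro: rev_image_eqI[of "(j, a)"])
  ultimately show ?thesis by blast
qed

lemma ex_bound_states: "\<exists>SS. \<forall>(\<sigma>, A, \<sigma>', B) \<in> TR V. \<sigma> < SS \<and> \<sigma>' < SS"
proof -
  have "finite (fst ` TR V \<union> (\<lambda>y. fst (snd (snd y))) ` TR V)" using finite_TR by simp
  then obtain SS where SS: "\<forall>\<sigma> \<in> fst ` TR V \<union> (\<lambda>y. fst (snd (snd y))) ` TR V. \<sigma> < SS"
    unfolding finite_nat_set_iff_bounded by blast
  have "fst y < SS \<and> fst (snd (snd y)) < SS" if "y \<in> TR V" for y using SS that by simp
  then show ?thesis by (intro exI[of _ SS]) (auto simp: split_beta)
qed

lemma run_halted:
  assumes "halted V (run_tm V ws s)" "s \<le> t"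
  shows "run_tm V ws t = run_tm V ws s"
proof -
  have "(step_tm V ^^ (s + (t - s))) (init_config V ws) = run_tm V ws s"
    using funpow_step_halted[OF assms(1)] by (intro funpow_trans) (simp_all add: run_tm_def)
  then show ?thesis using assms(2) by (simp add: run_tm_def)
qed

text \<open>Acceptance is only required at some time, but a halting configuration never changes, so
  it is visible at every time after the halting bound.\<close>

lemma accepts_within:
  assumes "accepts V ws" "halts_within V ws s" "s \<le> t"
  shows "fst (run_tm V ws t) = tm_accept V"
proof -
  obtain t' where t': "fst (run_tm V ws t') = tm_accept V" using assms(1) by (auto simp: accepts_def)
  have s: "halted V (run_tm V ws s)" using assms(2) by (simp add: halts_within_def)
  show ?thesis
  proof (cases "t' \<le> t")
    case True
    have "halted V (run_tm V ws t')" using t' by (simp add: halted_def)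
    from run_halted[OF this True] t' show ?thesis by simp
  next
    case False
    then have "run_tm V ws t' = run_tm V ws s" using assms(3) by (intro run_halted[OF s]) simp
    then show ?thesis using run_halted[OF s assms(3)] t' by simp
  qed
qed

text \<open>The successive bindings are \<open>m\<close>, \<open>slack\<close>, \<open>T\<close>,
  the number \<open>2 * T + 3\<close> of positions, and the padding \<open>w\<close>; they supply
  the variables 1 to 5.\<close>

definition reduction_em :: "nat \<Rightarrow> nat \<Rightarrow> (nat \<times> (nat \<times> nat) set \<times> nat \<times> (nat \<times> nat) set) list \<Rightarrow> tm \<Rightarrow> em \<Rightarrow> em \<Rightarrow> em" where
  "reduction_em KK SS tr V em ez =
     Let em (Let ez (Let (For 0 (ones 1) \<oplus> For 1 (ones 1) \<oplus> For 2 (ones 1)) (Let (For 3 (ones 2) \<oplus> ones 3)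
       (Let (For 3 (For 4 (ones (5 * length (net.kinds KK tr)))) \<oplus> ones 18)
         (all_em KK SS tr 3 (init_em KK SS V) (final_em KK SS V))))))"

lemma scoped_reduction_em:
  assumes "scoped 1 em" "scoped 1 ez"
  shows "scoped 1 (reduction_em KK SS tr V em ez)"
proof -
  have "scoped 6 (init_em KK SS V j)" "scoped 6 (final_em KK SS V j)" for j
    by (simp_all add: init_em_def final_em_def scoped_bits scoped_layer del: bits.simps)
  then have "scoped 6 (all_em KK SS tr 3 (init_em KK SS V) (final_em KK SS V))" by (intro scoped_all_em)
  then show ?thesis using assms scoped_mono[OF assms(2), of 2]
    by (simp add: reduction_em_def eval_nat_numeral del: ones.simps)
qed

lemma reduction:
  assumes V: "polytime_verifier V"
  shows "\<exists>f. polytime_computable f \<and> (\<forall>x. \<exists>d. f x = encode_seq d \<and> degree_sequence d \<and>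
    (bipartite_multigraph_realizable d \<longleftrightarrow> (\<exists>u. length u \<le> poly q (length x) \<and> accepts V [x, u])))"
proof -
  from V obtain p :: "nat poly" where wf: "wf_tm V" "2 \<le> tm_tapes V"
    and p: "\<forall>x u. halts_within V [x, u] (poly p (length x + length u))"
    unfolding polytime_verifier_def by blast
  obtain KK where KK: "\<forall>j < tm_tapes V. hK j < KK" "\<forall>j < tm_tapes V. \<forall>a \<le> tm_symbols V. cK j a < KK"
    using ex_bound_kinds by blast
  obtain SS where SS: "\<forall>(\<sigma>, A, \<sigma>', B) \<in> TR V. \<sigma> < SS \<and> \<sigma>' < SS"
    using ex_bound_states by blast
  obtain tr where tr: "set tr = TR V" using finite_list[OF finite_TR] by blast
  \<comment> \<open>\<open>tq\<close> bounds the running time of \<open>V\<close> for all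
    certificates of admissible length, by monotonicity of polynomials. \<open>sq\<close> then covers
    \<open>tm_tapes V + 2\<close> rounds for each step and the two extra rounds that end the
    guessing and discard the tapes.\<close>
  define tq where "tq = p \<circ>\<^sub>p ([:0, 1:] + q)"
  define sq where "sq = smult (tm_tapes V + 2) tq + [:2:]"
  obtain em where em: "scoped 1 em" "\<forall>x n env. length (den x em (n # env)) = poly q n" using ex_poly_em by blast
  obtain ez where ez: "scoped 1 ez" "\<forall>x n env. length (den x ez (n # env)) = poly sq n" using ex_poly_em by blast
  define f where "f x = den x (reduction_em KK SS tr V em ez) [length x]" for x
  have "polytime_computable f"
    unfolding f_def by (rule polytime_computable_den[OF scoped_reduction_em[OF em(1) ez(1)]])
  moreover have "\<exists>d. f x = encode_seq d \<and> degree_sequence d \<and>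
    (bipartite_multigraph_realizable d \<longleftrightarrow> (\<exists>u. length u \<le> poly q (length x) \<and> accepts V [x, u]))" for x
  proof -
    define m where "m = poly q (length x)"
    define t where "t = poly tq (length x)"
    define slack where "slack = poly sq (length x)"
    define T where "T = length x + m + slack"
    define Z where "Z = T + 1"
    define w where "w = T * ((2 * Z + 1) * (5 * length (net.kinds KK tr))) + 18"
    have t: "t = poly p (length x + m)" by (simp add: t_def tq_def poly_pcompose m_def)
    have slack: "slack = (tm_tapes V + 2) * t + 2" by (simp add: slack_def sq_def t_def)
    have T0: "0 < T" by (simp add: T_def slack)
    interpret encoded KK SS Z T tr V x m slack
    proof unfold_locales
      fix \<sigma> A \<sigma>' B assume *: "(\<sigma>, A, \<sigma>', B) \<in> set tr"
      have "\<sigma> < SS \<and> \<sigma>' < SS" using bspec[OF SS *[unfolded tr]] by simp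
      moreover have "A \<subseteq> {..<3} \<times> {..<KK}" "B \<subseteq> {..<3} \<times> {..<KK}"
        by (rule TR_bounds[OF wf _ _ *[unfolded tr]]; simp add: KK)+
      ultimately show "\<sigma> < SS \<and> \<sigma>' < SS \<and> A \<subseteq> {..<3} \<times> {..<KK} \<and> B \<subseteq> {..<3} \<times> {..<KK}"
        by simp
    qed (use wf KK tr T0 in \<open>simp_all add: T_def Z_def\<close>)
    have "den x (reduction_em KK SS tr V em ez) [length x] =
        den x (all_em KK SS tr 3 (init_em KK SS V) (final_em KK SS V)) (env w)"
    proof -
      let ?n = "length x"
      have 1: "length (den x em [?n]) = m" using em(2) by (simp add: m_def)
      have 2: "length (den x ez [?n, m]) = slack" using ez(2) by (simp add: slack_def)
      have one: "length (den x (For v (ones a)) e) = e ! v * a" for v a e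
        by (rule length_den_For) simp
      have 3: "length (den x (For 0 (ones 1) \<oplus> For 1 (ones 1) \<oplus> For 2 (ones 1)) [?n, m, slack]) = T"
        unfolding den.simps(3) length_append one by (simp add: T_def)
      have 4: "length (den x (For 3 (ones 2) \<oplus> ones 3) [?n, m, slack, T]) = 2 * Z + 1"
        unfolding den.simps(3) length_append one by (simp add: Z_def)
      have two: "length (den x (For 3 (For 4 (ones a))) [?n, m, slack, T, N']) = T * (N' * a)" for a N'
        by (subst length_den_For[where a = "N' * a"]) (simp_all only: one, simp_all)
      have 5: "length (den x (For 3 (For 4 (ones (5 * length (net.kinds KK tr)))) \<oplus> ones 18) [?n, m, slack, T, 2 * Z + 1]) = w"
        unfolding den.simps(3) length_append two w_def by simp
      show ?thesis
        unfolding reduction_em_def den.simps(5) 1 append.simps 2 3 4 5 env6_def by (rule refl)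
    qed
    then have "f x = encode_seq (degs w)" unfolding f_def den_degs .
    moreover have "degree_sequence (degs w)" by (rule degree_sequence_degs) (simp add: w_def)
    moreover have "bipartite_multigraph_realizable (degs w) \<longleftrightarrow> (\<exists>u. length u \<le> m \<and> accepts V [x, u])"
    proof (rule realizable_degs_iff[OF w_def])
      have "t \<le> (tm_tapes V + 2) * t" by simp
      then show "t \<le> Z" "m + 2 + t * (tm_tapes V + 2) \<le> T"
        unfolding Z_def T_def slack by (simp_all add: mult.commute)
      fix u assume u: "length u \<le> m" "accepts V [x, u]"
      have "poly p (length x + length u) \<le> t" unfolding t using u(1) by (intro poly_nat_mono) simp
      then show "fst (run_tm V [x, u] t) = tm_accept V" by (rule accepts_within[OF u(2) p[rule_format]])
    qed
    ultimately show ?thesis unfolding m_def by blast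
  qed
  ultimately show ?thesis by blast
qed

theorem theorem20:
  "NP_hard (encode_seq ` {d. degree_sequence d})
           (encode_seq ` {d. degree_sequence d \<and> bipartite_multigraph_realizable d})"
  unfolding NP_hard_def
proof
  fix L assume "L \<in> NP"
  then obtain V and q :: "nat poly" where V: "polytime_verifier V"
    "\<And>x. x \<in> L \<longleftrightarrow> (\<exists>u. length u \<le> poly q (length x) \<and> accepts V [x, u])"
    unfolding NP_def by blast
  obtain f where f: "polytime_computable f" "\<And>x. \<exists>d. f x = encode_seq d \<and> degree_sequence d \<and>
    (bipartite_multigraph_realizable d \<longleftrightarrow> (\<exists>u. length u \<le> poly q (length x) \<and> accepts V [x, u]))"
    using reduction[OF V(1), of q] by blast
  have "f x \<in> encode_seq ` {d. degree_sequence d} \<and>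
    (x \<in> L \<longleftrightarrow> f x \<in> encode_seq ` {d. degree_sequence d \<and> bipartite_multigraph_realizable d})" for x
  proof -
    obtain d where d: "f x = encode_seq d" "degree_sequence d" "bipartite_multigraph_realizable d \<longleftrightarrow> x \<in> L"
      using f(2)[of x] V(2)[of x] by blast
    \<comment> \<open>Since the encoding is injective, \<open>f x\<close> encodes a yes-instance
      only if \<open>d\<close> itself is one.\<close>
    then show ?thesis using inj_encode_seq by (auto dest: injD)
  qed
  then show "\<exists>f. polytime_computable f \<and> (\<forall>x. f x \<in> encode_seq ` {d. degree_sequence d} \<and>
    (x \<in> L \<longleftrightarrow> f x \<in> encode_seq ` {d. degree_sequence d \<and> bipartite_multigraph_realizable d}))"
    using f(1) by blast
qed

end
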